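(* Let $0<\delta<1$. There are constants $c_1,c_2,c_3$ and $c_4$ that depend only on $L$ and $\delta$ for which the following holds. Let $X$ be a random matrix in $\mathbb{R}^{m\times T}$ whose law $\mu$ is isotropic and $L$-subgaussian with respect to the trace inner product, let $Y$ be a square-integrable random variable, let $A^*$ be the minimizer in $\mathbb{R}^{m\times T}$ of $A\mapsto\mathbb{E}(\langle A,X\rangle-Y)^2$, and assume that $\xi=\langle A^*,X\rangle-Y$ belongs to $L_q$ for some $q>2$. Assume that there is $V\in\mathbb{R}^{m\times T}$ that satisfies $\mathrm{rank}(V)\le s$ and $$\|A^*-V\|_1\le c_1\|\xi\|_{L_q}\, s\sqrt{\frac{\max\{m,T\}}{N}}.$$ Let $N\ge c_2 s\max\{m,T\}$ and $\lambda=c_3\|\xi\|_{L_q}\sqrt{\frac{\max\{m,T\}}{N}}$. Then with probability at least $1-\delta$, the trace norm regularization estimator $\hat A$ with regularization parameter $\lambda$ satisfies, for any $1\le p\le 2$, $$\|\hat A-A^*\|_p\le c_4\|\xi\|_{L_q}\, s^{1/p}\sqrt{\frac{\max\{m,T\}}{N}}.$$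
   Context: Here $m,T,N,s$ are positive integers and $\langle\cdot,\cdot\rangle$ is the trace inner product on $\mathbb{R}^{m\times T}$. For a matrix $A$ with singular values $(\sigma_i(A))$ arranged in non-increasing order and $p\ge1$, $\|A\|_p=(\sum_i\sigma_i^p(A))^{1/p}$ is the $p$-Schatten norm; $\|\cdot\|_1$ is the trace norm and $\|\cdot\|_2$ is the Hilbert–Schmidt norm. A probability measure $\mu$ on $\mathbb{R}^{m\times T}$ is isotropic if $\int\langle B,A\rangle^2\,d\mu(A)=\|B\|_2^2$ for every $B\in\mathbb{R}^{m\times T}$; it is $L$-subgaussian if $\|\langle B,\cdot\rangle\|_{L_p(\mu)}\le L\sqrt p\,\|\langle B,\cdot\rangle\|_{L_2(\mu)}$ for every $p\ge2$ and every $B\in\mathbb{R}^{m\times T}$. $\|\xi\|_{L_q}=(\mathbb{E}|\xi|^q)^{1/q}$; $\xi$ need not be independent of $X$. $(X_i,Y_i)_{i=1}^N$ are independent copies of $(X,Y)$. The trace norm regularization estimator with regularization parameter $\lambda>0$ is $$\hat A\in\operatorname{argmin}_{A\in\mathbb{R}^{m\times T}}\Big(\frac1N\sum_{i=1}^N(Y_i-\langle X_i,A\rangle)^2+\lambda\|A\|_1\Big).$$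
   Formalization: The constants c_3 and c_4 may depend on q as well as on L and δ (c_1 and c_2 depend only on L and δ); with constants uniform over all q>2 the claim fails, e.g. for m=T=s=1, Gaussian X and noise equal to a random sign on {|X|≥t} as q tends to 2. *)

theory Defs
  imports
    "HOL-Probability.Probability"
    "Jordan_Normal_Form.Char_Poly"
    "Jordan_Normal_Form.DL_Rank"
begin

definition trace_inner :: "real mat \<Rightarrow> real mat \<Rightarrow> real" where
  "trace_inner A B = sum_list (diag_mat (transpose_mat A * B))"

text \<open>
  The roots of the characteristic polynomial of \<open>A\<^sup>T A\<close>, counted with multiplicity, are its
  eigenvalues; there are \<open>dim_col A\<close> of them, and all but the largest
  \<open>min (dim_row A) (dim_col A)\<close> are zero.
\<close>

definition singular_values :: "real mat \<Rightarrow> real list" where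
  "singular_values A =
     take (min (dim_row A) (dim_col A))
       (rev (sorted_list_of_multiset
          (image_mset sqrt (proots (char_poly (transpose_mat A * A))))))"

definition schatten_norm :: "real \<Rightarrow> real mat \<Rightarrow> real" where
  "schatten_norm p A = (\<Sum>\<sigma>\<leftarrow>singular_values A. \<sigma> powr p) powr (1 / p)"

text \<open>
  The space of \<open>m \<times> T\<close> real matrices with its Borel sigma-algebra, which is generated by the entries.
\<close>

definition mat_borel :: "nat \<Rightarrow> nat \<Rightarrow> real mat measure" where
  "mat_borel m T =
     vimage_algebra (carrier_mat m T) (\<lambda>A. \<lambda>ij\<in>{..<m} \<times> {..<T}. A $$ ij)
       (Pi\<^sub>M ({..<m} \<times> {..<T}) (\<lambda>_. borel))"

definition in_Lp :: "'a measure \<Rightarrow> real \<Rightarrow> ('a \<Rightarrow> real) \<Rightarrow> bool" where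
  "in_Lp M p f \<longleftrightarrow> f \<in> borel_measurable M \<and> integrable M (\<lambda>x. \<bar>f x\<bar> powr p)"

text \<open>Only meaningful together with \<^const>\<open>in_Lp\<close>: the Bochner integral of a function that is
  not integrable is \<open>0\<close>.\<close>

definition Lp_norm :: "'a measure \<Rightarrow> real \<Rightarrow> ('a \<Rightarrow> real) \<Rightarrow> real" where
  "Lp_norm M p f = (\<integral>x. \<bar>f x\<bar> powr p \<partial>M) powr (1 / p)"

definition isotropic :: "nat \<Rightarrow> nat \<Rightarrow> real mat measure \<Rightarrow> bool" where
  "isotropic m T \<mu> \<longleftrightarrow>
     (\<forall>B\<in>carrier_mat m T.
        integrable \<mu> (\<lambda>A. (trace_inner B A)\<^sup>2) \<and>
        (\<integral>A. (trace_inner B A)\<^sup>2 \<partial>\<mu>) = (schatten_norm 2 B)\<^sup>2)"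

definition subgaussian :: "real \<Rightarrow> nat \<Rightarrow> nat \<Rightarrow> real mat measure \<Rightarrow> bool" where
  "subgaussian L m T \<mu> \<longleftrightarrow>
     (\<forall>p\<ge>2. \<forall>B\<in>carrier_mat m T.
        in_Lp \<mu> p (trace_inner B) \<and>
        Lp_norm \<mu> p (trace_inner B) \<le> L * sqrt p * Lp_norm \<mu> 2 (trace_inner B))"

text \<open>
  The pair \<open>(X, Y)\<close> is given by its joint law \<open>P\<close>: on the probability space \<open>P\<close> itself, \<open>X\<close> is
  \<^const>\<open>fst\<close> and \<open>Y\<close> is \<^const>\<open>snd\<close>. Working with laws keeps the type of the
  underlying probability space fixed, so that a constant chosen before \<open>P\<close> cannot depend on it.
\<close>

definition joint_law :: "nat \<Rightarrow> nat \<Rightarrow> (real mat \<times> real) measure \<Rightarrow> bool" where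
  "joint_law m T P \<longleftrightarrow> prob_space P \<and> sets P = sets (mat_borel m T \<Otimes>\<^sub>M borel)"

definition law_X :: "nat \<Rightarrow> nat \<Rightarrow> (real mat \<times> real) measure \<Rightarrow> real mat measure" where
  "law_X m T P = distr P (mat_borel m T) fst"

definition is_risk_minimizer ::
  "nat \<Rightarrow> nat \<Rightarrow> (real mat \<times> real) measure \<Rightarrow> real mat \<Rightarrow> bool" where
  "is_risk_minimizer m T P A \<longleftrightarrow>
     is_arg_min (\<lambda>A. \<integral>(x, y). (trace_inner A x - y)\<^sup>2 \<partial>P) (\<lambda>A. A \<in> carrier_mat m T) A"

definition noise :: "real mat \<Rightarrow> real mat \<times> real \<Rightarrow> real" where
  "noise A = (\<lambda>(x, y). trace_inner A x - y)"

definition sample_law ::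
  "nat \<Rightarrow> (real mat \<times> real) measure \<Rightarrow> (nat \<Rightarrow> real mat \<times> real) measure" where
  "sample_law N P = Pi\<^sub>M {..<N} (\<lambda>_. P)"

text \<open>
  \<open>Z i\<close> is the pair \<open>(X\<^sub>i, Y\<^sub>i)\<close>. The minimizer need not be unique.
\<close>

definition trace_norm_estimator ::
  "nat \<Rightarrow> nat \<Rightarrow> nat \<Rightarrow> real \<Rightarrow> (nat \<Rightarrow> real mat \<times> real) \<Rightarrow> real mat \<Rightarrow> bool" where
  "trace_norm_estimator m T N lam Z Ahat \<longleftrightarrow>
     is_arg_min
       (\<lambda>A. (1 / real N) * (\<Sum>i<N. (snd (Z i) - trace_inner (fst (Z i)) A)\<^sup>2)
            + lam * schatten_norm 1 A)
       (\<lambda>A. A \<in> carrier_mat m T) Ahat"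

end

theory Submission
  imports Defs
begin

text \<open>
  Put \<open>d = max m T\<close>. Let \<open>M\<close> be the average of the matrices \<open>\<xi>\<^sub>i X\<^sub>i\<close> and \<open>Q(D)\<close> the average of
  \<open>\<langle>X\<^sub>i, D\<rangle>\<^sup>2\<close>. Optimality of the estimator and decomposability of the trace norm reduce the claim to
  two events: the operator norm of \<open>M\<close> is at most a constant times \<open>\<parallel>\<xi>\<parallel> \<surd>(d / N)\<close>, and \<open>Q\<close> is bounded
  below on matrices whose trace norm is at most a multiple of \<open>\<surd>s\<close> times their Hilbert-Schmidt norm.

  Both events are read off one finite set of rank-one matrices: rounding the coordinates of
  \<open>\<surd>m u\<close> independently at random to adjacent integers writes \<open>u v\<^sup>T\<close> as an exact convex combination of
  outer products of scaled lattice points, of which there are at most exponentially many in \<open>d\<close>.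
  For the first event a union bound suffices, after \<open>\<xi>\<^sub>i \<langle>X\<^sub>i, g\<rangle>\<close> is truncated at level \<open>\<surd>(N / d)\<close>:
  Bernstein's inequality controls the truncated sums, and fewer than \<open>d\<close> terms are larger, which are
  controlled by the \<open>L\<^sub>q\<close> norm of the noise and the subgaussian tails of the design.
  For the second event, Maurey's empirical method reduces the lower bound to sums of order \<open>s\<close> many
  lattice matrices, where a one-sided Chernoff bound and a union bound apply. No symmetrisation
  or chaining is needed.
\<close>

section \<open>Spectral theorem for symmetric matrices\<close>

text \<open>The noise has only q > 2 moments and may depend on the design, so its products with the
  design need not have exponential moments, and conditioning on the design does not leave centred
  noise. Two facts stand in for independence: minimality of the risk makes the noise orthogonal to
  every linear functional of the design, and a Young inequality bounds the second moment of the
  products. The union over d-element subsets costs a factor 1 + ln (N / d); it is at most a constant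
  times (N / d) powr (1 - 2 / q), exactly what the q-th moment of the noise can pay. Since the
  convex combination of lattice matrices is exact, bounds on them pass to all matrices without
  discretisation error. The number k of points in a Maurey sum is dictated by the cone of possible
  errors: there the trace norm n and the Hilbert-Schmidt norm f satisfy n <= 10 sqrt s f, the
  sampling error is n^2 C / (k - 1), and k - 1 >= 400 C s leaves f^2 / 4. There are at most 2304^(d
  k) such sums; the logarithm of this number, of order s d, is what N has to dominate.\<close>

definition dot :: "nat \<Rightarrow> (nat \<Rightarrow> real) \<Rightarrow> (nat \<Rightarrow> real) \<Rightarrow> real" where
  "dot n x y = (\<Sum>i<n. x i * y i)"

text \<open>Vectors are total functions of which only the first n values count. Families carry an
  arbitrary index set, so that the eigenvectors with nonzero eigenvalue form a subfamily without
  reindexing.\<close>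

definition orthonormal :: "nat \<Rightarrow> 'k set \<Rightarrow> ('k \<Rightarrow> nat \<Rightarrow> real) \<Rightarrow> bool" where
  "orthonormal n K v \<longleftrightarrow> (\<forall>k\<in>K. \<forall>l\<in>K. dot n (v k) (v l) = (if k = l then 1 else 0))"

lemma dot_commute: "dot n x y = dot n y x"
  by (simp add: dot_def mult.commute)

lemma dot_add_left: "dot n (\<lambda>i. x i + y i) z = dot n x z + dot n y z"
  by (simp add: dot_def ring_distribs sum.distrib)

lemma dot_diff_left: "dot n (\<lambda>i. x i - y i) z = dot n x z - dot n y z"
  by (simp add: dot_def ring_distribs sum_subtractf)

lemma dot_scale_left: "dot n (\<lambda>i. c * x i) z = c * dot n x z"
  by (simp add: dot_def sum_distrib_left mult.assoc)

lemma dot_sum_left: "dot n (\<lambda>i. \<Sum>k\<in>K. f k i) z = (\<Sum>k\<in>K. dot n (f k) z)"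
  unfolding dot_def sum_distrib_right by (rule sum.swap)

lemma dot_add_right: "dot n z (\<lambda>i. x i + y i) = dot n z x + dot n z y"
  by (metis dot_add_left dot_commute)

lemma dot_diff_right: "dot n z (\<lambda>i. x i - y i) = dot n z x - dot n z y"
  by (metis dot_diff_left dot_commute)

lemma dot_scale_right: "dot n z (\<lambda>i. c * x i) = c * dot n z x"
  by (metis dot_scale_left dot_commute)

lemma dot_sum_right: "dot n z (\<lambda>i. \<Sum>k\<in>K. f k i) = (\<Sum>k\<in>K. dot n z (f k))"
  by (subst dot_commute, subst dot_sum_left) (simp add: dot_commute)

lemma dot_scale_left': "dot n (\<lambda>i. x i * c) z = c * dot n x z"
  by (simp add: dot_def sum_distrib_left mult_ac)

lemma dot_scale_right': "dot n z (\<lambda>i. x i * c) = c * dot n z x"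
  by (metis dot_scale_left' dot_commute)

lemmas dot_simps = dot_add_left dot_diff_left dot_scale_left dot_sum_left
  dot_add_right dot_diff_right dot_scale_right dot_sum_right

lemma dot_self_nonneg [simp]: "0 \<le> dot n x x"
  by (simp add: dot_def sum_nonneg)

lemma dot_self_eq_0: "dot n x x = 0 \<longleftrightarrow> (\<forall>i<n. x i = 0)"
  unfolding dot_def by (subst sum_nonneg_eq_0_iff) auto

lemma dot_cong: "(\<And>i. i < n \<Longrightarrow> x i = x' i) \<Longrightarrow> (\<And>i. i < n \<Longrightarrow> y i = y' i) \<Longrightarrow> dot n x y = dot n x' y'"
  by (simp add: dot_def)

lemma dot_Cauchy_Schwarz: "(dot n x y)\<^sup>2 \<le> dot n x x * dot n y y"
  using Cauchy_Schwarz_ineq_sum[of x y "{..<n}"] by (simp add: dot_def power2_eq_square)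

lemma abs_dot_le: "\<bar>dot n x y\<bar> \<le> sqrt (dot n x x) * sqrt (dot n y y)"
  using real_sqrt_le_mono[OF dot_Cauchy_Schwarz[of n x y]] by (simp add: real_sqrt_mult)

text \<open>Pythagoras for the projection onto the span of the family. Nonnegativity of the squared
  residual is Bessel's inequality; its vanishing will give completeness.\<close>

lemma orthonormal_residual:
  fixes x :: "nat \<Rightarrow> real"
  assumes "finite K" "orthonormal n K v"
  defines "r \<equiv> \<lambda>i. x i - (\<Sum>k\<in>K. dot n (v k) x * v k i)"
  shows "dot n r r = dot n x x - (\<Sum>k\<in>K. (dot n (v k) x)\<^sup>2)"
    and "k \<in> K \<Longrightarrow> dot n (v k) r = 0"
proof -
  have 1: "(\<Sum>l\<in>K. dot n (v l) x * dot n (v k) (v l)) = dot n (v k) x" if "k \<in> K" for k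
  proof -
    have "(\<Sum>l\<in>K. dot n (v l) x * dot n (v k) (v l)) = (\<Sum>l\<in>K. if l = k then dot n (v k) x else 0)"
      using assms(2) that by (intro sum.cong) (auto simp: orthonormal_def)
    then show ?thesis using that assms(1) by simp
  qed
  show 2: "dot n (v k) r = 0" if "k \<in> K" for k
    unfolding r_def using 1[OF that] by (simp add: dot_simps)
  have "dot n r r = dot n x r - (\<Sum>k\<in>K. dot n (v k) x * dot n (v k) r)"
    by (subst r_def) (simp add: dot_diff_left dot_sum_left dot_scale_left)
  also have "\<dots> = dot n x r" using 2 by simp
  also have "\<dots> = dot n x x - (\<Sum>k\<in>K. (dot n (v k) x)\<^sup>2)"
    unfolding r_def by (simp add: dot_simps power2_eq_square dot_commute[of n x "v _"])
  finally show "dot n r r = dot n x x - (\<Sum>k\<in>K. (dot n (v k) x)\<^sup>2)" .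
qed

lemma bessel:
  assumes "finite K" "orthonormal n K v"
  shows "(\<Sum>k\<in>K. (dot n (v k) x)\<^sup>2) \<le> dot n x x"
proof -
  have "0 \<le> dot n x x - (\<Sum>k\<in>K. (dot n (v k) x)\<^sup>2)"
    by (subst orthonormal_residual(1)[OF assms, symmetric]) (rule dot_self_nonneg)
  then show ?thesis by simp
qed

lemma dot_unit:
  assumes "j < n"
  shows "dot n x (\<lambda>i. if i = j then 1 else 0) = x j"
proof -
  have "dot n x (\<lambda>i. if i = j then 1 else 0) = (\<Sum>i<n. if i = j then x j else 0)"
    unfolding dot_def by (intro sum.cong) auto
  then show ?thesis using assms by simp
qed

lemma orthonormal_sum_sq:
  assumes "orthonormal n K v"
  shows "(\<Sum>j<n. \<Sum>k\<in>K. (v k j)\<^sup>2) = real (card K)"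
proof -
  have "(\<Sum>j<n. \<Sum>k\<in>K. (v k j)\<^sup>2) = (\<Sum>k\<in>K. dot n (v k) (v k))"
    by (subst sum.swap) (simp add: dot_def power2_eq_square)
  also have "\<dots> = (\<Sum>k\<in>K. 1)"
    using assms by (intro sum.cong) (auto simp: orthonormal_def)
  finally show ?thesis by simp
qed

lemma orthonormal_row_le:
  assumes "finite K" "orthonormal n K v" "j < n"
  shows "(\<Sum>k\<in>K. (v k j)\<^sup>2) \<le> 1"
  using bessel[OF assms(1,2), of "\<lambda>i. if i = j then 1 else 0"] assms(3) by (simp add: dot_unit)

text \<open>Double counting of squared entries stands in for dimension theory: counted by vectors
  the total is \<open>card K\<close>, and each coordinate contributes at most 1 by Bessel against a
  standard basis vector.\<close>

lemma orthonormal_card_le: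
  assumes "finite K" "orthonormal n K v"
  shows "card K \<le> n"
proof -
  have "real (card K) \<le> (\<Sum>j<n. 1)"
    unfolding orthonormal_sum_sq[OF assms(2), symmetric]
    by (intro sum_mono orthonormal_row_le[OF assms]) simp
  then show ?thesis by simp
qed

text \<open>Equality in the double count forces every coordinate to contribute exactly 1, so each
  standard basis vector has zero residual and equals its own expansion.\<close>

lemma orthonormal_complete:
  assumes "finite K" "orthonormal n K v" "card K = n" "i < n" "j < n"
  shows "(\<Sum>k\<in>K. v k i * v k j) = (if i = j then 1 else 0)"
proof -
  have row: "(\<Sum>k\<in>K. (v k j)\<^sup>2) = 1" if "j < n" for j
  proof -
    have "(\<Sum>j<n. 1 - (\<Sum>k\<in>K. (v k j)\<^sup>2)) = 0"
      unfolding sum_subtractf orthonormal_sum_sq[OF assms(2)] using assms(3) by simp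
    then have "\<forall>j\<in>{..<n}. 1 - (\<Sum>k\<in>K. (v k j)\<^sup>2) = 0"
      by (subst (asm) sum_nonneg_eq_0_iff) (simp_all add: orthonormal_row_le[OF assms(1,2)])
    then show ?thesis using that by auto
  qed
  let ?e = "\<lambda>i. if i = j then 1 else (0::real)"
  have "dot n (\<lambda>i. ?e i - (\<Sum>k\<in>K. dot n (v k) ?e * v k i)) (\<lambda>i. ?e i - (\<Sum>k\<in>K. dot n (v k) ?e * v k i)) = 0"
    using orthonormal_residual(1)[OF assms(1,2), of ?e] row[OF assms(5)] assms(5) by (simp add: dot_unit)
  then have "?e i - (\<Sum>k\<in>K. dot n (v k) ?e * v k i) = 0"
    using assms(4) unfolding dot_self_eq_0 by blast
  then show ?thesis using assms(5) by (simp add: dot_unit mult.commute)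
qed

definition mat_vec :: "nat \<Rightarrow> (nat \<Rightarrow> nat \<Rightarrow> real) \<Rightarrow> (nat \<Rightarrow> real) \<Rightarrow> nat \<Rightarrow> real" where
  "mat_vec n S x i = dot n (S i) x"

lemma mat_vec_symmetric:
  assumes "\<And>i j. i < n \<Longrightarrow> j < n \<Longrightarrow> S i j = S j i"
  shows "dot n x (mat_vec n S y) = dot n (mat_vec n S x) y"
proof -
  have "dot n x (mat_vec n S y) = (\<Sum>i<n. \<Sum>j<n. x i * S i j * y j)"
    unfolding mat_vec_def dot_def sum_distrib_left by (simp add: mult.assoc)
  also have "\<dots> = (\<Sum>j<n. \<Sum>i<n. x i * S j i * y j)"
    by (subst sum.swap) (intro sum.cong refl, simp add: assms)
  also have "\<dots> = dot n (mat_vec n S x) y"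
    unfolding mat_vec_def dot_def sum_distrib_right by (intro sum.cong refl) (simp add: mult.commute)
  finally show ?thesis .
qed

lemma compact_product_box:
  fixes B :: "nat \<Rightarrow> real set"
  assumes "\<And>i. compact (B i)"
  shows "compact (PiE UNIV B)"
proof -
  have "compactin (product_topology (\<lambda>i. euclidean) UNIV) (PiE UNIV B)"
    unfolding compactin_PiE using assms by simp
  then show ?thesis by (simp add: euclidean_product_topology)
qed

lemma continuous_on_dot:
  assumes "\<And>i. continuous_on A (\<lambda>x. f x i)" "\<And>i. continuous_on A (\<lambda>x. g x i)"
  shows "continuous_on A (\<lambda>x. dot n (f x) (g x))"
  unfolding dot_def by (intro continuous_on_sum continuous_on_mult assms)

lemma continuous_on_coordinate: "continuous_on A (\<lambda>x :: nat \<Rightarrow> real. x i)"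
  by (rule continuous_on_subset[OF continuous_on_product_coordinates]) simp

text \<open>Pinning the coordinates from n on to 0 makes the set a closed part of a product of
  compact sets, so Tychonoff applies in the topology of functions.\<close>

lemma compact_unit_sphere:
  "compact {x. (\<forall>i\<ge>n. x i = 0) \<and> dot n x x = 1 \<and> (\<forall>l<k. dot n x (v l) = 0)}" (is "compact ?K")
proof -
  let ?B = "PiE UNIV (\<lambda>i. if i < n then {-1..1} else {0::real})"
  have "closed {x. dot n x x = 1}"
    by (intro closed_Collect_eq continuous_on_dot continuous_on_const continuous_on_coordinate)
  moreover have "closed {x. \<forall>l<k. dot n x (v l) = 0}"
    by (intro closed_Collect_all closed_Collect_imp open_Collect_const
          closed_Collect_eq continuous_on_dot continuous_on_const continuous_on_coordinate)
  ultimately have "compact (?B \<inter> ({x. dot n x x = 1} \<inter> {x. \<forall>l<k. dot n x (v l) = 0}))"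
    by (intro compact_Int_closed compact_product_box) auto
  also have "?B \<inter> ({x. dot n x x = 1} \<inter> {x. \<forall>l<k. dot n x (v l) = 0}) = ?K"
  proof (intro Set.set_eqI iffI)
    fix x assume x: "x \<in> ?B \<inter> ({x. dot n x x = 1} \<inter> {x. \<forall>l<k. dot n x (v l) = 0})"
    then have "x i = 0" if "i \<ge> n" for i
      using that by (auto simp: PiE_def Pi_def dest!: spec[of _ i])
    then show "x \<in> ?K" using x by auto
  next
    fix x assume x: "x \<in> ?K"
    have "x i \<in> {-1..1}" if "i < n" for i
    proof -
      have "(x i)\<^sup>2 \<le> (\<Sum>i<n. (x i)\<^sup>2)" using that by (intro member_le_sum) auto
      also have "\<dots> = 1" using x by (simp add: dot_def power2_eq_square)
      finally show ?thesis using abs_le_square_iff[of "x i" 1] by (auto simp: abs_le_iff)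
    qed
    then show "x \<in> ?B \<inter> ({x. dot n x x = 1} \<inter> {x. \<forall>l<k. dot n x (v l) = 0})"
      using x by (auto simp: PiE_def Pi_def)
  qed
  finally show ?thesis .
qed

text \<open>The next eigenvector maximises the Rayleigh quotient on the orthogonal complement of the
  eigenvectors found so far.\<close>

lemma symmetric_next_eigenvector:
  assumes sym: "\<And>i j. i < n \<Longrightarrow> j < n \<Longrightarrow> S i j = S j i"
    and on: "orthonormal n {..<k} v" and kn: "k < n"
    and ev: "\<And>l i. l < k \<Longrightarrow> i < n \<Longrightarrow> mat_vec n S (v l) i = d l * v l i"
  shows "\<exists>x c. dot n x x = 1 \<and> (\<forall>l<k. dot n x (v l) = 0) \<and> (\<forall>i<n. mat_vec n S x i = c * x i)"
proof -
  let ?K = "{x. (\<forall>i\<ge>n. x i = 0) \<and> dot n x x = 1 \<and> (\<forall>l<k. dot n x (v l) = 0)}"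
  let ?f = "\<lambda>x. dot n x (mat_vec n S x)"
  have normalise: "\<exists>c>0. \<exists>y\<in>?K. (\<forall>i<n. y i = c * x i) \<and> c\<^sup>2 * dot n x x = 1"
    if "dot n x x \<noteq> 0" "\<forall>l<k. dot n x (v l) = 0" for x
  proof -
    define c where "c = 1 / sqrt (dot n x x)"
    have pos: "dot n x x > 0" using that(1) dot_self_nonneg[of n x] by linarith
    have c: "c > 0" "c\<^sup>2 * dot n x x = 1"
      using pos by (auto simp: c_def power_divide)
    define y where "y i = (if i < n then c * x i else 0)" for i
    have d: "dot n y z = c * dot n x z" for z
      unfolding dot_scale_left[symmetric] by (rule dot_cong) (auto simp: y_def)
    have "dot n y y = c\<^sup>2 * dot n x x"
      unfolding d by (subst dot_commute, unfold d) (simp add: power2_eq_square)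
    then have "y \<in> ?K" using that(2) c d by (auto simp: y_def)
    then show ?thesis using c y_def by (intro exI[of _ c] conjI bexI[of _ y]) auto
  qed
  \<comment> \<open>Nonemptiness of the sphere: the squared entries of k < n unit vectors sum to k,
    so some standard basis vector has a nonzero residual, which is then normalised.\<close>
  have "\<exists>j<n. (\<Sum>l<k. (v l j)\<^sup>2) \<noteq> 1"
  proof (rule ccontr)
    assume "\<not> ?thesis"
    then have "(\<Sum>j<n. \<Sum>l<k. (v l j)\<^sup>2) = (\<Sum>j<n. 1)" by (intro sum.cong) auto
    then show False using orthonormal_sum_sq[OF on] kn by simp
  qed
  then obtain j where j: "j < n" "(\<Sum>l<k. (v l j)\<^sup>2) \<noteq> 1" by blast
  let ?e = "\<lambda>i. if i = j then 1 else (0::real)"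
  let ?r = "\<lambda>i. ?e i - (\<Sum>l<k. dot n (v l) ?e * v l i)"
  have "dot n ?r ?r \<noteq> 0"
    using orthonormal_residual(1)[OF _ on, of ?e] j by (simp add: dot_unit)
  moreover have "\<forall>l<k. dot n ?r (v l) = 0"
    using orthonormal_residual(2)[OF _ on, of _ ?e] by (auto simp: dot_commute)
  ultimately have "?K \<noteq> {}" using normalise[of ?r] by auto
  moreover have "continuous_on ?K ?f"
    unfolding mat_vec_def by (intro continuous_on_dot continuous_on_const continuous_on_coordinate)
  ultimately have "\<exists>x\<in>?K. \<forall>y\<in>?K. ?f y \<le> ?f x"
    by (rule continuous_attains_sup[OF compact_unit_sphere])
  then obtain x where x: "x \<in> ?K" and max: "\<And>y. y \<in> ?K \<Longrightarrow> ?f y \<le> ?f x"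
    by (elim bexE) (rule that, assumption, erule bspec)
  define c where "c = ?f x"
  have x1: "dot n x x = 1" and xv: "\<And>l. l < k \<Longrightarrow> dot n x (v l) = 0" using x by auto
  have f_cong: "?f y = a\<^sup>2 * ?f z" if "\<And>i. i < n \<Longrightarrow> y i = a * z i" for y z a
  proof -
    have "?f y = dot n (\<lambda>i. a * z i) (\<lambda>i. a * mat_vec n S z i)"
      unfolding mat_vec_def dot_scale_right[symmetric] by (intro dot_cong) (auto simp: that)
    then show ?thesis by (simp add: dot_simps power2_eq_square)
  qed
  have rayleigh: "?f z \<le> c * dot n z z" if z: "\<forall>l<k. dot n z (v l) = 0" for z
  proof (cases "dot n z z = 0")
    case True
    then have "?f z = 0\<^sup>2 * ?f z" by (intro f_cong) (simp add: dot_self_eq_0)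
    then show ?thesis using True by simp
  next
    case False
    obtain a y where a: "a > 0" "y \<in> ?K" "\<forall>i<n. y i = a * z i" "a\<^sup>2 * dot n z z = 1"
      using normalise[OF False z] by blast
    have "a\<^sup>2 * ?f z \<le> c" using max[OF a(2)] f_cong[of y a z] a(3) by (simp add: c_def)
    also have "c = a\<^sup>2 * (c * dot n z z)" using a(4) by (simp add: algebra_simps)
    finally show ?thesis using a(1) by simp
  qed
  \<comment> \<open>The claim is r = 0. Since r is orthogonal to x and to all earlier eigenvectors,
    moving from x in the direction r stays admissible and would raise the Rayleigh quotient to first
    order.\<close>
  define r where "r i = mat_vec n S x i - c * x i" for i
  have rv: "dot n r (v l) = 0" if "l < k" for l
  proof -
    have "dot n (mat_vec n S x) (v l) = dot n x (mat_vec n S (v l))"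
      using mat_vec_symmetric[OF sym] by simp
    also have "\<dots> = dot n x (\<lambda>i. d l * v l i)" by (rule dot_cong) (auto simp: ev that)
    finally show ?thesis unfolding r_def by (simp add: dot_simps xv that)
  qed
  have rx: "dot n r x = 0"
    unfolding r_def using x1 by (simp add: dot_simps c_def dot_commute)
  define b where "b = dot n r r"
  have b: "dot n r (mat_vec n S x) = b"
  proof -
    have "b = dot n r (\<lambda>i. mat_vec n S x i - c * x i)"
      unfolding b_def by (rule dot_cong) (auto simp: r_def)
    then have "b = dot n r (mat_vec n S x) - c * dot n r x"
      by (simp only: dot_diff_right dot_scale_right)
    then show ?thesis using rx by simp
  qed
  have perturb: "c + 2 * t * b + t\<^sup>2 * ?f r \<le> c * (1 + t\<^sup>2 * b)" for t
  proof -
    let ?z = "\<lambda>i. x i + t * r i"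
    have m: "mat_vec n S ?z = (\<lambda>i. mat_vec n S x i + t * mat_vec n S r i)"
      by (auto simp: mat_vec_def dot_simps)
    have "dot n x (mat_vec n S r) = b"
      using mat_vec_symmetric[of n S x r, OF sym] b by (simp add: dot_commute)
    then have "?f ?z = c + 2 * t * b + t\<^sup>2 * ?f r"
      unfolding m using b by (simp add: dot_simps c_def power2_eq_square algebra_simps)
    moreover have "dot n ?z ?z = 1 + t\<^sup>2 * b"
      using rx x1 by (simp add: dot_simps b_def dot_commute[of n x r] power2_eq_square algebra_simps)
    moreover have "\<forall>l<k. dot n ?z (v l) = 0" using xv rv by (simp add: dot_simps)
    ultimately show ?thesis using rayleigh[of ?z] by simp
  qed
  have q: "2 * t * b \<le> t\<^sup>2 * (c * b - ?f r)" for t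
    using perturb[of t] by (simp add: algebra_simps)
  have "b = 0"
  proof (rule ccontr)
    assume "b \<noteq> 0"
    then have bp: "b > 0" by (simp add: b_def order_less_le)
    define e where "e = c * b - ?f r"
    \<comment> \<open>Small enough that the second-order term t e is at most b, against the
      first-order gain 2 b; the added 1 covers e = 0.\<close>
    define t where "t = b / (\<bar>e\<bar> + 1)"
    have t: "t > 0" using bp by (simp add: t_def)
    have "2 * t * b \<le> t\<^sup>2 * e" using q e_def by simp
    then have "2 * b \<le> t * e" using t by (simp add: power2_eq_square)
    also have "\<dots> \<le> t * (\<bar>e\<bar> + 1)" using t by (intro mult_left_mono) auto
    also have "\<dots> = b" by (simp add: t_def)
    finally show False using bp by simp
  qed
  then have "\<forall>i<n. mat_vec n S x i = c * x i"
    using dot_self_eq_0[of n r] by (auto simp: b_def r_def)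
  then show ?thesis using x1 xv by blast
qed

theorem symmetric_eigenbasis:
  assumes sym: "\<And>i j. i < n \<Longrightarrow> j < n \<Longrightarrow> S i j = S j i"
  shows "\<exists>v d. orthonormal n {..<n} v \<and> (\<forall>k<n. \<forall>i<n. mat_vec n S (v k) i = d k * v k i)"
proof -
  have "\<exists>v d. orthonormal n {..<k} v \<and> (\<forall>l<k. \<forall>i<n. mat_vec n S (v l) i = d l * v l i)" if "k \<le> n" for k
    using that
  proof (induction k)
    case 0
    then show ?case by (auto simp: orthonormal_def)
  next
    case (Suc k)
    then obtain v d where v: "orthonormal n {..<k} v"
        "\<And>l i. l < k \<Longrightarrow> i < n \<Longrightarrow> mat_vec n S (v l) i = d l * v l i" by auto
    obtain x c where x: "dot n x x = 1" "\<forall>l<k. dot n x (v l) = 0" "\<forall>i<n. mat_vec n S x i = c * x i"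
      using symmetric_next_eigenvector[of n S, OF sym v(1) _ v(2)] Suc.prems by auto
    have "orthonormal n {..<Suc k} (v(k := x))"
      using v(1) x(1,2) by (auto simp: orthonormal_def less_Suc_eq dot_commute)
    moreover have "\<forall>l<Suc k. \<forall>i<n. mat_vec n S ((v(k := x)) l) i = (d(k := c)) l * (v(k := x)) l i"
      using v(2) x(3) by (auto simp: less_Suc_eq)
    ultimately show ?case by blast
  qed
  then show ?thesis by blast
qed

section \<open>Singular values\<close>

abbreviation entries :: "real mat \<Rightarrow> nat \<Rightarrow> nat \<Rightarrow> real" where
  "entries A \<equiv> \<lambda>i j. A $$ (i, j)"

abbreviation fun_mat :: "nat \<Rightarrow> nat \<Rightarrow> (nat \<Rightarrow> nat \<Rightarrow> real) \<Rightarrow> real mat" where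
  "fun_mat m T a \<equiv> mat m T (\<lambda>(i, j). a i j)"

definition frob :: "nat \<Rightarrow> nat \<Rightarrow> (nat \<Rightarrow> nat \<Rightarrow> real) \<Rightarrow> (nat \<Rightarrow> nat \<Rightarrow> real) \<Rightarrow> real" where
  "frob m T a b = (\<Sum>i<m. dot T (a i) (b i))"

lemma trace_inner_eq_frob:
  assumes "A \<in> carrier_mat m T" "B \<in> carrier_mat m T"
  shows "trace_inner A B = frob m T (entries A) (entries B)"
proof -
  have "trace_inner A B = (\<Sum>j<T. \<Sum>i<m. A $$ (i, j) * B $$ (i, j))"
    using assms unfolding trace_inner_def diag_mat_def
    by (simp add: sum_list_distinct_conv_sum_set scalar_prod_def atLeast0LessThan row_transpose)
  also have "\<dots> = frob m T (entries A) (entries B)"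
    unfolding frob_def dot_def by (rule sum.swap)
  finally show ?thesis .
qed

text \<open>\<open>singular_values\<close> cuts a decreasing list. If a positive entry were cut off,
  the r entries before it would be positive too and there would be more than r nonzero ones; so only
  zeros are lost, which \<open>f\<close> maps to 0.\<close>

lemma sum_list_take_decreasing:
  fixes M :: "real multiset"
  assumes nonneg: "\<And>x. x \<in># M \<Longrightarrow> 0 \<le> x" and r: "size {#x \<in># M. x \<noteq> 0#} \<le> r" and f0: "f 0 = (0::real)"
  shows "(\<Sum>x\<leftarrow>take r (rev (sorted_list_of_multiset M)). f x) = (\<Sum>x\<in>#M. f x)"
proof -
  define xs where "xs = rev (sorted_list_of_multiset M)"
  have mset_xs: "mset xs = M" by (simp add: xs_def)
  have sorted: "sorted_wrt (\<ge>) xs" by (simp add: xs_def sorted_wrt_rev)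
  have zero: "x = 0" if x: "x \<in> set (drop r xs)" for x
  proof (rule ccontr)
    assume "x \<noteq> 0"
    moreover have "x \<in># M" using x in_set_dropD mset_xs by fastforce
    ultimately have pos: "x > 0" using nonneg by (simp add: order_less_le)
    have "sorted_wrt (\<ge>) (take r xs @ drop r xs)" using sorted by simp
    then have "\<forall>y\<in>set (take r xs). y \<noteq> 0"
      using x pos unfolding sorted_wrt_append by force
    then have "filter (\<lambda>y. y \<noteq> 0) (take r xs) = take r xs" by simp
    moreover have "length (take r xs) = r" using x by (cases "r \<le> length xs") auto
    moreover have "filter (\<lambda>y. y \<noteq> 0) (drop r xs) \<noteq> []"
      using x \<open>x \<noteq> 0\<close> by (auto simp: filter_empty_conv)
    ultimately have "length (filter (\<lambda>y. y \<noteq> 0) (take r xs @ drop r xs)) > r"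
      by (simp only: filter_append length_append) simp
    then have "length (filter (\<lambda>y. y \<noteq> 0) xs) > r" by simp
    moreover have "length (filter (\<lambda>y. y \<noteq> 0) xs) = size {#x \<in># M. x \<noteq> 0#}"
      unfolding mset_xs[symmetric] by (metis mset_filter size_mset)
    ultimately show False using r by simp
  qed
  have "(\<Sum>x\<in>#M. f x) = (\<Sum>x\<leftarrow>take r xs @ drop r xs. f x)"
    by (simp add: mset_xs[symmetric] sum_mset_sum_list[symmetric])
  also have "\<dots> = (\<Sum>x\<leftarrow>take r xs. f x) + (\<Sum>x\<leftarrow>drop r xs. f x)"
    by (simp only: map_append sum_list.append)
  also have "map f (drop r xs) = map (\<lambda>_. 0) (drop r xs)"
    using zero f0 by (intro map_cong) auto
  finally show ?thesis by (simp add: xs_def sum_list_0)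
qed

text \<open>Similarity to a diagonal matrix, with the eigenvectors as change of basis, yields the
  roots together with their multiplicities, which the list of singular values records.\<close>

lemma char_poly_eigenbasis:
  assumes on: "orthonormal n {..<n} v"
    and ev: "\<And>k i. k < n \<Longrightarrow> i < n \<Longrightarrow> mat_vec n S (v k) i = d k * v k i"
  shows "proots (char_poly (fun_mat n n S)) = image_mset d (mset_set {..<n})"
proof -
  let ?P = "mat n n (\<lambda>(i, k). v k i)" and ?Q = "mat n n (\<lambda>(k, i). v k i)"
  let ?D = "mat n n (\<lambda>(k, l). if k = l then d k else 0)"
  have complete: "(\<Sum>k<n. v k i * v k j) = (if i = j then 1 else 0)" if "i < n" "j < n" for i j
    using orthonormal_complete[OF _ on _ that] by simp
  have QP: "?Q * ?P = 1\<^sub>m n"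
    using on by (intro eq_matI) (auto simp: scalar_prod_def atLeast0LessThan orthonormal_def dot_def)
  have PQ: "?P * ?Q = 1\<^sub>m n"
    using complete by (intro eq_matI) (auto simp: scalar_prod_def atLeast0LessThan)
  have PD: "?P * ?D = mat n n (\<lambda>(i, k). d k * v k i)"
    by (intro eq_matI) (auto simp: scalar_prod_def atLeast0LessThan if_distrib cong: if_cong)
  have "fun_mat n n S = ?P * ?D * ?Q"
  proof (intro eq_matI)
    fix i j assume "i < dim_row (?P * ?D * ?Q)" "j < dim_col (?P * ?D * ?Q)"
    then have ij: "i < n" "j < n" by auto
    have "(?P * ?D * ?Q) $$ (i, j) = (\<Sum>k<n. mat_vec n S (v k) i * v k j)"
      unfolding PD using ij by (simp add: scalar_prod_def atLeast0LessThan ev)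
    also have "\<dots> = (\<Sum>l<n. S i l * (\<Sum>k<n. v k l * v k j))"
      unfolding mat_vec_def dot_def sum_distrib_right sum_distrib_left
      by (subst sum.swap) (simp add: mult.assoc)
    also have "\<dots> = S i j"
      using ij by (simp add: complete if_distrib cong: if_cong)
    finally show "fun_mat n n S $$ (i, j) = (?P * ?D * ?Q) $$ (i, j)" using ij by simp
  qed auto
  then have "similar_mat (fun_mat n n S) ?D"
    unfolding similar_mat_def similar_mat_wit_def Let_def using PQ QP
    by (intro exI[of _ ?P] exI[of _ ?Q]) auto
  then have "char_poly (fun_mat n n S) = char_poly ?D" by (rule char_poly_similar)
  also have "\<dots> = (\<Prod>a\<leftarrow>diag_mat ?D. [:- a, 1:])"
    by (rule char_poly_upper_triangular[of _ n]) (auto simp: upper_triangular_def)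
  also have "diag_mat ?D = map d [0..<n]" by (auto simp: diag_mat_def)
  finally have cp: "char_poly (fun_mat n n S) = (\<Prod>p\<leftarrow>map (\<lambda>k. [:- d k, 1:]) [0..<n]. p)"
    by (simp add: comp_def)
  have "proots (char_poly (fun_mat n n S)) = (\<Sum>k\<leftarrow>[0..<n]. {#d k#})"
    unfolding cp by (subst proots_prod_list) (auto simp: comp_def)
  also have "\<dots> = image_mset d (mset [0..<n])"
    by (induction n) auto
  also have "mset [0..<n] = mset_set {..<n}"
    by (metis atLeast0LessThan mset_upt)
  finally show ?thesis .
qed

text \<open>The reduced decomposition: only positive singular values are indexed, so that
  \<open>card K\<close> is bounded by the rank. The last clause ties it to the norm defined by
  characteristic polynomials, to which no later argument has to return.\<close>

definition is_svd ::
  "nat \<Rightarrow> nat \<Rightarrow> (nat \<Rightarrow> nat \<Rightarrow> real) \<Rightarrow> nat set \<Rightarrow> (nat \<Rightarrow> real) \<Rightarrow>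
    (nat \<Rightarrow> nat \<Rightarrow> real) \<Rightarrow> (nat \<Rightarrow> nat \<Rightarrow> real) \<Rightarrow> bool" where
  "is_svd m T a K \<sigma> u v \<longleftrightarrow> finite K \<and> (\<forall>k\<in>K. 0 < \<sigma> k) \<and> orthonormal m K u \<and> orthonormal T K v \<and>
    (\<forall>i<m. \<forall>j<T. a i j = (\<Sum>k\<in>K. \<sigma> k * u k i * v k j)) \<and>
    (\<forall>p>0. schatten_norm p (fun_mat m T a) = (\<Sum>k\<in>K. \<sigma> k powr p) powr (1 / p))"

lemma is_svdD:
  assumes "is_svd m T a K \<sigma> u v"
  shows "finite K" "\<And>k. k \<in> K \<Longrightarrow> 0 < \<sigma> k" "orthonormal m K u" "orthonormal T K v"
    "\<And>i j. i < m \<Longrightarrow> j < T \<Longrightarrow> a i j = (\<Sum>k\<in>K. \<sigma> k * u k i * v k j)"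
    "\<And>p. 0 < p \<Longrightarrow> schatten_norm p (fun_mat m T a) = (\<Sum>k\<in>K. \<sigma> k powr p) powr (1 / p)"
  using assms unfolding is_svd_def by blast+

text \<open>The images of an eigenbasis \<open>v\<close> of the Gram matrix are pairwise orthogonal
  with squared norms \<open>d\<close>. Hence \<open>d\<close> is nonnegative, and the nonzero images
  only need normalising to become left singular vectors.\<close>

theorem singular_value_decomposition:
  obtains K \<sigma> u v where "is_svd m T a K \<sigma> u v"
proof -
  define S where "S j l = (\<Sum>i<m. a i j * a i l)" for j l
  obtain v d where on: "orthonormal T {..<T} v"
    and ev: "\<And>k i. k < T \<Longrightarrow> i < T \<Longrightarrow> mat_vec T S (v k) i = d k * v k i"
    using symmetric_eigenbasis[of T S] by (auto simp: S_def mult.commute)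
  define w where "w k i = dot T (a i) (v k)" for k i
  have ww: "dot m (w k) (w l) = (if k = l then d l else 0)" if "k < T" "l < T" for k l
  proof -
    have "dot m (w k) (w l) = (\<Sum>i<m. \<Sum>j<T. \<Sum>j'<T. v k j * (a i j * a i j' * v l j'))"
      unfolding dot_def[of m] w_def dot_def sum_product by (intro sum.cong refl) simp
    also have "\<dots> = (\<Sum>j<T. \<Sum>j'<T. \<Sum>i<m. v k j * (a i j * a i j' * v l j'))"
      by (subst sum.swap, rule sum.cong[OF refl], rule sum.swap)
    also have "\<dots> = dot T (v k) (mat_vec T S (v l))"
      unfolding mat_vec_def dot_def S_def sum_distrib_left sum_distrib_right by (rule refl)
    also have "\<dots> = dot T (v k) (\<lambda>i. d l * v l i)"
      by (rule dot_cong) (auto simp: ev that)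
    finally show ?thesis using on that by (auto simp: dot_simps orthonormal_def)
  qed
  have d0: "0 \<le> d k" if "k < T" for k
    using ww[OF that that] dot_self_nonneg[of m "w k"] by simp
  define K where "K = {k \<in> {..<T}. d k \<noteq> 0}"
  define u where "u k i = w k i / sqrt (d k)" for k i
  have K: "finite K" "K \<subseteq> {..<T}" by (auto simp: K_def)
  have pos: "0 < sqrt (d k)" if "k \<in> K" for k
    using that d0[of k] by (auto simp: K_def order_less_le)
  have u: "orthonormal m K u"
    unfolding orthonormal_def
  proof (intro ballI)
    fix k l assume kl: "k \<in> K" "l \<in> K"
    have "dot m (u k) (u l) = dot m (w k) (w l) / (sqrt (d k) * sqrt (d l))"
      unfolding u_def dot_def by (simp add: sum_divide_distrib)
    moreover have "k < T" "l < T" using kl K(2) by auto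
    ultimately show "dot m (u k) (u l) = (if k = l then 1 else 0)"
      using ww[of k l] pos[OF kl(1)] by auto
  qed
  have v: "orthonormal T K v" using on K(2) unfolding orthonormal_def by (meson subsetD)
  \<comment> \<open>Completeness of the full basis \<open>v\<close> writes \<open>a\<close> as a sum
    over all k < T; the terms outside \<open>K\<close> vanish because there the image of
    \<open>v k\<close> has norm 0.\<close>
  have a: "a i j = (\<Sum>k\<in>K. sqrt (d k) * u k i * v k j)" if "i < m" "j < T" for i j
  proof -
    have wz: "w k i = 0" if "k < T" "k \<notin> K" for k
      using ww[OF that(1) that(1)] that dot_self_eq_0[of m "w k"] \<open>i < m\<close> by (auto simp: K_def)
    have "(\<Sum>k\<in>K. sqrt (d k) * u k i * v k j) = (\<Sum>k\<in>K. w k i * v k j)"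
    proof (intro sum.cong refl)
      fix k assume "k \<in> K"
      then show "sqrt (d k) * u k i * v k j = w k i * v k j"
        using pos[of k] by (simp add: u_def)
    qed
    also have "\<dots> = (\<Sum>k<T. w k i * v k j)"
      using K wz by (intro sum.mono_neutral_left) auto
    also have "\<dots> = (\<Sum>l<T. a i l * (\<Sum>k<T. v k l * v k j))"
      unfolding w_def dot_def sum_distrib_right sum_distrib_left
      by (subst sum.swap) (simp add: mult.assoc)
    also have "\<dots> = (\<Sum>l<T. if l = j then a i j else 0)"
      using orthonormal_complete[OF _ on] that by (intro sum.cong) auto
    also have "\<dots> = a i j" using that by simp
    finally show ?thesis by simp
  qed
  have "transpose_mat (fun_mat m T a) * fun_mat m T a = fun_mat T T S"
    by (intro eq_matI) (auto simp: scalar_prod_def atLeast0LessThan S_def)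
  then have roots: "image_mset sqrt (proots (char_poly (transpose_mat (fun_mat m T a) * fun_mat m T a)))
      = image_mset (\<lambda>k. sqrt (d k)) (mset_set {..<T})"
    using char_poly_eigenbasis[OF on ev] by (simp add: multiset.map_comp comp_def)
  have card: "size {#x \<in># image_mset (\<lambda>k. sqrt (d k)) (mset_set {..<T}). x \<noteq> 0#} \<le> min m T"
  proof -
    have "size {#x \<in># image_mset (\<lambda>k. sqrt (d k)) (mset_set {..<T}). x \<noteq> 0#} = card K"
      by (simp add: filter_mset_image_mset K_def)
    then show ?thesis
      using orthonormal_card_le[OF K(1) u] orthonormal_card_le[OF K(1) v] by simp
  qed
  have sch: "schatten_norm p (fun_mat m T a) = (\<Sum>k\<in>K. sqrt (d k) powr p) powr (1 / p)" if "0 < p" for p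
  proof -
    have "(\<Sum>s\<leftarrow>singular_values (fun_mat m T a). s powr p)
        = (\<Sum>s\<in>#image_mset (\<lambda>k. sqrt (d k)) (mset_set {..<T}). s powr p)"
      unfolding singular_values_def roots dim_row_mat dim_col_mat
      using d0 by (intro sum_list_take_decreasing card) auto
    also have "\<dots> = (\<Sum>k<T. sqrt (d k) powr p)"
      by (simp add: multiset.map_comp comp_def sum_unfold_sum_mset)
    also have "\<dots> = (\<Sum>k\<in>K. sqrt (d k) powr p)"
      by (rule sum.mono_neutral_right) (auto simp: K_def)
    finally show ?thesis by (simp add: schatten_norm_def)
  qed
  show ?thesis by (rule that[of K "\<lambda>k. sqrt (d k)" u v], unfold is_svd_def) (use K(1) pos u v a sch in blast)
qed

section \<open>Rank as a bound on the number of singular values\<close>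

lemma gram_schmidt_span:
  assumes "finite S"
  shows "\<exists>L e. L \<subseteq> S \<and> orthonormal n L e \<and>
    (\<forall>s\<in>S. \<forall>i<n. f s i = (\<Sum>l\<in>L. dot n (e l) (f s) * e l i))"
  using assms
proof (induction S)
  case empty
  then show ?case by (intro exI[of _ "{}"]) (auto simp: orthonormal_def)
next
  case (insert s S)
  then obtain L e where L: "L \<subseteq> S" and on: "orthonormal n L e"
    and span: "\<And>t i. t \<in> S \<Longrightarrow> i < n \<Longrightarrow> f t i = (\<Sum>l\<in>L. dot n (e l) (f t) * e l i)"
    by auto
  have finL: "finite L" using L insert.hyps(1) finite_subset by blast
  define r where "r = (\<lambda>i. f s i - (\<Sum>l\<in>L. dot n (e l) (f s) * e l i))"
  have re: "dot n (e l) r = 0" if "l \<in> L" for l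
    using orthonormal_residual(2)[OF finL on that, of "f s"] by (simp add: r_def)
  show ?case
  \<comment> \<open>A vector already in the span adds no index, so the new family is indexed by a
    subset of \<open>S\<close> and is no larger than \<open>S\<close>.\<close>
  proof (cases "dot n r r = 0")
    case True
    then have "\<forall>i<n. f s i = (\<Sum>l\<in>L. dot n (e l) (f s) * e l i)"
      by (simp add: dot_self_eq_0 r_def)
    then show ?thesis using L on span by (intro exI[of _ L] exI[of _ e]) auto
  next
    case False
    then have rpos: "0 < dot n r r" by (simp add: order_less_le)
    define c where "c = 1 / sqrt (dot n r r)"
    have c: "c * c * dot n r r = 1" using rpos by (simp add: c_def field_simps)
    define e' where "e' = e(s := (\<lambda>i. c * r i))"
    have sL: "s \<notin> L" using L insert.hyps(2) by auto
    have e': "e' l = e l" if "l \<in> L" for l using that sL by (auto simp: e'_def)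
    have e's: "e' s = (\<lambda>i. c * r i)" by (simp add: e'_def)
    have split: "(\<Sum>l\<in>insert s L. dot n (e' l) x * e' l i)
        = c * dot n r x * (c * r i) + (\<Sum>l\<in>L. dot n (e l) x * e l i)" for x i
      using finL sL by (simp add: e' e's dot_simps cong: sum.cong)
    have "orthonormal n (insert s L) e'"
      unfolding orthonormal_def
    proof (intro ballI)
      fix k l assume kl: "k \<in> insert s L" "l \<in> insert s L"
      show "dot n (e' k) (e' l) = (if k = l then 1 else 0)"
      proof (cases "k = s"; cases "l = s")
        assume "k = s" "l = s"
        then show ?thesis using c by (simp add: e's dot_simps mult.assoc)
      next
        assume "k = s" "l \<noteq> s"
        then show ?thesis using kl re[of l] e'[of l] by (simp add: e's dot_simps dot_commute[of n r "e l"])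
      next
        assume "k \<noteq> s" "l = s"
        then show ?thesis using kl re[of k] e'[of k] by (simp add: e's dot_simps)
      next
        assume "k \<noteq> s" "l \<noteq> s"
        then show ?thesis using kl on e' by (simp add: orthonormal_def)
      qed
    qed
    moreover have "f t i = (\<Sum>l\<in>insert s L. dot n (e' l) (f t) * e' l i)"
      if t: "t \<in> insert s S" and i: "i < n" for t i
    proof (cases "t = s")
      case True
      have "dot n r r = dot n r (f s) - (\<Sum>l\<in>L. dot n (e l) (f s) * dot n r (e l))"
        using dot_diff_right[of n r "f s" "\<lambda>i. \<Sum>l\<in>L. dot n (e l) (f s) * e l i"]
        by (simp add: r_def[symmetric] dot_sum_right dot_scale_right)
      also have "\<dots> = dot n r (f s)" using re by (simp add: dot_commute[of n r])
      finally have "c * dot n r (f s) * (c * r i) = r i"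
        using c by (metis mult.assoc mult.commute mult.right_neutral)
      then show ?thesis unfolding True split by (simp only:) (simp add: r_def)
    next
      case False
      then have tS: "t \<in> S" using t by simp
      have "dot n r (f t) = dot n r (\<lambda>i. \<Sum>l\<in>L. dot n (e l) (f t) * e l i)"
        by (rule dot_cong) (auto simp: span[OF tS])
      also have "\<dots> = (\<Sum>l\<in>L. dot n (e l) (f t) * dot n (e l) r)"
        by (simp add: dot_sum_right dot_scale_right dot_commute)
      also have "\<dots> = 0" using re by simp
      finally show ?thesis unfolding split using span[OF tS i] by simp
    qed
    ultimately show ?thesis using L by (intro exI[of _ "insert s L"] exI[of _ e']) auto
  qed
qed

text \<open>Double counting of the squared inner products of two orthonormal families: each
  \<open>u k\<close> contributes exactly 1 because it lies in the span of \<open>e\<close>, each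
  \<open>e l\<close> at most 1 by Bessel.\<close>

lemma card_orthonormal_in_span_le:
  assumes S: "finite S" and K: "finite K" "orthonormal n K u"
    and span: "\<And>k i. k \<in> K \<Longrightarrow> i < n \<Longrightarrow> u k i = (\<Sum>s\<in>S. c k s * f s i)"
  shows "card K \<le> card S"
proof -
  obtain L e where L: "L \<subseteq> S" and on: "orthonormal n L e"
    and f: "\<And>s i. s \<in> S \<Longrightarrow> i < n \<Longrightarrow> f s i = (\<Sum>l\<in>L. dot n (e l) (f s) * e l i)"
    using gram_schmidt_span[OF S, of n f] by blast
  have finL: "finite L" using L S finite_subset by blast
  have uL: "u k i = (\<Sum>l\<in>L. dot n (e l) (u k) * e l i)" if "k \<in> K" "i < n" for k i
  proof -
    have "dot n (e l) (u k) = (\<Sum>s\<in>S. c k s * dot n (e l) (f s))" for l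
    proof -
      have "dot n (e l) (u k) = dot n (e l) (\<lambda>i. \<Sum>s\<in>S. c k s * f s i)"
        by (rule dot_cong) (auto simp: span that)
      then show ?thesis by (simp add: dot_simps)
    qed
    then have "(\<Sum>l\<in>L. dot n (e l) (u k) * e l i) = (\<Sum>s\<in>S. c k s * (\<Sum>l\<in>L. dot n (e l) (f s) * e l i))"
      unfolding sum_distrib_left by (subst sum.swap) (simp add: sum_distrib_right mult.assoc)
    also have "\<dots> = u k i" unfolding span[OF that] using f[OF _ that(2)] by (intro sum.cong) auto
    finally show ?thesis by simp
  qed
  have "real (card K) = (\<Sum>k\<in>K. dot n (u k) (u k))"
    using K(2) by (simp add: orthonormal_def)
  also have "\<dots> = (\<Sum>k\<in>K. \<Sum>l\<in>L. (dot n (u k) (e l))\<^sup>2)"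
  proof (intro sum.cong refl)
    fix k assume k: "k \<in> K"
    have "dot n (u k) (u k) = dot n (u k) (\<lambda>i. \<Sum>l\<in>L. dot n (e l) (u k) * e l i)"
      by (rule dot_cong) (auto simp: uL[OF k, symmetric])
    then show "dot n (u k) (u k) = (\<Sum>l\<in>L. (dot n (u k) (e l))\<^sup>2)"
      by (simp add: dot_sum_right dot_scale_right power2_eq_square dot_commute)
  qed
  also have "\<dots> = (\<Sum>l\<in>L. \<Sum>k\<in>K. (dot n (u k) (e l))\<^sup>2)" by (rule sum.swap)
  also have "\<dots> \<le> (\<Sum>l\<in>L. 1)"
  proof (rule sum_mono)
    fix l assume "l \<in> L"
    then show "(\<Sum>k\<in>K. (dot n (u k) (e l))\<^sup>2) \<le> 1"
      using bessel[OF K, of "e l"] on by (simp add: orthonormal_def)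
  qed
  finally have "card K \<le> card L" by simp
  also have "\<dots> \<le> card S" using L S by (rule card_mono[rotated])
  finally show ?thesis .
qed

text \<open>Bridge from the abstract rank to explicit coefficients: a maximal independent set of
  columns has rank many elements, and maximality puts every other column into its span.\<close>

lemma rank_column_basis:
  assumes A: "A \<in> carrier_mat m (n :: nat)"
  shows "\<exists>S c. finite S \<and> card S = vec_space.rank m (A :: real mat) \<and>
    (\<forall>i<m. \<forall>j<n. A $$ (i, j) = (\<Sum>s\<in>S. c j s * s $ i))"
proof -
  interpret vec_space "TYPE(real)" m .
  have cols: "set (cols A) \<subseteq> carrier_vec m" using cols_dim[of A] A by auto
  obtain S where S: "maximal S (\<lambda>T. T \<subseteq> set (cols A) \<and> lin_indpt T)"
    using maximal_exists_superset[of "set (cols A)" "\<lambda>T. T \<subseteq> set (cols A) \<and> lin_indpt T" "{}"]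
    by (metis (no_types, lifting) List.finite_set empty_subsetI finite_lin_indpt2 finite.emptyI empty_iff)
  have sub: "S \<subseteq> set (cols A)" and li: "lin_indpt S" using S by (auto simp: maximal_def)
  have Sm: "S \<subseteq> carrier_vec m" using sub cols by blast
  have card: "card S = rank A" using rank_card_indpt[OF A S] by simp
  have fin: "finite S" using sub finite_subset by blast
  have "\<exists>a. \<forall>i<m. A $$ (i, j) = (\<Sum>s\<in>S. a s * s $ i)" if j: "j < n" for j
  proof -
    have cj: "col A j \<in> set (cols A)" using A j by (auto simp: cols_def)
    have "col A j \<in> span S"
    proof (cases "col A j \<in> S")
      case True
      then show ?thesis using sub cols by (meson span_mem subset_trans)
    next
      case False
      show ?thesis
      proof (rule ccontr)
        assume "col A j \<notin> span S"
        then have "lin_indpt (S \<union> {col A j})"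
          using lin_dep_iff_in_span[OF _ li _ False] sub cols cj by auto
        then have "card (S \<union> {col A j}) \<le> rank A"
          using rank_ge_card_indpt[OF A] sub cj by simp
        then show False using card False fin by simp
      qed
    qed
    then obtain a where a: "lincomb a S = col A j"
      using finite_in_span[OF fin, of "col A j"] Sm by auto
    have "A $$ (i, j) = (\<Sum>s\<in>S. a s * s $ i)" if "i < m" for i
    proof -
      have "A $$ (i, j) = lincomb a S $ i" using a A that j by simp
      then show ?thesis using lincomb_index[OF that] sub cols by auto
    qed
    then show ?thesis by blast
  qed
  then obtain c where "\<forall>j<n. \<forall>i<m. A $$ (i, j) = (\<Sum>s\<in>S. c j s * s $ i)" by metis
  then show ?thesis using fin card by blast
qed

text \<open>Applying the matrix to \<open>v k\<close> returns \<open>u k\<close> scaled by its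
  singular value, so every left singular vector lies in the column space.\<close>

lemma card_singular_le_rank:
  assumes A: "A \<in> carrier_mat m T" and K: "finite K" "orthonormal m K u" "orthonormal T K v"
    and pos: "\<And>k. k \<in> K \<Longrightarrow> (0::real) < \<sigma> k"
    and svd: "\<And>i j. i < m \<Longrightarrow> j < T \<Longrightarrow> A $$ (i, j) = (\<Sum>k\<in>K. \<sigma> k * u k i * v k j)"
  shows "card K \<le> vec_space.rank m A"
proof -
  obtain S c where S: "finite S" "card S = vec_space.rank m A"
    and c: "\<And>i j. i < m \<Longrightarrow> j < T \<Longrightarrow> A $$ (i, j) = (\<Sum>s\<in>S. c j s * s $ i)"
    using rank_column_basis[OF A] by blast
  have "u k i = (\<Sum>s\<in>S. (\<Sum>j<T. c j s * v k j) / \<sigma> k * s $ i)" if k: "k \<in> K" and i: "i < m" for k i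
  proof -
    have "(\<Sum>s\<in>S. (\<Sum>j<T. c j s * v k j) * s $ i) = (\<Sum>j<T. (\<Sum>s\<in>S. c j s * s $ i) * v k j)"
      unfolding sum_distrib_right by (subst sum.swap) (simp add: mult_ac)
    also have "\<dots> = (\<Sum>j<T. A $$ (i, j) * v k j)"
      using c i by (intro sum.cong) auto
    also have "\<dots> = (\<Sum>j<T. (\<Sum>l\<in>K. \<sigma> l * u l i * v l j) * v k j)"
      using i svd by (intro sum.cong) auto
    also have "\<dots> = (\<Sum>l\<in>K. \<sigma> l * u l i * dot T (v l) (v k))"
      unfolding sum_distrib_right by (subst sum.swap) (simp add: dot_def sum_distrib_left mult.assoc)
    also have "\<dots> = (\<Sum>l\<in>K. if l = k then \<sigma> k * u k i else 0)"
      using K(3) k by (intro sum.cong) (auto simp: orthonormal_def)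
    also have "\<dots> = \<sigma> k * u k i" using K(1) k by simp
    finally have "u k i = (\<Sum>s\<in>S. (\<Sum>j<T. c j s * v k j) * s $ i) / \<sigma> k"
      using pos[OF k] by simp
    then show ?thesis by (subst (asm) sum_divide_distrib) simp
  qed
  then have "card K \<le> card S"
    by (rule card_orthonormal_in_span_le[OF S(1) K(1,2)])
  then show ?thesis using S(2) by simp
qed

section \<open>Trace norm\<close>

definition vec_mat :: "nat \<Rightarrow> (nat \<Rightarrow> nat \<Rightarrow> real) \<Rightarrow> (nat \<Rightarrow> real) \<Rightarrow> nat \<Rightarrow> real" where
  "vec_mat m g x j = (\<Sum>i<m. x i * g i j)"

text \<open>For nonnegative t, the operator norm is at most t; the bilinear form avoids a
  supremum.\<close>

definition op_bounded :: "nat \<Rightarrow> nat \<Rightarrow> (nat \<Rightarrow> nat \<Rightarrow> real) \<Rightarrow> real \<Rightarrow> bool" where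
  "op_bounded m T g t \<longleftrightarrow>
    (\<forall>x y. dot m x (mat_vec T g y) \<le> t * (sqrt (dot m x x) * sqrt (dot T y y)))"

definition trace_norm :: "nat \<Rightarrow> nat \<Rightarrow> (nat \<Rightarrow> nat \<Rightarrow> real) \<Rightarrow> real" where
  "trace_norm m T a = schatten_norm 1 (fun_mat m T a)"

definition frob_norm :: "nat \<Rightarrow> nat \<Rightarrow> (nat \<Rightarrow> nat \<Rightarrow> real) \<Rightarrow> real" where
  "frob_norm m T a = sqrt (frob m T a a)"

lemma frob_commute: "frob m T a b = frob m T b a"
  by (simp add: frob_def dot_commute)

lemma frob_self_nonneg [simp]: "0 \<le> frob m T a a"
  by (simp add: frob_def sum_nonneg)

lemma frob_norm_nonneg [simp]: "0 \<le> frob_norm m T a"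
  by (simp add: frob_norm_def)

lemma frob_norm_sq: "(frob_norm m T a)\<^sup>2 = frob m T a a"
  by (simp add: frob_norm_def)

lemma frob_cong:
  "(\<And>i j. i < m \<Longrightarrow> j < T \<Longrightarrow> a i j = a' i j) \<Longrightarrow> (\<And>i j. i < m \<Longrightarrow> j < T \<Longrightarrow> b i j = b' i j)
    \<Longrightarrow> frob m T a b = frob m T a' b'"
  by (simp add: frob_def dot_def)

lemma frob_add_right: "frob m T a (\<lambda>i j. b i j + c i j) = frob m T a b + frob m T a c"
  by (simp add: frob_def dot_add_right sum.distrib)

lemma frob_diff_right: "frob m T a (\<lambda>i j. b i j - c i j) = frob m T a b - frob m T a c"
  by (simp add: frob_def dot_diff_right sum_subtractf)

lemma frob_scale_right: "frob m T a (\<lambda>i j. s * b i j) = s * frob m T a b"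
  by (simp add: frob_def dot_scale_right sum_distrib_left)

lemma frob_sum_right: "frob m T a (\<lambda>i j. \<Sum>k\<in>K. b k i j) = (\<Sum>k\<in>K. frob m T a (b k))"
  unfolding frob_def dot_sum_right by (rule sum.swap)

lemma frob_add_left: "frob m T (\<lambda>i j. b i j + c i j) a = frob m T b a + frob m T c a"
  by (metis frob_add_right frob_commute)

lemma frob_scale_left: "frob m T (\<lambda>i j. s * b i j) a = s * frob m T b a"
  by (metis frob_scale_right frob_commute)

lemma frob_sum_left: "frob m T (\<lambda>i j. \<Sum>k\<in>K. b k i j) a = (\<Sum>k\<in>K. frob m T (b k) a)"
  by (subst frob_commute, subst frob_sum_right) (simp add: frob_commute)

lemma dot_vec_mat: "dot m x (mat_vec T g y) = dot T (vec_mat m g x) y"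
  unfolding mat_vec_def vec_mat_def dot_def sum_distrib_left sum_distrib_right
  by (subst sum.swap) (simp add: mult.assoc)

lemma frob_outer: "frob m T a (\<lambda>i j. w i * z j) = dot m w (mat_vec T a z)"
  by (simp add: frob_def dot_scale_right mat_vec_def dot_def[of m])

lemma frob_svd:
  assumes "\<And>i j. i < m \<Longrightarrow> j < T \<Longrightarrow> a i j = (\<Sum>k\<in>K. \<sigma> k * u k i * v k j)"
  shows "frob m T a g = (\<Sum>k\<in>K. \<sigma> k * dot m (u k) (mat_vec T g (v k)))"
proof -
  have "frob m T a g = frob m T g (\<lambda>i j. \<Sum>k\<in>K. (\<sigma> k * u k i) * v k j)"
    by (subst frob_commute, rule frob_cong) (auto simp: assms)
  then show ?thesis by (simp add: frob_sum_right frob_outer dot_scale_left)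
qed

lemma op_boundedD:
  "op_bounded m T g t \<Longrightarrow> dot m x (mat_vec T g y) \<le> t * (sqrt (dot m x x) * sqrt (dot T y y))"
  by (simp add: op_bounded_def)

lemma op_bounded_mat_vec:
  assumes g: "op_bounded m T g t" and t: "0 \<le> t"
  shows "sqrt (dot m (mat_vec T g y) (mat_vec T g y)) \<le> t * sqrt (dot T y y)"
proof -
  let ?n = "sqrt (dot m (mat_vec T g y) (mat_vec T g y))"
  have "?n * ?n \<le> ?n * (t * sqrt (dot T y y))"
    using op_boundedD[OF g, of "mat_vec T g y" y] by (simp add: mult_ac)
  then show ?thesis
    using t mult_left_le_imp_le[of ?n ?n "t * sqrt (dot T y y)"]
    by (cases "?n = 0") (simp_all add: order_less_le)
qed

lemma op_bounded_vec_mat: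
  assumes g: "op_bounded m T g t" and t: "0 \<le> t"
  shows "sqrt (dot T (vec_mat m g x) (vec_mat m g x)) \<le> t * sqrt (dot m x x)"
proof -
  let ?n = "sqrt (dot T (vec_mat m g x) (vec_mat m g x))"
  have "?n * ?n \<le> ?n * (t * sqrt (dot m x x))"
    using op_boundedD[OF g, of x "vec_mat m g x"] by (simp add: mult_ac dot_vec_mat)
  then show ?thesis
    using t mult_left_le_imp_le[of ?n ?n "t * sqrt (dot m x x)"]
    by (cases "?n = 0") (simp_all add: order_less_le)
qed

lemma trace_norm_svd:
  assumes "\<And>p. 0 < p \<Longrightarrow> schatten_norm p (fun_mat m T a) = (\<Sum>k\<in>K. \<sigma> k powr p) powr (1 / p)"
    "\<And>k. k \<in> K \<Longrightarrow> 0 < (\<sigma> k :: real)"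
  shows "trace_norm m T a = (\<Sum>k\<in>K. \<sigma> k)"
proof -
  have "trace_norm m T a = (\<Sum>k\<in>K. \<sigma> k powr 1) powr 1"
    using assms(1)[of 1] by (simp add: trace_norm_def)
  also have "(\<Sum>k\<in>K. \<sigma> k powr 1) = (\<Sum>k\<in>K. \<sigma> k)"
    using assms(2) by (intro sum.cong) (auto simp: less_imp_le)
  also have "(\<Sum>k\<in>K. \<sigma> k) powr 1 = (\<Sum>k\<in>K. \<sigma> k)"
    using assms(2) by (intro powr_one sum_nonneg) (auto simp: less_imp_le)
  finally show ?thesis .
qed

text \<open>Each singular pair of \<open>a\<close> tests \<open>g\<close> on two unit vectors.
  Together with \<open>trace_norm_attained\<close> this makes the trace norm a maximum of linear
  functionals, from which the triangle inequality follows without comparing singular values of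
  different matrices.\<close>

lemma trace_duality:
  assumes g: "op_bounded m T g t"
  shows "frob m T a g \<le> t * trace_norm m T a"
proof -
  obtain K \<sigma> u v where "is_svd m T a K \<sigma> u v" by (rule singular_value_decomposition)
  note svd = is_svdD[OF this]
  have "frob m T a g = (\<Sum>k\<in>K. \<sigma> k * dot m (u k) (mat_vec T g (v k)))"
    by (rule frob_svd[OF svd(5)])
  also have "\<dots> \<le> (\<Sum>k\<in>K. \<sigma> k * t)"
  proof (intro sum_mono mult_left_mono)
    fix k assume k: "k \<in> K"
    then show "dot m (u k) (mat_vec T g (v k)) \<le> t" "0 \<le> \<sigma> k"
      using op_boundedD[OF g, of "u k" "v k"] svd(2)[OF k] svd(3,4) by (auto simp: orthonormal_def)
  qed
  also have "\<dots> = t * trace_norm m T a"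
    by (simp add: trace_norm_svd[OF svd(6,2)] sum_distrib_left mult.commute)
  finally show ?thesis .
qed

lemma sum_product_le_sqrt:
  fixes f g :: "'k \<Rightarrow> real"
  shows "(\<Sum>k\<in>K. f k * g k) \<le> sqrt (\<Sum>k\<in>K. (f k)\<^sup>2) * sqrt (\<Sum>k\<in>K. (g k)\<^sup>2)"
  unfolding real_sqrt_mult[symmetric]
  by (intro real_le_rsqrt Cauchy_Schwarz_ineq_sum)

lemma trace_norm_attained:
  obtains g where "op_bounded m T g 1" "frob m T a g = trace_norm m T a"
proof -
  obtain K \<sigma> u v where "is_svd m T a K \<sigma> u v" by (rule singular_value_decomposition)
  note svd = is_svdD[OF this]
  \<comment> \<open>The partial isometry that maps each \<open>v k\<close> to \<open>u k\<close>;
    Bessel on both sides bounds its operator norm by 1.\<close>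
  define g where "g = (\<lambda>i j. \<Sum>k\<in>K. u k i * v k j)"
  have mv: "dot m x (mat_vec T g y) = (\<Sum>k\<in>K. dot m (u k) x * dot T (v k) y)" for x y
  proof -
    have "mat_vec T g y = (\<lambda>i. \<Sum>k\<in>K. dot T (v k) y * u k i)"
      by (simp add: fun_eq_iff mat_vec_def g_def dot_sum_left dot_scale_left mult.commute)
    then show ?thesis
      by (simp add: dot_sum_right dot_scale_right dot_scale_right' dot_commute[of m x "u _"] mult.commute)
  qed
  have "op_bounded m T g 1"
    unfolding op_bounded_def
  proof (intro allI)
    fix x y
    have "dot m x (mat_vec T g y) \<le> sqrt (\<Sum>k\<in>K. (dot m (u k) x)\<^sup>2) * sqrt (\<Sum>k\<in>K. (dot T (v k) y)\<^sup>2)"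
      unfolding mv by (rule sum_product_le_sqrt)
    also have "\<dots> \<le> sqrt (dot m x x) * sqrt (dot T y y)"
      by (intro mult_mono real_sqrt_le_mono bessel svd) (auto intro: sum_nonneg)
    finally show "dot m x (mat_vec T g y) \<le> 1 * (sqrt (dot m x x) * sqrt (dot T y y))" by simp
  qed
  moreover have "frob m T a g = trace_norm m T a"
  proof -
    have "frob m T a g = (\<Sum>k\<in>K. \<sigma> k * dot m (u k) (mat_vec T g (v k)))"
      by (rule frob_svd[OF svd(5)])
    also have "\<dots> = (\<Sum>k\<in>K. \<sigma> k)"
    proof (intro sum.cong refl)
      fix k assume k: "k \<in> K"
      have "dot m (u k) (mat_vec T g (v k)) = (\<Sum>l\<in>K. if l = k then 1 else 0)"
        unfolding mv using k svd(3,4) by (intro sum.cong) (auto simp: orthonormal_def)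
      then show "\<sigma> k * dot m (u k) (mat_vec T g (v k)) = \<sigma> k" using k svd(1) by simp
    qed
    finally show ?thesis by (simp add: trace_norm_svd[OF svd(6,2)])
  qed
  ultimately show ?thesis by (rule that)
qed

lemma op_bounded_uminus: "op_bounded m T g t \<Longrightarrow> op_bounded m T (\<lambda>i j. - g i j) t"
proof -
  assume g: "op_bounded m T g t"
  have "dot m x (mat_vec T (\<lambda>i j. - g i j) y) = dot m (\<lambda>i. - x i) (mat_vec T g y)" for x y
    by (simp add: dot_def mat_vec_def sum_negf)
  moreover have "dot m (\<lambda>i. - x i) (\<lambda>i. - x i) = dot m x x" for x by (simp add: dot_def)
  ultimately show ?thesis
    using op_boundedD[OF g] unfolding op_bounded_def by metis
qed

lemma trace_norm_nonneg [simp]: "0 \<le> trace_norm m T a"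
  unfolding trace_norm_def schatten_norm_def by simp

lemma trace_norm_triangle: "trace_norm m T (\<lambda>i j. a i j + b i j) \<le> trace_norm m T a + trace_norm m T b"
proof -
  obtain g where g: "op_bounded m T g 1"
    "frob m T (\<lambda>i j. a i j + b i j) g = trace_norm m T (\<lambda>i j. a i j + b i j)"
    by (rule trace_norm_attained)
  then show ?thesis
    using trace_duality[OF g(1), of a] trace_duality[OF g(1), of b] by (simp add: frob_add_left)
qed

lemma trace_norm_uminus: "trace_norm m T (\<lambda>i j. - a i j) = trace_norm m T a"
proof -
  have le: "trace_norm m T a \<le> trace_norm m T (\<lambda>i j. - a i j)" for a
  proof -
    obtain g where g: "op_bounded m T g 1" "frob m T a g = trace_norm m T a"
      by (rule trace_norm_attained)
    have "frob m T (\<lambda>i j. - a i j) (\<lambda>i j. - g i j) = frob m T a g"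
      by (simp add: frob_def dot_def)
    then show ?thesis
      using trace_duality[OF op_bounded_uminus[OF g(1)], of "\<lambda>i j. - a i j"] g(2) by simp
  qed
  from le[of a] le[of "\<lambda>i j. - a i j"] show ?thesis by simp
qed

lemma trace_norm_diff_ge: "trace_norm m T a - trace_norm m T b \<le> trace_norm m T (\<lambda>i j. a i j + b i j)"
  using trace_norm_triangle[of m T "\<lambda>i j. a i j + b i j" "\<lambda>i j. - b i j"]
  by (simp add: trace_norm_uminus)

text \<open>Isotropy is stated through singular values, whereas moments are computed entrywise; this
  connects the two.\<close>

lemma schatten_norm_2: "schatten_norm 2 (fun_mat m T a) = frob_norm m T a"
proof -
  obtain K \<sigma> u v where "is_svd m T a K \<sigma> u v" by (rule singular_value_decomposition)
  note svd = is_svdD[OF this]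
  have mv: "mat_vec T a (v k) i = \<sigma> k * u k i" if "k \<in> K" "i < m" for k i
  proof -
    have "mat_vec T a (v k) i = dot T (\<lambda>j. \<Sum>l\<in>K. (\<sigma> l * u l i) * v l j) (v k)"
      unfolding mat_vec_def by (rule dot_cong) (auto simp: svd(5) that)
    also have "\<dots> = (\<Sum>l\<in>K. if l = k then \<sigma> k * u k i else 0)"
      unfolding dot_sum_left dot_scale_left using svd(4) that
      by (intro sum.cong) (auto simp: orthonormal_def)
    finally show ?thesis using svd(1) that by simp
  qed
  have "frob m T a a = (\<Sum>k\<in>K. \<sigma> k * dot m (u k) (mat_vec T a (v k)))"
    by (rule frob_svd[OF svd(5)])
  also have "\<dots> = (\<Sum>k\<in>K. \<sigma> k powr 2)"
  proof (intro sum.cong refl)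
    fix k assume k: "k \<in> K"
    have "dot m (u k) (mat_vec T a (v k)) = dot m (u k) (\<lambda>i. \<sigma> k * u k i)"
      by (rule dot_cong) (auto simp: mv k)
    also have "\<dots> = \<sigma> k" using k svd(3) by (simp add: dot_scale_right orthonormal_def)
    finally show "\<sigma> k * dot m (u k) (mat_vec T a (v k)) = \<sigma> k powr 2"
      using svd(2)[OF k] by (simp add: power2_eq_square)
  qed
  finally show ?thesis
    using svd(6)[of 2] by (simp add: frob_norm_def powr_half_sqrt sum_nonneg)
qed

text \<open>After division by \<alpha> the pointwise bound r powr p \<le> r + r^2 interpolates
  between the two norms. It replaces Hoelder's inequality and costs a factor 2, uniformly in
  p.\<close>

lemma schatten_norm_interpolate:
  assumes p: "1 \<le> p" "p \<le> 2" and "0 < \<alpha>" "0 < s"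
    and 1: "trace_norm m T a \<le> \<alpha> * s" and 2: "frob_norm m T a \<le> \<alpha> * sqrt s"
  shows "schatten_norm p (fun_mat m T a) \<le> 2 * \<alpha> * s powr (1 / p)"
proof -
  obtain K \<sigma> u v where "is_svd m T a K \<sigma> u v" by (rule singular_value_decomposition)
  note svd = is_svdD[OF this]
  have "frob_norm m T a = sqrt (\<Sum>k\<in>K. (\<sigma> k)\<^sup>2)"
  proof -
    have "(\<Sum>k\<in>K. \<sigma> k powr 2) = (\<Sum>k\<in>K. (\<sigma> k)\<^sup>2)"
      using svd(2) by (intro sum.cong refl powr_numeral) (simp add: less_imp_le)
    then show ?thesis
      using svd(6)[of 2] unfolding schatten_norm_2 by (simp add: powr_half_sqrt sum_nonneg)
  qed
  then have "sqrt (\<Sum>k\<in>K. (\<sigma> k)\<^sup>2) \<le> sqrt (\<alpha>\<^sup>2 * s)"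
    using 2 \<open>0 < \<alpha>\<close> by (simp add: real_sqrt_mult)
  then have s2: "(\<Sum>k\<in>K. (\<sigma> k)\<^sup>2) \<le> \<alpha>\<^sup>2 * s" by simp
  have s1: "(\<Sum>k\<in>K. \<sigma> k) \<le> \<alpha> * s" using 1 trace_norm_svd[OF svd(6,2)] by simp
  have "(\<Sum>k\<in>K. \<sigma> k powr p) \<le> (\<Sum>k\<in>K. \<alpha> powr p * (\<sigma> k / \<alpha> + (\<sigma> k / \<alpha>)\<^sup>2))"
  proof (intro sum_mono)
    fix k assume k: "k \<in> K"
    define r where "r = \<sigma> k / \<alpha>"
    have r: "0 < r" using svd(2)[OF k] \<open>0 < \<alpha>\<close> by (simp add: r_def)
    have "r powr p \<le> r + r\<^sup>2"
    proof (cases "r \<le> 1")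
      case True
      then have "r powr p \<le> r powr 1" using r p by (intro powr_mono') auto
      also have "r powr 1 \<le> r + r\<^sup>2" using r by simp
      finally show ?thesis .
    next
      case False
      then have "r powr p \<le> r powr 2" using r p by (intro powr_mono) auto
      then show ?thesis using r by simp
    qed
    moreover have "\<sigma> k powr p = \<alpha> powr p * r powr p"
      using r \<open>0 < \<alpha>\<close> by (simp add: r_def powr_mult[symmetric])
    ultimately show "\<sigma> k powr p \<le> \<alpha> powr p * (\<sigma> k / \<alpha> + (\<sigma> k / \<alpha>)\<^sup>2)"
      by (simp add: r_def mult_left_mono)
  qed
  also have "\<dots> = \<alpha> powr p * ((\<Sum>k\<in>K. \<sigma> k) / \<alpha> + (\<Sum>k\<in>K. (\<sigma> k)\<^sup>2) / \<alpha>\<^sup>2)"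
    by (simp add: sum_distrib_left[symmetric] sum.distrib sum_divide_distrib power_divide)
  also have "\<dots> \<le> \<alpha> powr p * (s + s)"
    using s1 s2 \<open>0 < \<alpha>\<close> by (intro mult_left_mono add_mono) (auto simp: field_simps)
  finally have "schatten_norm p (fun_mat m T a) \<le> (\<alpha> powr p * (2 * s)) powr (1 / p)"
    using svd(6)[of p] p by (simp add: powr_mono2 sum_nonneg)
  also have "\<dots> = \<alpha> * (2 powr (1 / p) * s powr (1 / p))"
    using \<open>0 < \<alpha>\<close> \<open>0 < s\<close> p by (simp add: powr_mult powr_powr)
  also have "\<dots> \<le> \<alpha> * (2 powr 1 * s powr (1 / p))"
    using \<open>0 < \<alpha>\<close> p by (intro mult_left_mono mult_right_mono powr_mono) auto
  finally show ?thesis by (simp add: mult_ac)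
qed

section \<open>Decomposability of the trace norm\<close>

definition residual :: "nat \<Rightarrow> 'k set \<Rightarrow> ('k \<Rightarrow> nat \<Rightarrow> real) \<Rightarrow> (nat \<Rightarrow> real) \<Rightarrow> nat \<Rightarrow> real" where
  "residual n K u x = (\<lambda>i. x i - (\<Sum>k\<in>K. dot n (u k) x * u k i))"

lemma dot_residual_left: "dot n (residual n K u x) y = dot n x y - (\<Sum>k\<in>K. dot n (u k) x * dot n (u k) y)"
  by (simp add: residual_def dot_simps)

lemma dot_residual_right: "dot n x (residual n K u y) = dot n x y - (\<Sum>k\<in>K. dot n (u k) x * dot n (u k) y)"
  by (subst dot_commute, subst dot_residual_left) (simp add: dot_commute mult.commute)

lemma dot_residual_self:
  assumes "finite K" "orthonormal n K u"
  shows "dot n (residual n K u x) (residual n K u x) = dot n x x - (\<Sum>k\<in>K. (dot n (u k) x)\<^sup>2)"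
  unfolding residual_def by (rule orthonormal_residual(1)[OF assms])

text \<open>This is \<open>(1 - P) g (1 - Q)\<close>, where \<open>P\<close> and \<open>Q\<close> are the orthogonal projections onto the
  spans of the families \<open>u\<close> and \<open>v\<close>.\<close>

definition sandwich ::
  "nat \<Rightarrow> nat \<Rightarrow> 'k set \<Rightarrow> ('k \<Rightarrow> nat \<Rightarrow> real) \<Rightarrow> ('k \<Rightarrow> nat \<Rightarrow> real) \<Rightarrow>
    (nat \<Rightarrow> nat \<Rightarrow> real) \<Rightarrow> nat \<Rightarrow> nat \<Rightarrow> real" where
  "sandwich m T K u v g = (\<lambda>i j. g i j - (\<Sum>k\<in>K. u k i * vec_mat m g (u k) j)
      - (\<Sum>k\<in>K. residual m K u (mat_vec T g (v k)) i * v k j))"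

lemma frob_sandwich_right:
  "frob m T d (sandwich m T K u v g) = frob m T d g
    - (\<Sum>k\<in>K. dot T (vec_mat m d (u k)) (vec_mat m g (u k)))
    - (\<Sum>k\<in>K. dot m (residual m K u (mat_vec T g (v k))) (mat_vec T d (v k)))"
  by (simp add: sandwich_def frob_diff_right frob_sum_right frob_outer dot_vec_mat)

text \<open>Compression by symmetric projections is self-adjoint, so it can be moved from the dual
  matrix onto \<open>d\<close>.\<close>

lemma frob_sandwich_commute:
  "frob m T d (sandwich m T K u v g) = frob m T (sandwich m T K u v d) g"
  unfolding frob_commute[of m T "sandwich m T K u v d"] frob_sandwich_right dot_residual_left
  by (simp add: frob_commute[of m T d g] dot_commute mult.commute)

lemma dot_sandwich:
  "dot m x (mat_vec T (sandwich m T K u v g) y) =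
    dot m (residual m K u x) (mat_vec T g (residual T K v y))"
proof -
  have 1: "mat_vec T (sandwich m T K u v g) y = (\<lambda>i. mat_vec T g y i
      - (\<Sum>k\<in>K. dot m (u k) (mat_vec T g y) * u k i)
      - (\<Sum>k\<in>K. dot T (v k) y * residual m K u (mat_vec T g (v k)) i))"
    by (simp add: fun_eq_iff mat_vec_def sandwich_def dot_simps dot_scale_left'
        dot_vec_mat mult.commute)
  have 2: "mat_vec T g (residual T K v y) = (\<lambda>i. mat_vec T g y i - (\<Sum>k\<in>K. dot T (v k) y * mat_vec T g (v k) i))"
    by (simp add: fun_eq_iff mat_vec_def residual_def dot_simps)
  show ?thesis
    unfolding 1 2 by (simp add: dot_simps dot_scale_right' dot_residual_left dot_residual_right dot_commute[of m x "u _"] mult.commute)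
qed

lemma sum_vec_mat_le:
  assumes "finite K" "orthonormal m K u"
  shows "(\<Sum>k\<in>K. dot T (vec_mat m d (u k)) (vec_mat m d (u k))) \<le> frob m T d d"
proof -
  have "(\<Sum>k\<in>K. dot T (vec_mat m d (u k)) (vec_mat m d (u k))) = (\<Sum>j<T. \<Sum>k\<in>K. (dot m (u k) (\<lambda>i. d i j))\<^sup>2)"
    by (subst sum.swap) (simp add: dot_def vec_mat_def power2_eq_square)
  also have "\<dots> \<le> (\<Sum>j<T. dot m (\<lambda>i. d i j) (\<lambda>i. d i j))"
    by (intro sum_mono bessel assms)
  also have "\<dots> = frob m T d d"
    unfolding frob_def dot_def by (rule sum.swap)
  finally show ?thesis .
qed

lemma sum_mat_vec_le:
  assumes "finite K" "orthonormal T K v"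
  shows "(\<Sum>k\<in>K. dot m (mat_vec T d (v k)) (mat_vec T d (v k))) \<le> frob m T d d"
proof -
  have "(\<Sum>k\<in>K. dot m (mat_vec T d (v k)) (mat_vec T d (v k))) = (\<Sum>i<m. \<Sum>k\<in>K. (dot T (v k) (d i))\<^sup>2)"
    by (subst sum.swap) (simp add: dot_def[of m] mat_vec_def power2_eq_square dot_commute)
  also have "\<dots> \<le> frob m T d d"
    unfolding frob_def by (intro sum_mono bessel assms)
  finally show ?thesis .
qed

lemma sum_sqrt_le:
  assumes "\<And>k. k \<in> K \<Longrightarrow> 0 \<le> f k" "(\<Sum>k\<in>K. f k) \<le> c"
  shows "(\<Sum>k\<in>K. sqrt (f k)) \<le> sqrt (card K) * sqrt c"
proof -
  have "(\<Sum>k\<in>K. 1 * sqrt (f k)) \<le> sqrt (\<Sum>k\<in>K. 1\<^sup>2) * sqrt (\<Sum>k\<in>K. (sqrt (f k))\<^sup>2)"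
    by (rule sum_product_le_sqrt)
  also have "(\<Sum>k\<in>K. (sqrt (f k))\<^sup>2) = (\<Sum>k\<in>K. f k)"
    using assms(1) by (intro sum.cong) auto
  also have "sqrt (\<Sum>k\<in>K. 1\<^sup>2) * sqrt (\<Sum>k\<in>K. f k) \<le> sqrt (card K) * sqrt c"
    using assms(2) by (simp add: mult_left_mono)
  finally show ?thesis by simp
qed

text \<open>Cauchy-Schwarz in the plane, for two vectors that are each split into a projected part
  and its orthogonal complement.\<close>

lemma sqrt_mult_add_le:
  assumes "0 \<le> \<alpha>" "\<alpha> \<le> X" "0 \<le> \<beta>" "\<beta> \<le> (Y::real)"
  shows "sqrt \<alpha> * sqrt \<beta> + sqrt (X - \<alpha>) * sqrt (Y - \<beta>) \<le> sqrt X * sqrt Y"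
proof -
  define p q r s where "p = sqrt \<alpha>" and "q = sqrt \<beta>" and "r = sqrt (X - \<alpha>)" and "s = sqrt (Y - \<beta>)"
  have X: "X = p\<^sup>2 + r\<^sup>2" and Y: "Y = q\<^sup>2 + s\<^sup>2"
    using assms by (simp_all add: p_def q_def r_def s_def)
  have "0 \<le> (p * s - r * q)\<^sup>2" by simp
  then have "(p * q + r * s)\<^sup>2 \<le> X * Y"
    unfolding X Y by (simp add: power2_eq_square algebra_simps)
  then have "p * q + r * s \<le> sqrt (X * Y)" by (rule real_le_rsqrt)
  then show ?thesis by (simp add: p_def q_def r_def s_def real_sqrt_mult)
qed

text \<open>These matrices are the subgradients of the trace norm at a matrix with singular vectors
  \<open>u\<close> and \<open>v\<close>. The two summands act between orthogonal pairs of subspaces,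
  so their operator norms combine by maximum and not by sum.\<close>

lemma op_bounded_subgradient:
  assumes K: "finite K" and u: "orthonormal m K u" and v: "orthonormal T K v"
    and g: "op_bounded m T g 1"
  shows "op_bounded m T (\<lambda>i j. (\<Sum>k\<in>K. u k i * v k j) + sandwich m T K u v g i j) 1"
  unfolding op_bounded_def
proof (intro allI)
  fix x y
  let ?h = "\<lambda>i j. (\<Sum>k\<in>K. u k i * v k j) + sandwich m T K u v g i j"
  let ?a = "\<Sum>k\<in>K. (dot m (u k) x)\<^sup>2" and ?b = "\<Sum>k\<in>K. (dot T (v k) y)\<^sup>2"
  have "mat_vec T ?h y = (\<lambda>i. (\<Sum>k\<in>K. dot T (v k) y * u k i) + mat_vec T (sandwich m T K u v g) y i)"
    by (simp add: fun_eq_iff mat_vec_def dot_simps mult.commute)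
  then have "dot m x (mat_vec T ?h y) = (\<Sum>k\<in>K. dot m (u k) x * dot T (v k) y)
      + dot m (residual m K u x) (mat_vec T g (residual T K v y))"
    by (simp add: dot_add_right dot_sum_right dot_scale_right dot_scale_right' dot_sandwich
        dot_commute[of m x "u _"] mult.commute)
  also have "\<dots> \<le> sqrt ?a * sqrt ?b + sqrt (dot m x x - ?a) * sqrt (dot T y y - ?b)"
    using op_boundedD[OF g, of "residual m K u x" "residual T K v y"]
    by (intro add_mono sum_product_le_sqrt) (simp add: dot_residual_self K u v)
  also have "\<dots> \<le> sqrt (dot m x x) * sqrt (dot T y y)"
    by (intro sqrt_mult_add_le bessel K u v) (auto intro: sum_nonneg)
  finally show "dot m x (mat_vec T ?h y) \<le> 1 * (sqrt (dot m x x) * sqrt (dot T y y))" by simp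
qed

text \<open>The witness is the trace norm of \<open>(1 - P) d (1 - Q)\<close>.\<close>

lemma trace_norm_decomposition:
  fixes a d :: "nat \<Rightarrow> nat \<Rightarrow> real"
  assumes rank: "vec_space.rank m (fun_mat m T a) \<le> s"
  shows "\<exists>t\<ge>0. trace_norm m T a - sqrt s * frob_norm m T d + t \<le> trace_norm m T (\<lambda>i j. a i j + d i j)
    \<and> trace_norm m T d \<le> 2 * sqrt s * frob_norm m T d + t"
proof -
  obtain K \<sigma> u v where "is_svd m T a K \<sigma> u v" by (rule singular_value_decomposition)
  note K = is_svdD(1)[OF this] and pos = is_svdD(2)[OF this] and u = is_svdD(3)[OF this]
    and v = is_svdD(4)[OF this] and svd = is_svdD(5)[OF this] and sch = is_svdD(6)[OF this]
  have "card K \<le> vec_space.rank m (fun_mat m T a)"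
    by (rule card_singular_le_rank[OF _ K u v pos]) (auto simp: svd)
  then have card: "sqrt (card K) \<le> sqrt s" using rank by simp
  have bound: "(\<Sum>k\<in>K. sqrt (f k)) \<le> sqrt s * frob_norm m T d"
    if "\<And>k. k \<in> K \<Longrightarrow> 0 \<le> f k" "(\<Sum>k\<in>K. f k) \<le> frob m T d d" for f
  proof -
    have "(\<Sum>k\<in>K. sqrt (f k)) \<le> sqrt (card K) * frob_norm m T d"
      unfolding frob_norm_def by (rule sum_sqrt_le[OF that])
    then show ?thesis using card by (meson frob_norm_nonneg mult_right_mono order_trans)
  qed
  let ?sw = "sandwich m T K u v"
  define t where "t = trace_norm m T (?sw d)"
  have "trace_norm m T a - sqrt s * frob_norm m T d + t \<le> trace_norm m T (\<lambda>i j. a i j + d i j)"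
  proof -
    obtain g where g: "op_bounded m T g 1" "frob m T (?sw d) g = t"
      unfolding t_def by (rule trace_norm_attained)
    let ?h = "\<lambda>i j. (\<Sum>k\<in>K. u k i * v k j) + ?sw g i j"
    have "frob m T a ?h = (\<Sum>k\<in>K. frob m T a (\<lambda>i j. u k i * v k j)) + frob m T a (?sw g)"
      by (simp add: frob_add_right frob_sum_right)
    also have "(\<Sum>k\<in>K. frob m T a (\<lambda>i j. u k i * v k j)) = trace_norm m T a"
    proof -
      have "frob m T a (\<lambda>i j. u k i * v k j) = \<sigma> k" if k: "k \<in> K" for k
      proof -
        have "frob m T a (\<lambda>i j. u k i * v k j)
            = (\<Sum>l\<in>K. \<sigma> l * dot m (u l) (mat_vec T (\<lambda>i j. u k i * v k j) (v l)))"
          by (rule frob_svd[OF svd])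
        also have "\<dots> = (\<Sum>l\<in>K. if l = k then \<sigma> k else 0)"
        proof (intro sum.cong refl)
          fix l assume l: "l \<in> K"
          have "mat_vec T (\<lambda>i j. u k i * v k j) (v l) = (\<lambda>i. dot T (v k) (v l) * u k i)"
            by (simp add: mat_vec_def dot_scale_left fun_eq_iff)
          then show "\<sigma> l * dot m (u l) (mat_vec T (\<lambda>i j. u k i * v k j) (v l)) = (if l = k then \<sigma> k else 0)"
            using k l u v by (auto simp: dot_scale_right orthonormal_def)
        qed
        finally show ?thesis using K k by simp
      qed
      then show ?thesis by (simp add: trace_norm_svd[OF sch pos])
    qed
    \<comment> \<open>The compression removes the column space of \<open>a\<close>, so against
      \<open>a\<close> the dual matrix acts as the partial isometry alone and attains the trace
      norm.\<close>
    also have "frob m T a (?sw g) = 0"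
    proof -
      have "dot m (residual m K u (u k)) z = 0" if "k \<in> K" for k z
      proof -
        have "(\<Sum>l\<in>K. dot m (u l) (u k) * dot m (u l) z) = (\<Sum>l\<in>K. if l = k then dot m (u k) z else 0)"
          using u that by (intro sum.cong) (auto simp: orthonormal_def)
        then show ?thesis using K that by (simp add: dot_residual_left)
      qed
      then show ?thesis by (simp add: frob_svd[OF svd] dot_sandwich)
    qed
    finally have ah: "frob m T a ?h = trace_norm m T a" by simp
    \<comment> \<open>The most that \<open>d\<close> can lose against the partial isometry: there
      are at most s unit directions, hence the factor sqrt s by Cauchy-Schwarz.\<close>
    have "- (\<Sum>k\<in>K. frob m T d (\<lambda>i j. u k i * v k j)) \<le> (\<Sum>k\<in>K. sqrt (dot m (mat_vec T d (v k)) (mat_vec T d (v k))))"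
      unfolding sum_negf[symmetric] frob_outer
    proof (rule sum_mono)
      fix k assume "k \<in> K"
      then show "- dot m (u k) (mat_vec T d (v k)) \<le> sqrt (dot m (mat_vec T d (v k)) (mat_vec T d (v k)))"
        using abs_dot_le[of m "u k" "mat_vec T d (v k)"] u by (simp add: orthonormal_def)
    qed
    also have "\<dots> \<le> sqrt s * frob_norm m T d"
      by (intro bound sum_mat_vec_le K v) simp
    finally have "frob m T d ?h \<ge> - sqrt s * frob_norm m T d + t"
      using g(2) by (simp add: frob_add_right frob_sum_right frob_sandwich_commute)
    moreover have "frob m T (\<lambda>i j. a i j + d i j) ?h \<le> trace_norm m T (\<lambda>i j. a i j + d i j)"
      using trace_duality[OF op_bounded_subgradient[OF K u v g(1)]] by simp
    ultimately show ?thesis using ah by (simp add: frob_add_left)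
  qed
  moreover have "trace_norm m T d \<le> 2 * sqrt s * frob_norm m T d + t"
  proof -
    \<comment> \<open>The pairing with \<open>g\<close> is split according to d = P d + (1 - P) d Q
      + (1 - P) d (1 - Q). The first two parts live on at most s directions and cost sqrt s times
      the Hilbert-Schmidt norm each; the third is bounded by \<open>t\<close>.\<close>
    obtain g where g: "op_bounded m T g 1" "frob m T d g = trace_norm m T d"
      by (rule trace_norm_attained)
    have 1: "(\<Sum>k\<in>K. dot T (vec_mat m d (u k)) (vec_mat m g (u k))) \<le> sqrt s * frob_norm m T d"
    proof -
      have "(\<Sum>k\<in>K. dot T (vec_mat m d (u k)) (vec_mat m g (u k)))
          \<le> (\<Sum>k\<in>K. sqrt (dot T (vec_mat m d (u k)) (vec_mat m d (u k))))"
      proof (rule sum_mono)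
        fix k assume k: "k \<in> K"
        have "dot T (vec_mat m d (u k)) (vec_mat m g (u k))
            \<le> sqrt (dot T (vec_mat m d (u k)) (vec_mat m d (u k))) * sqrt (dot T (vec_mat m g (u k)) (vec_mat m g (u k)))"
          using abs_dot_le abs_le_D1 by blast
        also have "\<dots> \<le> sqrt (dot T (vec_mat m d (u k)) (vec_mat m d (u k))) * 1"
          using op_bounded_vec_mat[OF g(1), of "u k"] u k by (intro mult_left_mono) (auto simp: orthonormal_def)
        finally show "dot T (vec_mat m d (u k)) (vec_mat m g (u k)) \<le> sqrt (dot T (vec_mat m d (u k)) (vec_mat m d (u k)))"
          by simp
      qed
      also have "\<dots> \<le> sqrt s * frob_norm m T d"
        by (intro bound sum_vec_mat_le K u) simp
      finally show ?thesis .
    qed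
    have 2: "(\<Sum>k\<in>K. dot m (residual m K u (mat_vec T g (v k))) (mat_vec T d (v k))) \<le> sqrt s * frob_norm m T d"
    proof -
      have "(\<Sum>k\<in>K. dot m (residual m K u (mat_vec T g (v k))) (mat_vec T d (v k)))
          \<le> (\<Sum>k\<in>K. sqrt (dot m (mat_vec T d (v k)) (mat_vec T d (v k))))"
      proof (rule sum_mono)
        fix k assume k: "k \<in> K"
        let ?r = "residual m K u (mat_vec T g (v k))"
        have "dot m ?r (mat_vec T d (v k)) \<le> sqrt (dot m ?r ?r) * sqrt (dot m (mat_vec T d (v k)) (mat_vec T d (v k)))"
          using abs_dot_le abs_le_D1 by blast
        also have "\<dots> \<le> 1 * sqrt (dot m (mat_vec T d (v k)) (mat_vec T d (v k)))"
        proof (intro mult_right_mono)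
          have "dot m ?r ?r \<le> dot m (mat_vec T g (v k)) (mat_vec T g (v k))"
            using sum_nonneg[of K "\<lambda>l. (dot m (u l) (mat_vec T g (v k)))\<^sup>2"] by (simp add: dot_residual_self K u)
          then have "sqrt (dot m ?r ?r) \<le> sqrt (dot m (mat_vec T g (v k)) (mat_vec T g (v k)))" by simp
          also have "\<dots> \<le> 1"
            using op_bounded_mat_vec[OF g(1), of "v k"] v k by (auto simp: orthonormal_def)
          finally show "sqrt (dot m ?r ?r) \<le> 1" .
        qed simp
        finally show "dot m ?r (mat_vec T d (v k)) \<le> sqrt (dot m (mat_vec T d (v k)) (mat_vec T d (v k)))" by simp
      qed
      also have "\<dots> \<le> sqrt s * frob_norm m T d"
        by (intro bound sum_mat_vec_le K v) simp
      finally show ?thesis .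
    qed
    have "frob m T d (?sw g) \<le> t"
      unfolding frob_sandwich_commute t_def using trace_duality[OF g(1)] by simp
    then show ?thesis
      using 1 2 g(2) unfolding frob_sandwich_right by simp
  qed
  moreover have "0 \<le> t" by (simp add: t_def)
  ultimately show ?thesis by blast
qed

section \<open>Lattice points and the transfer of quadratic lower bounds\<close>

text \<open>The radius is chosen for rounding: if y has squared norm at most m and each coordinate
  moves by at most 1, then z^2 \<le> 2 y^2 + 2 sums to at most 4 m. Extensionality outside the first
  m coordinates keeps the set finite.\<close>

definition lattice_ball :: "nat \<Rightarrow> (nat \<Rightarrow> int) set" where
  "lattice_ball m = {z \<in> PiE {..<m} (\<lambda>_. UNIV). (\<Sum>i<m. (z i)\<^sup>2) \<le> 4 * int m}"

lemma sum_half_power_abs_le: "(\<Sum>a\<in>{- int n..int n}. (1 / 2 :: real) ^ nat \<bar>a\<bar>) \<le> 3"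
proof -
  have "(\<Sum>a\<in>{- int n..int n}. (1 / 2 :: real) ^ nat \<bar>a\<bar>) = 3 - 2 * (1 / 2) ^ n"
  proof (induction n)
    case (Suc n)
    have "{- int (Suc n)..int (Suc n)} = insert (- int (Suc n)) (insert (int (Suc n)) {- int n..int n})"
      by auto
    then show ?case using Suc by (simp add: nat_add_distrib)
  qed simp
  then show ?thesis by simp
qed

lemma abs_le_square_int: "\<bar>z\<bar> \<le> (z::int)\<^sup>2"
proof (cases "z = 0")
  case False
  then have "\<bar>z\<bar> * 1 \<le> \<bar>z\<bar> * \<bar>z\<bar>" by (intro mult_left_mono) auto
  then show ?thesis by (simp add: power2_eq_square)
qed simp

lemma lattice_sum_abs_le:
  assumes "z \<in> lattice_ball m"
  shows "(\<Sum>i<m. nat \<bar>z i\<bar>) \<le> 4 * m"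
proof -
  have "int (\<Sum>i<m. nat \<bar>z i\<bar>) = (\<Sum>i<m. \<bar>z i\<bar>)" by simp
  also have "\<dots> \<le> (\<Sum>i<m. (z i)\<^sup>2)" by (intro sum_mono abs_le_square_int)
  also have "\<dots> \<le> 4 * int m" using assms by (simp add: lattice_ball_def)
  finally show ?thesis by linarith
qed

lemma lattice_subset_box: "lattice_ball m \<subseteq> PiE {..<m} (\<lambda>_. {- int (4 * m)..int (4 * m)})"
proof
  fix z assume z: "z \<in> lattice_ball m"
  have "\<bar>z i\<bar> \<le> int (4 * m)" if "i < m" for i
  proof -
    have "nat \<bar>z i\<bar> \<le> (\<Sum>i<m. nat \<bar>z i\<bar>)"
      using that by (intro member_le_sum) auto
    then show ?thesis using lattice_sum_abs_le[OF z] by linarith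
  qed
  then have "z i \<in> {- int (4 * m)..int (4 * m)}" if "i < m" for i
    using that by (auto simp: abs_le_iff minus_le_iff)
  then show "z \<in> PiE {..<m} (\<lambda>_. {- int (4 * m)..int (4 * m)})"
    using z by (auto simp: lattice_ball_def PiE_def Pi_def)
qed

lemma finite_lattice [simp]: "finite (lattice_ball m)"
  by (rule finite_subset[OF lattice_subset_box]) (auto intro: finite_PiE)

text \<open>Exponential counting: each lattice point has weight at least \<open>2\<^bsup>-4m\<^esup>\<close> in a product
  measure of total mass at most \<open>3\<^bsup>m\<^esup>\<close>.\<close>

lemma card_lattice_le: "real (card (lattice_ball m)) \<le> 48 ^ m"
proof -
  let ?w = "\<lambda>a::int. (1 / 2 :: real) ^ nat \<bar>a\<bar>"
  let ?B = "{- int (4 * m)..int (4 * m)}"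
  have "real (card (lattice_ball m)) * (1 / 2) ^ (4 * m) = (\<Sum>z\<in>lattice_ball m. (1 / 2) ^ (4 * m))" by simp
  also have "\<dots> \<le> (\<Sum>z\<in>lattice_ball m. \<Prod>i<m. ?w (z i))"
  proof (rule sum_mono)
    fix z assume "z \<in> lattice_ball m"
    then show "(1 / 2 :: real) ^ (4 * m) \<le> (\<Prod>i<m. ?w (z i))"
      unfolding power_sum[symmetric] by (intro power_decreasing lattice_sum_abs_le) auto
  qed
  also have "\<dots> \<le> (\<Sum>z\<in>PiE {..<m} (\<lambda>_. ?B). \<Prod>i<m. ?w (z i))"
    by (intro sum_mono2 lattice_subset_box prod_nonneg) (auto intro: finite_PiE)
  also have "\<dots> = (\<Prod>i<m. \<Sum>a\<in>?B. ?w a)"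
    by (rule prod_sum_PiE[symmetric]) auto
  also have "\<dots> \<le> 3 ^ m"
    using sum_half_power_abs_le[of "4 * m"] by (simp add: power_mono sum_nonneg)
  finally have "real (card (lattice_ball m)) * (1 / 16) ^ m \<le> 3 ^ m"
    by (simp add: power_mult power_divide)
  then have "real (card (lattice_ball m)) \<le> 3 ^ m * 16 ^ m"
    by (simp add: power_divide field_simps)
  then show ?thesis by (simp add: power_mult_distrib[symmetric])
qed

text \<open>Rounding the coordinates of \<open>\<surd>m u\<close> independently at random to an adjacent integer is
  unbiased and stays in the lattice.\<close>

lemma lattice_rounding:
  assumes u: "dot m u u \<le> 1" and m: "0 < m"
  shows "\<exists>p. (\<forall>z\<in>lattice_ball m. 0 \<le> p z) \<and> (\<Sum>z\<in>lattice_ball m. p z) = 1 \<and>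
    (\<forall>i<m. (\<Sum>z\<in>lattice_ball m. p z * (real_of_int (z i) / sqrt m)) = u i)"
proof -
  define y where "y i = u i * sqrt m" for i
  define Zi where "Zi i = {\<lfloor>y i\<rfloor>, \<lfloor>y i\<rfloor> + 1}" for i
  define w where "w i a = (if a = \<lfloor>y i\<rfloor> then 1 - frac (y i) else frac (y i))" for i a
  let ?Z = "PiE {..<m} Zi"
  have finZi: "finite (Zi i)" for i by (simp add: Zi_def)
  have w0: "0 \<le> w i a" for i a using frac_lt_1[of "y i"] by (auto simp: w_def)
  have w1: "(\<Sum>a\<in>Zi i. w i a) = 1" for i by (simp add: Zi_def w_def)
  have wy: "(\<Sum>a\<in>Zi i. w i a * real_of_int a) = y i" for i
    by (simp add: Zi_def w_def frac_def algebra_simps)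
  have sub: "?Z \<subseteq> lattice_ball m"
  proof
    fix z assume z: "z \<in> ?Z"
    have "real_of_int (z i) ^ 2 \<le> 2 * (y i)\<^sup>2 + 2" if "i < m" for i
    proof -
      have "z i = \<lfloor>y i\<rfloor> \<or> z i = \<lfloor>y i\<rfloor> + 1" using z that by (auto simp: PiE_def Pi_def Zi_def)
      then have "\<bar>real_of_int (z i) - y i\<bar> \<le> 1" by linarith
      then have "(real_of_int (z i) - y i)\<^sup>2 \<le> 1" by (simp add: abs_square_le_1)
      \<comment> \<open>Equivalent to z^2 \<le> 2 y^2 + 2 (z - y)^2, where the last square is at
        most 1.\<close>
      moreover have "0 \<le> (real_of_int (z i) - 2 * y i)\<^sup>2" by simp
      ultimately show ?thesis by (simp add: power2_eq_square algebra_simps)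
    qed
    then have "(\<Sum>i<m. real_of_int (z i) ^ 2) \<le> (\<Sum>i<m. 2 * (y i)\<^sup>2 + 2)"
      by (intro sum_mono) auto
    also have "\<dots> = 2 * (m * dot m u u) + 2 * m"
      by (simp add: y_def dot_def sum.distrib sum_distrib_left power2_eq_square mult_ac)
    also have "\<dots> \<le> 4 * m" using u mult_left_mono[OF u, of "real m"] by simp
    finally have "real_of_int (\<Sum>i<m. (z i)\<^sup>2) \<le> real_of_int (4 * int m)" by simp
    then have "(\<Sum>i<m. (z i)\<^sup>2) \<le> 4 * int m" by (simp only: of_int_le_iff)
    then show "z \<in> lattice_ball m" using z by (auto simp: lattice_ball_def PiE_def Pi_def)
  qed
  define p where "p z = (if z \<in> ?Z then \<Prod>i<m. w i (z i) else 0)" for z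
  have restrict: "(\<Sum>z\<in>lattice_ball m. p z * f z) = (\<Sum>z\<in>?Z. (\<Prod>i<m. w i (z i)) * f z)" for f
    using sub by (intro sum.mono_neutral_cong_right) (auto simp: p_def)
  have "(\<Sum>z\<in>lattice_ball m. p z) = (\<Sum>z\<in>?Z. \<Prod>i<m. w i (z i))"
    using restrict[of "\<lambda>_. 1"] by simp
  also have "\<dots> = (\<Prod>i<m. \<Sum>a\<in>Zi i. w i a)"
    by (rule prod_sum_PiE[symmetric]) (auto simp: finZi)
  finally have p1: "(\<Sum>z\<in>lattice_ball m. p z) = 1" by (simp add: w1)
  have py: "(\<Sum>z\<in>lattice_ball m. p z * real_of_int (z j)) = y j" if j: "j < m" for j
  proof -
    \<comment> \<open>The factor \<open>z j\<close> is written as a product over all coordinates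
      that is 1 off j, so that the sum factorises and every other coordinate contributes its total
      mass 1.\<close>
    have "(\<Sum>z\<in>lattice_ball m. p z * real_of_int (z j))
        = (\<Sum>z\<in>?Z. \<Prod>i<m. w i (z i) * (if i = j then real_of_int (z i) else 1))"
      unfolding restrict using j by (simp add: prod.distrib cong: if_cong)
    also have "\<dots> = (\<Prod>i<m. \<Sum>a\<in>Zi i. w i a * (if i = j then real_of_int a else 1))"
      by (rule prod_sum_PiE[symmetric]) (auto simp: finZi)
    also have "\<dots> = (\<Prod>i<m. if i = j then y j else 1)"
      by (intro prod.cong) (auto simp: wy w1)
    also have "\<dots> = y j" using j by simp
    finally show ?thesis .
  qed
  have "(\<Sum>z\<in>lattice_ball m. p z * (real_of_int (z i) / sqrt m)) = u i" if "i < m" for i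
    using py[OF that] m by (simp add: y_def sum_divide_distrib[symmetric])
  moreover have "\<forall>z\<in>lattice_ball m. 0 \<le> p z" by (auto simp: p_def w0 prod_nonneg)
  ultimately show ?thesis using p1 by blast
qed

abbreviation lattice_pairs :: "nat \<Rightarrow> nat \<Rightarrow> ((nat \<Rightarrow> int) \<times> (nat \<Rightarrow> int)) set" where
  "lattice_pairs m T \<equiv> lattice_ball m \<times> lattice_ball T"

definition lattice_outer ::
  "nat \<Rightarrow> nat \<Rightarrow> (nat \<Rightarrow> int) \<times> (nat \<Rightarrow> int) \<Rightarrow> nat \<Rightarrow> nat \<Rightarrow> real" where
  "lattice_outer m T x i j = (real_of_int (fst x i) / sqrt m) * (real_of_int (snd x j) / sqrt T)"

lemma card_lattice_pairs_le: "real (card (lattice_pairs m T)) \<le> 48 ^ (m + T)"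
  unfolding card_cartesian_product power_add of_nat_mult
  by (intro mult_mono card_lattice_le) auto

text \<open>Each scaled lattice vector has squared norm at most 4; the product 16 reappears in the
  later constants.\<close>

lemma frob_lattice_outer_le:
  assumes "x \<in> lattice_pairs m T" "0 < m" "0 < T"
  shows "frob m T (lattice_outer m T x) (lattice_outer m T x) \<le> 16"
proof -
  have le: "dot n (\<lambda>i. z i / sqrt n) (\<lambda>i. z i / sqrt n) \<le> 4" if "z \<in> lattice_ball n" "0 < n" for z n
  proof -
    have "dot n (\<lambda>i. z i / sqrt n) (\<lambda>i. z i / sqrt n) = real_of_int (\<Sum>i<n. (z i)\<^sup>2) / n"
      by (simp add: dot_def power2_eq_square sum_divide_distrib)
    also have "\<dots> \<le> real_of_int (4 * int n) / n"
      using that unfolding lattice_ball_def by (intro divide_right_mono) (auto simp only: of_int_le_iff mem_Collect_eq of_nat_0_le_iff)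
    finally show ?thesis using that(2) by simp
  qed
  have "frob m T (lattice_outer m T x) (lattice_outer m T x)
      = dot m (\<lambda>i. real_of_int (fst x i) / sqrt m) (\<lambda>i. real_of_int (fst x i) / sqrt m)
        * dot T (\<lambda>i. real_of_int (snd x i) / sqrt T) (\<lambda>i. real_of_int (snd x i) / sqrt T)"
    unfolding frob_def dot_def lattice_outer_def sum_product by (intro sum.cong refl) (simp add: mult_ac)
  also have "\<dots> \<le> 4 * 4"
    using assms by (intro mult_mono le) auto
  finally show ?thesis by simp
qed

text \<open>The two vectors of a singular pair are rounded independently, so the mean of the outer
  product is the outer product of the means. Mixing the pairs with weights proportional to their
  singular values then represents \<open>d\<close> exactly.\<close>

lemma trace_norm_ball_subset_hull:
  fixes d :: "nat \<Rightarrow> nat \<Rightarrow> real"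
  assumes m: "0 < m" and T: "0 < T"
  shows "\<exists>P. (\<forall>x\<in>lattice_pairs m T. 0 \<le> P x) \<and> (\<Sum>x\<in>lattice_pairs m T. P x) = 1 \<and>
    (\<forall>i<m. \<forall>j<T. d i j = trace_norm m T d * (\<Sum>x\<in>lattice_pairs m T. P x * lattice_outer m T x i j))"
proof -
  let ?g = "\<lambda>z n i. real_of_int (z i) / sqrt (real n)"
  obtain K \<sigma> u v where "is_svd m T d K \<sigma> u v" by (rule singular_value_decomposition)
  note K = is_svdD(1)[OF this] and pos = is_svdD(2)[OF this] and u = is_svdD(3)[OF this]
    and v = is_svdD(4)[OF this] and svd = is_svdD(5)[OF this] and sch = is_svdD(6)[OF this]
  have tn: "trace_norm m T d = (\<Sum>k\<in>K. \<sigma> k)" by (rule trace_norm_svd[OF sch pos])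
  have "\<forall>k\<in>K. \<exists>p. (\<forall>z\<in>lattice_ball m. 0 \<le> p z) \<and> (\<Sum>z\<in>lattice_ball m. p z) = 1 \<and>
    (\<forall>i<m. (\<Sum>z\<in>lattice_ball m. p z * ?g z m i) = u k i)"
    using u m by (intro ballI lattice_rounding) (auto simp: orthonormal_def)
  from bchoice[OF this] obtain p where "\<forall>k\<in>K. (\<forall>z\<in>lattice_ball m. 0 \<le> p k z) \<and>
    (\<Sum>z\<in>lattice_ball m. p k z) = 1 \<and> (\<forall>i<m. (\<Sum>z\<in>lattice_ball m. p k z * ?g z m i) = u k i)"
    by (elim exE) (rule that)
  then have p: "\<And>k z. k \<in> K \<Longrightarrow> z \<in> lattice_ball m \<Longrightarrow> 0 \<le> p k z"
    "\<And>k. k \<in> K \<Longrightarrow> (\<Sum>z\<in>lattice_ball m. p k z) = 1"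
    "\<And>k i. k \<in> K \<Longrightarrow> i < m \<Longrightarrow> (\<Sum>z\<in>lattice_ball m. p k z * ?g z m i) = u k i"
    by blast+
  have "\<forall>k\<in>K. \<exists>p. (\<forall>z\<in>lattice_ball T. 0 \<le> p z) \<and> (\<Sum>z\<in>lattice_ball T. p z) = 1 \<and>
    (\<forall>i<T. (\<Sum>z\<in>lattice_ball T. p z * ?g z T i) = v k i)"
    using v T by (intro ballI lattice_rounding) (auto simp: orthonormal_def)
  from bchoice[OF this] obtain r where "\<forall>k\<in>K. (\<forall>z\<in>lattice_ball T. 0 \<le> r k z) \<and>
    (\<Sum>z\<in>lattice_ball T. r k z) = 1 \<and> (\<forall>i<T. (\<Sum>z\<in>lattice_ball T. r k z * ?g z T i) = v k i)"
    by (elim exE) (rule that)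
  then have r: "\<And>k z. k \<in> K \<Longrightarrow> z \<in> lattice_ball T \<Longrightarrow> 0 \<le> r k z"
    "\<And>k. k \<in> K \<Longrightarrow> (\<Sum>z\<in>lattice_ball T. r k z) = 1"
    "\<And>k i. k \<in> K \<Longrightarrow> i < T \<Longrightarrow> (\<Sum>z\<in>lattice_ball T. r k z * ?g z T i) = v k i"
    by blast+
  have outer: "(\<Sum>x\<in>lattice_pairs m T. p k (fst x) * r k (snd x) * lattice_outer m T x i j) = u k i * v k j"
    if "k \<in> K" "i < m" "j < T" for k i j
  proof -
    have "u k i * v k j = (\<Sum>z\<in>lattice_ball m. p k z * ?g z m i) * (\<Sum>w\<in>lattice_ball T. r k w * ?g w T j)"
      by (simp only: p(3)[OF that(1,2)] r(3)[OF that(1,3)])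
    also have "\<dots> = (\<Sum>z\<in>lattice_ball m. \<Sum>w\<in>lattice_ball T. p k z * ?g z m i * (r k w * ?g w T j))"
      by (rule sum_product)
    finally show ?thesis
      by (simp add: sum.cartesian_product case_prod_unfold lattice_outer_def mult_ac)
  qed
  have one: "(\<Sum>x\<in>lattice_pairs m T. p k (fst x) * r k (snd x)) = 1" if "k \<in> K" for k
  proof -
    have "(\<Sum>z\<in>lattice_ball m. \<Sum>w\<in>lattice_ball T. p k z * r k w) = 1"
      using p(2) r(2) that by (simp add: sum_product[symmetric])
    then show ?thesis by (simp add: sum.cartesian_product case_prod_unfold)
  qed
  show ?thesis
  proof (cases "K = {}")
    \<comment> \<open>Here \<open>d\<close> vanishes and gives no mixing weights, but a probability
      vector is still required; rounding the zero vector provides one.\<close>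
    case True
    have "dot n (\<lambda>_. 0) (\<lambda>_. 0) \<le> 1" for n by (simp add: dot_def)
    from lattice_rounding[OF this[of m] m] lattice_rounding[OF this[of T] T]
    obtain p r :: "(nat \<Rightarrow> int) \<Rightarrow> real" where pr: "\<forall>z\<in>lattice_ball m. 0 \<le> p z" "(\<Sum>z\<in>lattice_ball m. p z) = 1"
      "\<forall>z\<in>lattice_ball T. 0 \<le> r z" "(\<Sum>z\<in>lattice_ball T. r z) = 1" by blast
    have "(\<Sum>z\<in>lattice_ball m. \<Sum>w\<in>lattice_ball T. p z * r w) = 1"
      using pr(2,4) by (simp add: sum_product[symmetric])
    then have "(\<Sum>x\<in>lattice_pairs m T. p (fst x) * r (snd x)) = 1"
      by (simp add: sum.cartesian_product case_prod_unfold)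
    moreover have "\<forall>x\<in>lattice_pairs m T. 0 \<le> p (fst x) * r (snd x)" using pr(1,3) by auto
    moreover have "trace_norm m T d = 0" using tn True by simp
    moreover have "d i j = 0" if "i < m" "j < T" for i j using svd[OF that] True by simp
    ultimately show ?thesis
      by (intro exI[of _ "\<lambda>x. p (fst x) * r (snd x)"]) (simp only: mult_zero_left, blast)
  next
    case False
    then have tpos: "0 < trace_norm m T d" unfolding tn using K pos by (intro sum_pos) auto
    define P where "P x = (\<Sum>k\<in>K. \<sigma> k / trace_norm m T d * (p k (fst x) * r k (snd x)))" for x
    have "\<forall>x\<in>lattice_pairs m T. 0 \<le> P x"
      unfolding P_def using pos p(1) r(1) tpos by (auto intro!: sum_nonneg mult_nonneg_nonneg simp: less_imp_le)
    moreover have "(\<Sum>x\<in>lattice_pairs m T. P x) = 1"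
    proof -
      have "(\<Sum>x\<in>lattice_pairs m T. P x)
          = (\<Sum>k\<in>K. \<sigma> k / trace_norm m T d * (\<Sum>x\<in>lattice_pairs m T. p k (fst x) * r k (snd x)))"
        unfolding P_def by (subst sum.swap) (simp add: sum_distrib_left)
      also have "\<dots> = (\<Sum>k\<in>K. \<sigma> k / trace_norm m T d)" by (intro sum.cong refl) (simp add: one)
      also have "\<dots> = 1" using tpos by (simp add: sum_divide_distrib[symmetric] tn)
      finally show ?thesis .
    qed
    moreover have "d i j = trace_norm m T d * (\<Sum>x\<in>lattice_pairs m T. P x * lattice_outer m T x i j)"
      if "i < m" "j < T" for i j
    proof -
      have "(\<Sum>x\<in>lattice_pairs m T. P x * lattice_outer m T x i j)
          = (\<Sum>k\<in>K. \<sigma> k / trace_norm m T d *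
              (\<Sum>x\<in>lattice_pairs m T. p k (fst x) * r k (snd x) * lattice_outer m T x i j))"
        unfolding P_def sum_distrib_right by (subst sum.swap) (simp add: sum_distrib_left mult.assoc)
      also have "\<dots> = (\<Sum>k\<in>K. \<sigma> k * u k i * v k j) / trace_norm m T d"
        using that unfolding sum_divide_distrib by (intro sum.cong refl) (simp add: outer)
      finally show ?thesis using tpos svd[OF that] by simp
    qed
    ultimately show ?thesis by blast
  qed
qed

lemma trace_norm_ball_hullE:
  assumes "0 < m" "0 < T"
  obtains P where "\<And>x. x \<in> lattice_pairs m T \<Longrightarrow> 0 \<le> P x" "(\<Sum>x\<in>lattice_pairs m T. P x) = 1"
    "\<And>i j. i < m \<Longrightarrow> j < T \<Longrightarrow>
      d i j = trace_norm m T d * (\<Sum>x\<in>lattice_pairs m T. P x * lattice_outer m T x i j)"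
proof -
  obtain P where "\<forall>x\<in>lattice_pairs m T. 0 \<le> P x" "(\<Sum>x\<in>lattice_pairs m T. P x) = 1"
    "\<forall>i<m. \<forall>j<T. d i j = trace_norm m T d * (\<Sum>x\<in>lattice_pairs m T. P x * lattice_outer m T x i j)"
    using trace_norm_ball_subset_hull[OF assms, of d] by (elim exE conjE) (rule that)
  then show ?thesis by (intro that[of P]) blast+
qed

lemma frob_hull:
  assumes "\<And>i j. i < m \<Longrightarrow> j < T \<Longrightarrow> d i j = c * (\<Sum>x\<in>I. P x * g x i j)"
  shows "frob m T a d = c * (\<Sum>x\<in>I. P x * frob m T a (g x))"
proof -
  have "frob m T a d = frob m T a (\<lambda>i j. c * (\<Sum>x\<in>I. P x * g x i j))"
    by (rule frob_cong) (auto simp: assms)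
  then show ?thesis by (simp add: frob_scale_right frob_sum_right)
qed

text \<open>Turns finitely many estimates into one that is uniform over all matrices, hence valid
  for the random error of the estimator.\<close>

lemma frob_le_trace_norm_if_lattice:
  assumes m: "0 < m" and T: "0 < T"
    and b: "\<And>x. x \<in> lattice_pairs m T \<Longrightarrow> \<bar>frob m T a (lattice_outer m T x)\<bar> \<le> t"
  shows "\<bar>frob m T a d\<bar> \<le> t * trace_norm m T d"
proof -
  obtain P where P: "\<And>x. x \<in> lattice_pairs m T \<Longrightarrow> 0 \<le> P x" "(\<Sum>x\<in>lattice_pairs m T. P x) = 1"
    and d: "\<And>i j. i < m \<Longrightarrow> j < T \<Longrightarrow>
      d i j = trace_norm m T d * (\<Sum>x\<in>lattice_pairs m T. P x * lattice_outer m T x i j)"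
    by (rule trace_norm_ball_hullE[OF m T, of d]) blast
  have hull: "frob m T a d = trace_norm m T d * (\<Sum>x\<in>lattice_pairs m T. P x * frob m T a (lattice_outer m T x))"
    by (rule frob_hull[OF d])
  have "\<bar>\<Sum>x\<in>lattice_pairs m T. P x * frob m T a (lattice_outer m T x)\<bar> \<le> (\<Sum>x\<in>lattice_pairs m T. P x * t)"
  proof (rule order_trans[OF sum_abs], rule sum_mono)
    fix x assume x: "x \<in> lattice_pairs m T"
    then show "\<bar>P x * frob m T a (lattice_outer m T x)\<bar> \<le> P x * t"
      using b[OF x] P(1)[OF x] by (simp add: abs_mult mult_left_mono)
  qed
  also have "\<dots> = t" using P(2) by (simp add: sum_distrib_right[symmetric])
  finally show ?thesis
    unfolding hull abs_mult by (simp add: mult.commute[of t] mult_left_mono)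
qed

section \<open>Maurey's empirical method\<close>

lemma exists_le_average:
  fixes p f :: "'i \<Rightarrow> real"
  assumes "finite I" "\<And>x. x \<in> I \<Longrightarrow> 0 \<le> p x" "(\<Sum>x\<in>I. p x) = 1"
  shows "\<exists>x\<in>I. f x \<le> (\<Sum>x\<in>I. p x * f x)"
proof (rule ccontr)
  let ?c = "\<Sum>x\<in>I. p x * f x"
  assume "\<not> ?thesis"
  then have gt: "\<And>x. x \<in> I \<Longrightarrow> ?c < f x" by auto
  have "(\<Sum>x\<in>I. p x * (f x - ?c)) = 0"
    by (simp add: right_diff_distrib sum_subtractf sum_distrib_right[symmetric] assms(3))
  then have "\<forall>x\<in>I. p x * (f x - ?c) = 0"
    using assms(1,2) gt by (subst (asm) sum_nonneg_eq_0_iff) (simp_all add: less_imp_le)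
  then have "\<forall>x\<in>I. p x = 0" using gt by fastforce
  then show False using assms(3) by simp
qed

text \<open>Maurey's empirical method for a quadratic form with Gram matrix \<open>h\<close>: the right-hand side is
  the expectation of the form at a sum of \<open>k\<close> independent points drawn according to \<open>p\<close>.\<close>

lemma empirical_method:
  fixes h :: "'i \<Rightarrow> 'i \<Rightarrow> real"
  assumes fin: "finite I" and p0: "\<And>x. x \<in> I \<Longrightarrow> 0 \<le> p x" and p1: "(\<Sum>x\<in>I. p x) = 1"
    and sym: "\<And>x y. h x y = h y x"
  shows "\<exists>xs. set xs \<subseteq> I \<and> length xs = k \<and> (\<Sum>x\<leftarrow>xs. \<Sum>y\<leftarrow>xs. h x y)
    \<le> k * (\<Sum>x\<in>I. p x * h x x) + k * (real k - 1) * (\<Sum>x\<in>I. p x * (\<Sum>y\<in>I. p y * h x y))"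
proof -
  let ?Q = "\<lambda>xs. \<Sum>x\<leftarrow>xs. \<Sum>y\<leftarrow>xs. h x y"
  define b where "b x = (\<Sum>y\<in>I. p y * h x y)" for x
  define D where "D = (\<Sum>x\<in>I. p x * h x x)"
  define H where "H = (\<Sum>x\<in>I. p x * b x)"
  \<comment> \<open>The expectation of the form at \<open>C\<close> extended by k further
    independent points. Choosing these points one at a time without raising the expectation
    derandomises the argument.\<close>
  define F where "F k C = ?Q C + 2 * real k * (\<Sum>c\<leftarrow>C. b c) + k * D + k * (real k - 1) * H" for k C
  have avg_list: "(\<Sum>x\<in>I. p x * (\<Sum>c\<leftarrow>C. h x c)) = (\<Sum>c\<leftarrow>C. b c)" for C
    by (induction C) (simp_all add: distrib_left sum.distrib b_def sym[of _ "_ :: 'i"])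
  have Q_Cons: "?Q (x # C) = h x x + 2 * (\<Sum>c\<leftarrow>C. h x c) + ?Q C" for x C
  proof -
    have "(\<Sum>c\<leftarrow>C. h c x + (\<Sum>y\<leftarrow>C. h c y)) = (\<Sum>c\<leftarrow>C. h x c) + ?Q C"
      by (simp add: sum_list_addf sym[of _ x])
    then show ?thesis by simp
  qed
  have step: "\<exists>x\<in>I. F k (x # C) \<le> F (Suc k) C" for k C
  proof -
    have "(\<Sum>x\<in>I. p x * F k (x # C)) = F (Suc k) C"
    proof -
      have "p x * F k (x # C) = p x * h x x + 2 * (p x * (\<Sum>c\<leftarrow>C. h x c)) + 2 * real k * (p x * b x)
          + p x * (?Q C + 2 * real k * (\<Sum>c\<leftarrow>C. b c) + k * D + k * (real k - 1) * H)" for x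
        unfolding F_def Q_Cons by (simp add: algebra_simps)
      then have "(\<Sum>x\<in>I. p x * F k (x # C)) = D + 2 * (\<Sum>c\<leftarrow>C. b c) + 2 * real k * H
          + (?Q C + 2 * real k * (\<Sum>c\<leftarrow>C. b c) + k * D + k * (real k - 1) * H)"
        by (simp only: sum.distrib sum_distrib_left[symmetric] sum_distrib_right[symmetric] p1 avg_list D_def[symmetric] H_def[symmetric]) simp
      then show ?thesis unfolding F_def by (simp add: algebra_simps)
    qed
    then show ?thesis using exists_le_average[OF fin p0 p1, of "\<lambda>x. F k (x # C)"] by simp
  qed
  have "\<exists>xs. set xs \<subseteq> I \<and> length xs = length C + k \<and> ?Q xs \<le> F k C" if "set C \<subseteq> I" for C
    using that
  proof (induction k arbitrary: C)
    case 0
    then show ?case by (intro exI[of _ C]) (simp add: F_def)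
  next
    case (Suc k)
    obtain x where x: "x \<in> I" "F k (x # C) \<le> F (Suc k) C" using step by blast
    then obtain xs where "set xs \<subseteq> I" "length xs = length (x # C) + k" "?Q xs \<le> F k (x # C)"
      using Suc.IH[of "x # C"] Suc.prems by auto
    then show ?case using x(2) by (intro exI[of _ xs]) auto
  qed
  from this[of "[]"] show ?thesis by (simp add: F_def D_def H_def b_def)
qed

lemma frob_sum_list_right: "frob m T a (\<lambda>i j. \<Sum>x\<leftarrow>xs. g x i j) = (\<Sum>x\<leftarrow>xs. frob m T a (g x))"
proof (induction xs)
  case Nil
  show ?case by (simp add: frob_def dot_def)
qed (simp add: frob_add_right)

lemma frob_sum_list_left: "frob m T (\<lambda>i j. \<Sum>x\<leftarrow>xs. g x i j) a = (\<Sum>x\<leftarrow>xs. frob m T (g x) a)"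
  by (subst frob_commute, subst frob_sum_list_right) (simp add: frob_commute)

lemma sum_list_product:
  fixes f g :: "'i \<Rightarrow> real"
  shows "(\<Sum>x\<leftarrow>xs. \<Sum>y\<leftarrow>ys. f x * g y) = (\<Sum>x\<leftarrow>xs. f x) * (\<Sum>y\<leftarrow>ys. g y)"
  by (simp add: sum_list_const_mult sum_list_mult_const)

lemma sum_list_divide_distrib:
  fixes f :: "'i \<Rightarrow> real"
  shows "(\<Sum>x\<leftarrow>xs. f x / c) = (\<Sum>x\<leftarrow>xs. f x) / c"
  by (induction xs) (simp_all add: add_divide_distrib)

lemma sum_list_sum_swap:
  fixes f :: "'i \<Rightarrow> 'k \<Rightarrow> real"
  shows "(\<Sum>x\<leftarrow>xs. \<Sum>k\<in>A. f x k) = (\<Sum>k\<in>A. \<Sum>x\<leftarrow>xs. f x k)"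
  by (induction xs) (simp_all add: sum.distrib)

text \<open>For the empirical form minus half the Hilbert-Schmidt form, the expectation at a random
  k-sum has k diagonal and k (k - 1) off-diagonal terms. \<open>lower\<close> makes the form
  nonnegative at every k-sum and \<open>upper\<close> bounds the diagonal by C, so the off-diagonal
  mean is at least - C / (k - 1). Multiplied by \<open>(trace_norm m T d)\<^sup>2\<close>, this mean
  is the form at \<open>d\<close>.\<close>

lemma quadratic_lower_bound_transfer:
  fixes X :: "nat \<Rightarrow> nat \<Rightarrow> nat \<Rightarrow> real"
  assumes m: "0 < m" and T: "0 < T" and k: "2 \<le> k"
    and upper: "\<And>x. x \<in> lattice_pairs m T \<Longrightarrow> (\<Sum>i<N. (frob m T (X i) (lattice_outer m T x))\<^sup>2) / N \<le> C"
    and lower: "\<And>xs. set xs \<subseteq> lattice_pairs m T \<Longrightarrow> length xs = k \<Longrightarrow>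
      frob m T (\<lambda>i j. \<Sum>x\<leftarrow>xs. lattice_outer m T x i j) (\<lambda>i j. \<Sum>x\<leftarrow>xs. lattice_outer m T x i j) / 2
      \<le> (\<Sum>i<N. (frob m T (X i) (\<lambda>i j. \<Sum>x\<leftarrow>xs. lattice_outer m T x i j))\<^sup>2) / N"
  shows "frob m T d d / 2 - (trace_norm m T d)\<^sup>2 * C / (k - 1) \<le> (\<Sum>i<N. (frob m T (X i) d)\<^sup>2) / N"
proof -
  let ?I = "lattice_pairs m T"
  let ?g = "lattice_outer m T"
  define h where "h x y = (\<Sum>i<N. frob m T (X i) (?g x) * frob m T (X i) (?g y)) / N - frob m T (?g x) (?g y) / 2" for x y
  obtain P where P: "\<And>x. x \<in> ?I \<Longrightarrow> 0 \<le> P x" "(\<Sum>x\<in>?I. P x) = 1"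
    and d: "\<And>i j. i < m \<Longrightarrow> j < T \<Longrightarrow> d i j = trace_norm m T d * (\<Sum>x\<in>?I. P x * ?g x i j)"
    by (rule trace_norm_ball_hullE[OF m T, of d]) blast
  let ?H = "\<Sum>x\<in>?I. P x * (\<Sum>y\<in>?I. P y * h x y)"
  have h_sym: "h x y = h y x" for x y
    unfolding h_def by (subst frob_commute) (simp only: mult.commute)
  obtain xs where xs: "set xs \<subseteq> ?I" "length xs = k"
    and le: "(\<Sum>x\<leftarrow>xs. \<Sum>y\<leftarrow>xs. h x y) \<le> k * (\<Sum>x\<in>?I. P x * h x x) + k * (real k - 1) * ?H"
    using empirical_method[of ?I P h k, OF _ P h_sym] by auto
  have "(\<Sum>x\<leftarrow>xs. \<Sum>y\<leftarrow>xs. h x y)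
      = (\<Sum>i<N. (frob m T (X i) (\<lambda>i j. \<Sum>x\<leftarrow>xs. ?g x i j))\<^sup>2) / N
        - frob m T (\<lambda>i j. \<Sum>x\<leftarrow>xs. ?g x i j) (\<lambda>i j. \<Sum>x\<leftarrow>xs. ?g x i j) / 2"
  proof -
    have "(\<Sum>x\<leftarrow>xs. \<Sum>y\<leftarrow>xs. h x y) = (\<Sum>x\<leftarrow>xs. \<Sum>y\<leftarrow>xs. (\<Sum>i<N. frob m T (X i) (?g x) * frob m T (X i) (?g y)) / N)
        - (\<Sum>x\<leftarrow>xs. \<Sum>y\<leftarrow>xs. frob m T (?g x) (?g y) / 2)"
      by (simp add: h_def sum_list_subtractf)
    also have "(\<Sum>x\<leftarrow>xs. \<Sum>y\<leftarrow>xs. (\<Sum>i<N. frob m T (X i) (?g x) * frob m T (X i) (?g y)) / N)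
        = (\<Sum>i<N. (\<Sum>x\<leftarrow>xs. frob m T (X i) (?g x)) * (\<Sum>x\<leftarrow>xs. frob m T (X i) (?g x)) / N)"
      by (simp add: sum_divide_distrib sum_list_sum_swap sum_list_product[symmetric] sum_list_divide_distrib)
    also have "(\<Sum>x\<leftarrow>xs. \<Sum>y\<leftarrow>xs. frob m T (?g x) (?g y) / 2)
        = frob m T (\<lambda>i j. \<Sum>x\<leftarrow>xs. ?g x i j) (\<lambda>i j. \<Sum>x\<leftarrow>xs. ?g x i j) / 2"
      unfolding sum_list_divide_distrib
      by (subst frob_sum_list_left) (simp only: frob_sum_list_right)
    finally show ?thesis by (simp add: frob_sum_list_right power2_eq_square sum_divide_distrib)
  qed
  then have "0 \<le> (\<Sum>x\<leftarrow>xs. \<Sum>y\<leftarrow>xs. h x y)" using lower[OF xs] by simp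
  moreover have "(\<Sum>x\<in>?I. P x * h x x) \<le> (\<Sum>x\<in>?I. P x * C)"
  proof (intro sum_mono mult_left_mono P)
    fix x assume "x \<in> ?I"
    then show "h x x \<le> C"
      using upper[of x] frob_self_nonneg[of m T "?g x"]
      unfolding h_def power2_eq_square by linarith
  qed
  moreover have "(\<Sum>x\<in>?I. P x * C) = C" using P(2) by (simp add: sum_distrib_right[symmetric])
  ultimately have "0 \<le> k * C + k * (real k - 1) * ?H"
    using le mult_left_mono[of "\<Sum>x\<in>?I. P x * h x x" C "real k"] by simp
  then have "0 \<le> real k * (C + (real k - 1) * ?H)" by (simp add: algebra_simps)
  then have "0 \<le> C + (real k - 1) * ?H" using k by (simp add: zero_le_mult_iff)
  then have H: "- C / (real k - 1) \<le> ?H" using k by (simp add: field_simps)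
  have "(\<Sum>i<N. (frob m T (X i) d)\<^sup>2) / N - frob m T d d / 2 = (trace_norm m T d)\<^sup>2 * ?H"
  proof -
    let ?c = "trace_norm m T d"
    have hull: "frob m T a d = ?c * (\<Sum>x\<in>?I. P x * frob m T a (?g x))" for a
      by (rule frob_hull[OF d])
    have "?H = (\<Sum>x\<in>?I. \<Sum>y\<in>?I. (\<Sum>i<N. (P x * frob m T (X i) (?g x)) * (P y * frob m T (X i) (?g y)) / N)
        - P x * (P y * frob m T (?g x) (?g y)) / 2)"
      by (simp add: h_def sum_distrib_left sum_divide_distrib right_diff_distrib mult_ac)
    also have "\<dots> = (\<Sum>i<N. (\<Sum>x\<in>?I. P x * frob m T (X i) (?g x)) * (\<Sum>y\<in>?I. P y * frob m T (X i) (?g y)) / N)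
        - (\<Sum>x\<in>?I. P x * (\<Sum>y\<in>?I. P y * frob m T (?g x) (?g y))) / 2"
    proof -
      let ?f = "\<lambda>i x. P x * frob m T (X i) (?g x)"
      have "(\<Sum>x\<in>?I. \<Sum>y\<in>?I. \<Sum>i<N. ?f i x * ?f i y / N) = (\<Sum>x\<in>?I. \<Sum>i<N. \<Sum>y\<in>?I. ?f i x * ?f i y / N)"
        by (rule sum.cong[OF refl]) (rule sum.swap)
      also have "\<dots> = (\<Sum>i<N. \<Sum>x\<in>?I. \<Sum>y\<in>?I. ?f i x * ?f i y / N)"
        by (rule sum.swap)
      also have "\<dots> = (\<Sum>i<N. (\<Sum>x\<in>?I. ?f i x) * (\<Sum>y\<in>?I. ?f i y) / N)"
        by (simp only: sum_product sum_divide_distrib)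
      finally have "(\<Sum>x\<in>?I. \<Sum>y\<in>?I. \<Sum>i<N. ?f i x * ?f i y / N)
          = (\<Sum>i<N. (\<Sum>x\<in>?I. ?f i x) * (\<Sum>y\<in>?I. ?f i y) / N)" .
      moreover have "(\<Sum>x\<in>?I. \<Sum>y\<in>?I. P x * (P y * frob m T (?g x) (?g y)) / 2)
          = (\<Sum>x\<in>?I. P x * (\<Sum>y\<in>?I. P y * frob m T (?g x) (?g y))) / 2"
        by (simp only: sum_distrib_left sum_divide_distrib)
      ultimately show ?thesis by (simp only: sum_subtractf)
    qed
    finally have "?c\<^sup>2 * ?H
        = ?c\<^sup>2 * (\<Sum>i<N. (\<Sum>x\<in>?I. P x * frob m T (X i) (?g x)) * (\<Sum>y\<in>?I. P y * frob m T (X i) (?g y)) / N)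
          - ?c\<^sup>2 * (\<Sum>x\<in>?I. P x * (\<Sum>y\<in>?I. P y * frob m T (?g x) (?g y))) / 2"
      by (simp only: right_diff_distrib times_divide_eq_right)
    moreover have "?c\<^sup>2 * (\<Sum>x\<in>?I. P x * (\<Sum>y\<in>?I. P y * frob m T (?g x) (?g y))) = frob m T d d"
    proof -
      have "frob m T d d = ?c * (\<Sum>x\<in>?I. P x * frob m T d (?g x))" by (rule hull)
      also have "\<dots> = ?c * (\<Sum>x\<in>?I. P x * (?c * (\<Sum>y\<in>?I. P y * frob m T (?g x) (?g y))))"
        by (simp only: frob_commute[of m T d "?g _"] hull)
      finally show ?thesis by (simp add: power2_eq_square sum_distrib_left mult_ac)
    qed
    moreover have "(\<Sum>i<N. (frob m T (X i) d)\<^sup>2) / N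
        = ?c\<^sup>2 * (\<Sum>i<N. (\<Sum>x\<in>?I. P x * frob m T (X i) (?g x)) * (\<Sum>y\<in>?I. P y * frob m T (X i) (?g y)) / N)"
    proof -
      have "(\<Sum>i<N. (c * S i)\<^sup>2) / N = c\<^sup>2 * (\<Sum>i<N. S i * S i / N)" for c :: real and S
        by (simp add: sum_distrib_left sum_divide_distrib power2_eq_square mult_ac)
      then show ?thesis unfolding hull .
    qed
    ultimately show ?thesis by simp
  qed
  moreover have "(trace_norm m T d)\<^sup>2 * (- C / (real k - 1)) \<le> (trace_norm m T d)\<^sup>2 * ?H"
    using H by (rule mult_left_mono) simp
  ultimately show ?thesis using k by (simp add: of_nat_diff)
qed

section \<open>Concentration of sample sums\<close>

abbreviation sample :: "nat \<Rightarrow> 'a measure \<Rightarrow> (nat \<Rightarrow> 'a) measure" where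
  "sample N M \<equiv> Pi\<^sub>M {..<N} (\<lambda>_. M)"

lemma prob_space_sample: "prob_space M \<Longrightarrow> prob_space (sample N M)"
  by (rule prob_space_PiM)

lemma measurable_sample_component:
  "f \<in> borel_measurable M \<Longrightarrow> i < N \<Longrightarrow> (\<lambda>Z. f (Z i)) \<in> borel_measurable (sample N M)"
  by (rule measurable_compose[OF measurable_component_singleton]) auto

lemma measurable_sample_sum:
  fixes f :: "'a \<Rightarrow> real"
  assumes "f \<in> borel_measurable M" "J \<subseteq> {..<N}"
  shows "(\<lambda>Z. \<Sum>i\<in>J. f (Z i)) \<in> borel_measurable (sample N M)"
proof (rule borel_measurable_sum)
  fix i assume "i \<in> J"
  then show "(\<lambda>Z. f (Z i)) \<in> borel_measurable (sample N M)"
    using assms by (intro measurable_sample_component[of f M i N]) auto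
qed

lemma nn_integral_sample_prod:
  assumes M: "prob_space M" and f: "f \<in> borel_measurable M" and J: "J \<subseteq> {..<N}"
  shows "(\<integral>\<^sup>+Z. (\<Prod>i\<in>J. f (Z i)) \<partial>sample N M) = (\<integral>\<^sup>+x. f x \<partial>M) ^ card J"
proof -
  interpret prob_space M by fact
  interpret S: product_sigma_finite "\<lambda>_::nat. M"
    by (simp add: product_sigma_finite_def sigma_finite_measure_axioms)
  define g where "g i x = (if i \<in> J then f x else 1)" for i x
  have "(\<integral>\<^sup>+Z. (\<Prod>i\<in>J. f (Z i)) \<partial>sample N M) = (\<integral>\<^sup>+Z. (\<Prod>i\<in>{..<N}. g i (Z i)) \<partial>sample N M)"
    using J by (intro nn_integral_cong prod.mono_neutral_cong_left) (auto simp: g_def)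
  also have "\<dots> = (\<Prod>i\<in>{..<N}. \<integral>\<^sup>+x. g i x \<partial>M)"
    using f by (intro S.product_nn_integral_prod) (auto simp: g_def)
  also have "\<dots> = (\<Prod>i\<in>J. \<integral>\<^sup>+x. f x \<partial>M)"
    using J by (intro prod.mono_neutral_cong_right) (auto simp: g_def emeasure_space_1)
  finally show ?thesis by simp
qed

text \<open>The exponential moment is a nonnegative integral, so integrability never has to be shown
  beforehand. A general index set \<open>J\<close> is allowed for the sake of sums over d-element
  subsets of the sample.\<close>

lemma chernoff_sample:
  assumes M: "prob_space M" and f: "f \<in> borel_measurable M" and J: "J \<subseteq> {..<N}"
    and R: "(\<integral>\<^sup>+x. ennreal (exp (f x)) \<partial>M) \<le> ennreal R" "0 \<le> R"
  shows "measure (sample N M) {Z \<in> space (sample N M). t \<le> (\<Sum>i\<in>J. f (Z i))} \<le> R ^ card J * exp (- t)"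
proof -
  interpret S: prob_space "sample N M" by (rule prob_space_sample[OF M])
  let ?u = "\<lambda>Z. \<Prod>i\<in>J. ennreal (exp (f (Z i)))"
  let ?A = "{Z \<in> space (sample N M). t \<le> (\<Sum>i\<in>J. f (Z i))}"
  have meas: "?u \<in> borel_measurable (sample N M)"
  proof (rule borel_measurable_prod_ennreal)
    fix i assume "i \<in> J"
    then have [measurable]: "(\<lambda>Z. f (Z i)) \<in> borel_measurable (sample N M)"
      using J f by (intro measurable_sample_component[of f M i N]) auto
    show "(\<lambda>Z. ennreal (exp (f (Z i)))) \<in> borel_measurable (sample N M)" by measurable
  qed
  have u: "?u Z = ennreal (exp (\<Sum>i\<in>J. f (Z i)))" for Z
    using J finite_subset[OF J] by (simp add: prod_ennreal exp_sum)
  have "emeasure (sample N M) {Z \<in> space (sample N M). 1 \<le> ennreal (exp (- t)) * ?u Z}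
      \<le> ennreal (exp (- t)) * (\<integral>\<^sup>+Z. ?u Z * indicator (space (sample N M)) Z \<partial>sample N M)"
    using meas by (intro nn_integral_Markov_inequality) auto
  also have "(\<integral>\<^sup>+Z. ?u Z * indicator (space (sample N M)) Z \<partial>sample N M) = (\<integral>\<^sup>+Z. ?u Z \<partial>sample N M)"
    by (intro nn_integral_cong) simp
  also have "\<dots> = (\<integral>\<^sup>+x. ennreal (exp (f x)) \<partial>M) ^ card J"
    using f by (intro nn_integral_sample_prod[OF M _ J]) auto
  also have "ennreal (exp (- t)) * \<dots> \<le> ennreal (exp (- t)) * ennreal R ^ card J"
    by (intro mult_left_mono power_mono R) auto
  also have "\<dots> = ennreal (R ^ card J * exp (- t))"
    using R(2) by (simp add: ennreal_power ennreal_mult[symmetric] mult.commute)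
  also have "{Z \<in> space (sample N M). 1 \<le> ennreal (exp (- t)) * ?u Z} = ?A"
    unfolding u by (auto simp: ennreal_mult[symmetric] exp_add[symmetric] simp flip: ennreal_1)
  finally show ?thesis
    using R(2) by (simp add: S.emeasure_eq_measure)
qed

lemma measure_union_bound:
  fixes b :: real
  assumes M: "prob_space M" and I: "finite I"
    and B: "\<And>x. x \<in> I \<Longrightarrow> B x \<in> sets M" "\<And>x. x \<in> I \<Longrightarrow> measure M (B x) \<le> b"
  shows "measure M (\<Union>x\<in>I. B x) \<le> real (card I) * b"
proof -
  interpret prob_space M by fact
  have "measure M (\<Union>x\<in>I. B x) \<le> (\<Sum>x\<in>I. measure M (B x))"
    using B(1) by (intro finite_measure_subadditive_finite[OF I]) auto
  also have "\<dots> \<le> (\<Sum>x\<in>I. b)" by (intro sum_mono B)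
  finally show ?thesis by simp
qed

text \<open>The exceptional set is existential because the set where \<open>Q\<close> holds need not be measurable.\<close>

definition holds_whp :: "'a measure \<Rightarrow> real \<Rightarrow> ('a \<Rightarrow> bool) \<Rightarrow> bool" where
  "holds_whp M \<epsilon> Q \<longleftrightarrow> (\<exists>B\<in>sets M. measure M B \<le> \<epsilon> \<and> (\<forall>x\<in>space M - B. Q x))"

lemma holds_whp_conj:
  assumes "prob_space M" "holds_whp M \<epsilon>1 Q1" "holds_whp M \<epsilon>2 Q2"
  shows "holds_whp M (\<epsilon>1 + \<epsilon>2) (\<lambda>x. Q1 x \<and> Q2 x)"
proof -
  interpret prob_space M by fact
  obtain B1 B2 where B: "B1 \<in> sets M" "measure M B1 \<le> \<epsilon>1" "\<forall>x\<in>space M - B1. Q1 x"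
    "B2 \<in> sets M" "measure M B2 \<le> \<epsilon>2" "\<forall>x\<in>space M - B2. Q2 x"
    using assms(2,3) unfolding holds_whp_def by blast
  have "measure M (B1 \<union> B2) \<le> \<epsilon>1 + \<epsilon>2"
    using measure_Un_le[OF B(1,4)] B(2,5) by linarith
  then show ?thesis unfolding holds_whp_def using B by (intro bexI[of _ "B1 \<union> B2"]) auto
qed

lemma holds_whp_mono:
  assumes "holds_whp M \<epsilon> Q" "\<epsilon> \<le> \<epsilon>'" "\<And>x. x \<in> space M \<Longrightarrow> Q x \<Longrightarrow> Q' x"
  shows "holds_whp M \<epsilon>' Q'"
proof -
  obtain B where "B \<in> sets M" "measure M B \<le> \<epsilon>" "\<forall>x\<in>space M - B. Q x"
    using assms(1) unfolding holds_whp_def by blast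
  then show ?thesis
    unfolding holds_whp_def using assms(2,3) by (intro bexI[of _ B]) auto
qed

lemma holds_whp_event:
  assumes M: "prob_space M" and Q: "holds_whp M \<epsilon> Q"
  shows "\<exists>E\<in>sets M. 1 - \<epsilon> \<le> measure M E \<and> (\<forall>x\<in>E. Q x)"
proof -
  interpret prob_space M by fact
  obtain B where B: "B \<in> sets M" "measure M B \<le> \<epsilon>" "\<forall>x\<in>space M - B. Q x"
    using Q unfolding holds_whp_def by blast
  then show ?thesis by (intro bexI[of _ "space M - B"]) (auto simp: prob_compl)
qed

text \<open>The subset \<open>J x\<close> may vary with the index, so a maximum over all subsets of
  a given size becomes a union bound over pairs.\<close>

lemma chernoff_union:
  fixes f :: "'i \<Rightarrow> 'a \<Rightarrow> real"
  assumes M: "prob_space M" and I: "finite I"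
    and f: "\<And>x. x \<in> I \<Longrightarrow> f x \<in> borel_measurable M"
    and J: "\<And>x. x \<in> I \<Longrightarrow> J x \<subseteq> {..<N}" "\<And>x. x \<in> I \<Longrightarrow> card (J x) = n"
    and R: "\<And>x. x \<in> I \<Longrightarrow> (\<integral>\<^sup>+y. ennreal (exp (f x y)) \<partial>M) \<le> ennreal R" "0 \<le> R"
    and le: "card I * (R ^ n * exp (- t)) \<le> \<epsilon>"
  shows "holds_whp (sample N M) \<epsilon> (\<lambda>Z. \<forall>x\<in>I. (\<Sum>i\<in>J x. f x (Z i)) < t)"
proof -
  let ?B = "\<lambda>x. {Z \<in> space (sample N M). t \<le> (\<Sum>i\<in>J x. f x (Z i))}"
  have "measure (sample N M) (\<Union>x\<in>I. ?B x) \<le> card I * (R ^ n * exp (- t))"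
  proof (rule measure_union_bound[OF prob_space_sample[OF M] I, where B = ?B and b = "R ^ n * exp (- t)"])
    fix x assume x: "x \<in> I"
    show "?B x \<in> sets (sample N M)"
      using measurable_sample_sum[OF f[OF x] J(1)[OF x]] by measurable
    show "measure (sample N M) (?B x) \<le> R ^ n * exp (- t)"
      using chernoff_sample[OF M f[OF x] J(1)[OF x] R(1)[OF x] R(2), of t] J(2)[OF x] by simp
  qed
  moreover have "(\<Union>x\<in>I. ?B x) \<in> sets (sample N M)"
  proof (intro sets.finite_UN I)
    fix x assume x: "x \<in> I"
    show "?B x \<in> sets (sample N M)"
      using measurable_sample_sum[OF f[OF x] J(1)[OF x]] by measurable
  qed
  ultimately show ?thesis
    unfolding holds_whp_def using le by (intro bexI[of _ "\<Union>x\<in>I. ?B x"]) (auto simp: not_le)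
qed

text \<open>Markov is all that finite q-th moments of the noise allow; hence the polynomial
  dependence on 1 / \<epsilon> in the constants.\<close>

lemma markov_sample_sum:
  fixes a \<epsilon> :: real
  assumes M: "prob_space M" and f: "integrable M f" "\<And>x. 0 \<le> f x" and le: "(\<integral>x. f x \<partial>M) \<le> a"
    and \<epsilon>: "0 < \<epsilon>" and a: "0 < a" and N: "0 < N"
  shows "holds_whp (sample N M) \<epsilon> (\<lambda>Z. (\<Sum>i<N. f (Z i)) < N * a / \<epsilon>)"
proof -
  interpret M: prob_space M by fact
  interpret S: prob_space "sample N M" by (rule prob_space_sample[OF M])
  have meas: "f \<in> borel_measurable M" using f(1) by simp
  have comp: "(\<integral>\<^sup>+Z. ennreal (f (Z i)) \<partial>sample N M) \<le> ennreal a" if "i < N" for i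
  proof -
    have "(\<integral>\<^sup>+Z. (\<Prod>j\<in>{i}. ennreal (f (Z j))) \<partial>sample N M) = (\<integral>\<^sup>+x. ennreal (f x) \<partial>M) ^ card {i}"
      using that meas by (intro nn_integral_sample_prod[OF M]) auto
    then show ?thesis
      using f le by (simp add: nn_integral_eq_integral ennreal_leI)
  qed
  let ?u = "\<lambda>Z. \<Sum>i<N. ennreal (f (Z i))"
  let ?c = "ennreal (\<epsilon> / (N * a))"
  let ?B = "{Z \<in> space (sample N M). N * a / \<epsilon> \<le> (\<Sum>i<N. f (Z i))}"
  have u: "?u Z = ennreal (\<Sum>i<N. f (Z i))" for Z using f(2) by (simp add: sum_ennreal)
  have "(\<integral>\<^sup>+Z. ?u Z \<partial>sample N M) = (\<Sum>i<N. \<integral>\<^sup>+Z. ennreal (f (Z i)) \<partial>sample N M)"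
    using meas by (intro nn_integral_sum) auto
  also have "\<dots> \<le> (\<Sum>i<N. ennreal a)" using comp by (intro sum_mono) auto
  also have "\<dots> = ennreal (\<Sum>i<N. a)" using a by (intro sum_ennreal) auto
  also have "(\<Sum>i<N. a) = N * a" by simp
  finally have Eu: "(\<integral>\<^sup>+Z. ?u Z \<partial>sample N M) \<le> ennreal (N * a)" .
  have "emeasure (sample N M) {Z \<in> space (sample N M). 1 \<le> ?c * ?u Z}
      \<le> ?c * (\<integral>\<^sup>+Z. ?u Z * indicator (space (sample N M)) Z \<partial>sample N M)"
    using meas by (intro nn_integral_Markov_inequality) auto
  also have "(\<integral>\<^sup>+Z. ?u Z * indicator (space (sample N M)) Z \<partial>sample N M) = (\<integral>\<^sup>+Z. ?u Z \<partial>sample N M)"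
    by (intro nn_integral_cong) simp
  also have "?c * \<dots> \<le> ?c * ennreal (N * a)" by (intro mult_left_mono Eu) simp
  also have "\<dots> = ennreal \<epsilon>" using a \<epsilon> N by (simp add: ennreal_mult[symmetric])
  also have "{Z \<in> space (sample N M). 1 \<le> ?c * ?u Z} = ?B"
  proof -
    have "?c * ?u Z = ennreal (\<epsilon> / (N * a) * (\<Sum>i<N. f (Z i)))" for Z
      unfolding u using a \<epsilon> f(2) by (intro ennreal_mult[symmetric]) (auto intro: sum_nonneg)
    moreover have "1 \<le> \<epsilon> / (N * a) * y \<longleftrightarrow> N * a / \<epsilon> \<le> y" for y
      using a \<epsilon> N by (simp add: field_simps)
    ultimately show ?thesis by (simp only: ennreal_ge_1)
  qed
  finally have "measure (sample N M) ?B \<le> \<epsilon>"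
    using \<epsilon> by (simp add: S.emeasure_eq_measure)
  moreover have "?B \<in> sets (sample N M)"
    using measurable_sample_sum[OF meas, of "{..<N}" N] by measurable
  ultimately show ?thesis
    unfolding holds_whp_def by (intro bexI[of _ ?B]) (auto simp: not_le)
qed

section \<open>Exponential moments\<close>

lemma power_self_le_exp_fact: "real k ^ k \<le> exp 1 ^ k * fact k"
proof -
  have "real k ^ k /\<^sub>R fact k \<le> (\<Sum>n. real k ^ n /\<^sub>R fact n)"
    using sum_le_suminf[OF summable_exp_generic[of "real k"], of "{k}"] by simp
  also have "\<dots> = exp (real k)" by (simp add: exp_def)
  also have "\<dots> = exp 1 ^ k" using exp_of_nat_mult[of k "1::real"] by simp
  finally have "real k ^ k / fact k \<le> exp 1 ^ k" by (simp only: real_scaleR_def divide_inverse mult.commute)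
  then show ?thesis by (simp add: pos_divide_le_eq)
qed

text \<open>The growth (a k)^k of the even moments is the subgaussian rate: against k! it leaves (a
  e)^k, so the exponential series is dominated by a geometric one with ratio 1 / 2 and sum
  2.\<close>

lemma exp_square_moment:
  fixes f :: "'a \<Rightarrow> real"
  assumes M: "prob_space M" and f: "f \<in> borel_measurable M"
    and int: "\<And>k. 1 \<le> k \<Longrightarrow> integrable M (\<lambda>x. f x ^ (2 * k))"
    and le: "\<And>k. 1 \<le> k \<Longrightarrow> (\<integral>x. f x ^ (2 * k) \<partial>M) \<le> (a * k) ^ k"
    and c: "0 \<le> c" "0 \<le> a" "c * a * exp 1 \<le> 1 / 2"
  shows "(\<integral>\<^sup>+x. ennreal (exp (c * (f x)\<^sup>2)) \<partial>M) \<le> ennreal 2"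
proof -
  interpret prob_space M by fact
  define h where "h k x = (c * (f x)\<^sup>2) ^ k / fact k" for k x
  have h0: "0 \<le> h k x" for k x using c by (simp add: h_def)
  have exp_h: "ennreal (exp (c * (f x)\<^sup>2)) = (\<Sum>k. ennreal (h k x))" for x
  proof -
    have sum_h: "summable (\<lambda>k. h k x)"
      using summable_exp_generic[of "c * (f x)\<^sup>2"] by (simp only: h_def real_scaleR_def divide_inverse mult.commute)
    have "(\<Sum>k. h k x) = exp (c * (f x)\<^sup>2)"
      by (simp only: h_def exp_def real_scaleR_def divide_inverse mult.commute)
    moreover have "(\<Sum>k. ennreal (h k x)) = ennreal (\<Sum>k. h k x)"
      by (rule suminf_ennreal2[OF h0 sum_h])
    ultimately show ?thesis by (simp only:)
  qed
  have summand_le: "(\<integral>\<^sup>+x. ennreal (h k x) \<partial>M) \<le> ennreal ((1 / 2) ^ k)" for k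
  proof (cases "k = 0")
    case True
    then show ?thesis by (simp add: h_def emeasure_space_1)
  next
    case False
    then have k: "1 \<le> k" by simp
    have hk: "h k x = c ^ k / fact k * f x ^ (2 * k)" for x
      by (simp add: h_def power_mult_distrib power_mult)
    have "(\<integral>\<^sup>+x. ennreal (h k x) \<partial>M) = ennreal (\<integral>x. h k x \<partial>M)"
    proof (rule nn_integral_eq_integral)
      show "integrable M (h k)" unfolding hk[abs_def] using int[OF k] by simp
    qed (simp add: h0)
    also have "(\<integral>x. h k x \<partial>M) = c ^ k / fact k * (\<integral>x. f x ^ (2 * k) \<partial>M)"
      by (simp add: hk)
    also have "\<dots> \<le> c ^ k / fact k * (a * k) ^ k"
      using le[OF k] c by (intro mult_left_mono) auto
    also have "\<dots> = (c * a) ^ k * (real k ^ k / fact k)"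
      by (simp add: power_mult_distrib)
    also have "\<dots> \<le> (c * a) ^ k * exp 1 ^ k"
      using power_self_le_exp_fact[of k] c by (intro mult_left_mono) (auto simp: field_simps)
    also have "\<dots> \<le> (1 / 2) ^ k"
      using c by (simp only: power_mult_distrib[symmetric]) (intro power_mono, auto)
    finally show ?thesis by (simp add: ennreal_leI)
  qed
  have "(\<integral>\<^sup>+x. ennreal (exp (c * (f x)\<^sup>2)) \<partial>M) = (\<Sum>k. \<integral>\<^sup>+x. ennreal (h k x) \<partial>M)"
    unfolding exp_h using f by (intro nn_integral_suminf) (auto simp: h_def)
  also have "\<dots> \<le> (\<Sum>k. ennreal ((1 / 2) ^ k))"
    by (intro suminf_le summand_le) auto
  also have "\<dots> = ennreal 2"
    by (subst suminf_ennreal2) (auto simp: suminf_geometric)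
  finally show ?thesis .
qed

text \<open>Valid for arbitrarily negative x, which is what the one-sided lower tail of an unbounded
  square requires.\<close>

lemma exp_le_quadratic:
  assumes "(x::real) \<le> 1"
  shows "exp x \<le> 1 + x + x\<^sup>2"
proof (cases "0 \<le> x")
  case True
  then show ?thesis using exp_bound assms by simp
next
  case False
  define y where "y = - x"
  have y: "0 < y" using False by (simp add: y_def)
  have "exp x = 1 / exp y" by (simp add: y_def exp_minus field_simps)
  also have "\<dots> \<le> 1 / (1 + y)"
    using exp_ge_add_one_self[of y] y by (intro divide_left_mono) auto
  also have "\<dots> \<le> 1 - y + y\<^sup>2"
  proof -
    have "1 \<le> 1 + y ^ 3" using y by simp
    also have "\<dots> = (1 - y + y\<^sup>2) * (1 + y)" by (simp add: power2_eq_square power3_eq_cube algebra_simps)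
    finally show ?thesis using y by (simp add: pos_divide_le_eq)
  qed
  finally show ?thesis by (simp add: y_def)
qed

text \<open>The centred variable is at most 2 b, so \<open>2 * b * l \<le> 1\<close> keeps the
  exponent within the range of \<open>exp_le_quadratic\<close>; the linear term then integrates to
  0.\<close>

lemma bernstein_mgf:
  fixes W :: "'a \<Rightarrow> real"
  assumes M: "prob_space M" and W: "W \<in> borel_measurable M" and b: "\<And>x. \<bar>W x\<bar> \<le> b"
    and v: "(\<integral>x. (W x)\<^sup>2 \<partial>M) \<le> v" and l: "0 \<le> l" "2 * b * l \<le> 1"
  shows "(\<integral>\<^sup>+x. ennreal (exp (l * (W x - (\<integral>y. W y \<partial>M)))) \<partial>M) \<le> ennreal (exp (l\<^sup>2 * v))"
proof -
  interpret prob_space M by fact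
  define w where "w = (\<integral>y. W y \<partial>M)"
  define D where "D x = l * (W x - w)" for x
  have iW: "integrable M W" using W b by (intro integrable_const_bound[of _ b]) auto
  have b0: "0 \<le> b" using b by (meson abs_ge_zero order_trans not_empty)
  have iW2: "integrable M (\<lambda>x. (W x)\<^sup>2)"
    using W b b0 by (intro integrable_const_bound[of _ "b\<^sup>2"]) (auto intro!: power2_le_iff_abs_le[THEN iffD2])
  have w: "\<bar>w\<bar> \<le> b"
  proof -
    have "(\<integral>x. \<bar>W x\<bar> \<partial>M) \<le> b"
      using iW integral_mono[of M "\<lambda>x. \<bar>W x\<bar>" "\<lambda>_. b"] b by (simp add: prob_space)
    then show ?thesis unfolding w_def using integral_abs_bound[of M W] by linarith
  qed
  have D1: "D x \<le> 1" for x
  proof -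
    have "D x \<le> l * (2 * b)" unfolding D_def using b[of x] w l by (intro mult_left_mono) auto
    then show ?thesis using l by (simp add: mult_ac)
  qed
  have iD: "integrable M D" unfolding D_def using iW by simp
  have iD2: "integrable M (\<lambda>x. (D x)\<^sup>2)"
    unfolding D_def power_mult_distrib power2_diff using iW iW2 by simp
  have "(\<integral>\<^sup>+x. ennreal (exp (D x)) \<partial>M) \<le> (\<integral>\<^sup>+x. ennreal (1 + D x + (D x)\<^sup>2) \<partial>M)"
    by (intro nn_integral_mono ennreal_leI exp_le_quadratic D1)
  also have "\<dots> = ennreal (\<integral>x. 1 + D x + (D x)\<^sup>2 \<partial>M)"
  proof (intro nn_integral_eq_integral AE_I2)
    fix x
    show "0 \<le> 1 + D x + (D x)\<^sup>2" using exp_le_quadratic[OF D1[of x]] exp_gt_zero[of "D x"] by linarith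
  qed (use iD iD2 in simp)
  also have "(\<integral>x. 1 + D x + (D x)\<^sup>2 \<partial>M) = 1 + (\<integral>x. D x \<partial>M) + (\<integral>x. (D x)\<^sup>2 \<partial>M)"
    using iD iD2 by (simp add: prob_space)
  also have "(\<integral>x. D x \<partial>M) = 0"
    unfolding D_def using iW by (simp add: w_def prob_space)
  also have "(\<integral>x. (D x)\<^sup>2 \<partial>M) \<le> l\<^sup>2 * v"
  proof -
    have "(\<integral>x. (D x)\<^sup>2 \<partial>M) = (\<integral>x. l\<^sup>2 * ((W x)\<^sup>2 + w\<^sup>2 - 2 * w * W x) \<partial>M)"
      by (intro Bochner_Integration.integral_cong refl) (simp add: D_def power_mult_distrib power2_diff mult_ac)
    also have "\<dots> = l\<^sup>2 * ((\<integral>x. (W x)\<^sup>2 \<partial>M) - w\<^sup>2)"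
      using iW iW2 by (simp add: prob_space w_def[symmetric] power2_eq_square)
    also have "\<dots> \<le> l\<^sup>2 * v"
    proof (intro mult_left_mono)
      show "(\<integral>x. (W x)\<^sup>2 \<partial>M) - w\<^sup>2 \<le> v" using v zero_le_power2[of w] by linarith
    qed simp
    finally show ?thesis .
  qed
  finally have "(\<integral>\<^sup>+x. ennreal (exp (D x)) \<partial>M) \<le> ennreal (1 + l\<^sup>2 * v)"
    by (simp add: ennreal_leI)
  also have "\<dots> \<le> ennreal (exp (l\<^sup>2 * v))" using exp_ge_add_one_self[of "l\<^sup>2 * v"] by (simp add: ennreal_leI)
  finally show ?thesis by (simp add: D_def w_def)
qed

text \<open>A negative multiple of a square never exceeds 1, so a fourth moment suffices for the
  lower tail, with no boundedness.\<close>

lemma lower_tail_mgf: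
  fixes f :: "'a \<Rightarrow> real"
  assumes M: "prob_space M" and f: "f \<in> borel_measurable M"
    and i2: "integrable M (\<lambda>x. (f x)\<^sup>2)" and i4: "integrable M (\<lambda>x. (f x) ^ 4)"
    and e2: "(\<integral>x. (f x)\<^sup>2 \<partial>M) = \<beta>" and e4: "(\<integral>x. (f x) ^ 4 \<partial>M) \<le> K * \<beta>\<^sup>2" and l: "0 \<le> l"
  shows "(\<integral>\<^sup>+x. ennreal (exp (- l * (f x)\<^sup>2)) \<partial>M) \<le> ennreal (exp (- l * \<beta> + l\<^sup>2 * (K * \<beta>\<^sup>2)))"
proof -
  interpret prob_space M by fact
  let ?D = "\<lambda>x. - l * (f x)\<^sup>2"
  have D1: "?D x \<le> 1" for x using l by (simp add: mult_nonneg_nonneg order_trans[of _ 0])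
  have sq: "(?D x)\<^sup>2 = l\<^sup>2 * f x ^ 4" for x by (simp add: power_mult_distrib power_mult[symmetric])
  have "(\<integral>\<^sup>+x. ennreal (exp (?D x)) \<partial>M) \<le> (\<integral>\<^sup>+x. ennreal (1 + ?D x + l\<^sup>2 * f x ^ 4) \<partial>M)"
    using exp_le_quadratic[OF D1] unfolding sq by (intro nn_integral_mono ennreal_leI) auto
  also have "\<dots> = ennreal (\<integral>x. 1 + ?D x + l\<^sup>2 * f x ^ 4 \<partial>M)"
  proof (intro nn_integral_eq_integral AE_I2)
    fix x
    show "0 \<le> 1 + ?D x + l\<^sup>2 * f x ^ 4"
      using exp_le_quadratic[OF D1[of x]] exp_gt_zero[of "?D x"] unfolding sq by linarith
  qed (use i2 i4 in simp)
  also have "(\<integral>x. 1 + ?D x + l\<^sup>2 * f x ^ 4 \<partial>M) = 1 - l * \<beta> + l\<^sup>2 * (\<integral>x. f x ^ 4 \<partial>M)"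
    using i2 i4 by (simp add: prob_space e2)
  also have "\<dots> \<le> 1 + (- l * \<beta> + l\<^sup>2 * (K * \<beta>\<^sup>2))"
    using mult_left_mono[OF e4, of "l\<^sup>2"] by simp
  also have "\<dots> \<le> exp (- l * \<beta> + l\<^sup>2 * (K * \<beta>\<^sup>2))" by (rule exp_ge_add_one_self)
  finally show ?thesis by (simp add: ennreal_leI)
qed


section \<open>Uniform bounds over finite families\<close>

lemma binomial_le_exp:
  assumes "0 < d" "d \<le> N"
  shows "real (N choose d) \<le> exp (d * (1 + ln (N / d)))"
proof -
  have "real (N choose d) * fact d \<le> real N ^ d"
    using binomial_fact_pow[of N d] by (metis of_nat_fact of_nat_le_iff of_nat_mult of_nat_power)
  moreover have "real (N choose d) * real d ^ d \<le> real (N choose d) * (exp 1 ^ d * fact d)"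
    by (intro mult_left_mono power_self_le_exp_fact) simp
  ultimately have "real (N choose d) * real d ^ d \<le> exp 1 ^ d * real N ^ d"
    by (smt (verit) exp_gt_zero mult.left_commute mult_left_mono zero_less_power)
  then have "real (N choose d) \<le> exp 1 ^ d * real N ^ d / real d ^ d"
    using assms by (simp add: pos_le_divide_eq)
  also have "\<dots> = (exp 1 * (N / d)) ^ d"
    by (simp add: power_mult_distrib power_divide)
  also have "exp 1 * (N / d) = exp (1 + ln (N / d))"
    using assms by (simp add: exp_add)
  finally show ?thesis by (simp add: exp_of_nat_mult)
qed

lemma power_eq_exp_ln: "0 < (A::real) \<Longrightarrow> A ^ n = exp (n * ln A)"
  by (simp add: exp_of_nat_mult)

text \<open>The d-element set is made part of the index. The logarithm of the number of such sets,
  at most d (1 + ln (N / d)), is the price and reappears as the last factor of the bound.\<close>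

lemma top_sums_whp:
  fixes f :: "'i \<Rightarrow> 'a \<Rightarrow> real"
  assumes M: "prob_space M" and I: "finite I" "real (card I) \<le> A ^ d" and A: "1 \<le> A"
    and d: "1 \<le> d" "d \<le> N" and c: "0 < c" and \<epsilon>: "0 < \<epsilon>" "\<epsilon> \<le> 1"
    and f: "\<And>x. x \<in> I \<Longrightarrow> f x \<in> borel_measurable M"
    and mgf: "\<And>x. x \<in> I \<Longrightarrow> (\<integral>\<^sup>+y. ennreal (exp (c * (f x y)\<^sup>2)) \<partial>M) \<le> ennreal 2"
  shows "holds_whp (sample N M) \<epsilon> (\<lambda>Z. \<forall>x\<in>I. \<forall>J. J \<subseteq> {..<N} \<longrightarrow> card J = d \<longrightarrow>
    (\<Sum>i\<in>J. (f x (Z i))\<^sup>2) \<le> d * ((ln A + ln 2 + 1 + ln (1 / \<epsilon>)) / c) * (1 + ln (N / d)))"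
  (is "holds_whp _ _ ?Q")
proof -
  define r where "r = ln (1 / \<epsilon>)"
  define l where "l = ln (N / d)"
  define \<kappa> where "\<kappa> = ln A + ln 2 + 1 + r"
  define t where "t = d * \<kappa> * (1 + l)"
  have r: "0 \<le> r" using \<epsilon> by (simp add: r_def)
  have l: "0 \<le> l" using d by (simp add: l_def)
  have lnA: "0 \<le> ln A" using A by simp
  let ?JJ = "{J. J \<subseteq> {..<N} \<and> card J = d}"
  let ?I = "I \<times> ?JJ"
  have fin: "finite ?JJ" by (rule finite_subset[of _ "Pow {..<N}"]) auto
  have cardJ: "card ?JJ = N choose d" using n_subsets[of "{..<N}" d] by simp
  have "card ?I * (2 ^ d * exp (- t)) \<le> (exp (d * ln A) * exp (d * (1 + l))) * (exp (d * ln 2) * exp (- t))"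
  proof (intro mult_mono)
    show "real (card ?I) \<le> exp (d * ln A) * exp (d * (1 + l))"
      unfolding card_cartesian_product of_nat_mult cardJ l_def
      using I(2) A d by (intro mult_mono binomial_le_exp) (auto simp: power_eq_exp_ln)
  qed (auto simp: power_eq_exp_ln)
  also have "\<dots> = exp (d * (ln A + ln 2 + (1 + l)) - t)"
    by (simp add: exp_add[symmetric] algebra_simps)
  also have "\<dots> \<le> exp (- r)"
  proof -
    \<comment> \<open>All summands of \<kappa> are nonnegative, so its product with 1 + l dominates
      the sum; this separates the constant from the logarithm.\<close>
    have "ln A + ln 2 + (1 + l) + r \<le> \<kappa> * (1 + l)"
      using mult_nonneg_nonneg[OF lnA l] mult_nonneg_nonneg[OF r l] l
        mult_nonneg_nonneg[of "ln 2" l] by (simp add: \<kappa>_def algebra_simps)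
    then have "d * (ln A + ln 2 + (1 + l) + r) \<le> t"
      unfolding t_def mult.assoc by (intro mult_left_mono) auto
    moreover have "1 * r \<le> d * r" using d r by (intro mult_right_mono) auto
    ultimately show ?thesis by (simp add: algebra_simps)
  qed
  also have "exp (- r) = \<epsilon>" using \<epsilon> by (simp add: r_def ln_div)
  finally have small: "real (card ?I) * (2 ^ d * exp (- t)) \<le> \<epsilon>" .
  have "holds_whp (sample N M) \<epsilon> (\<lambda>Z. \<forall>p\<in>?I. (\<Sum>i\<in>snd p. c * (f (fst p) (Z i))\<^sup>2) < t)"
    by (rule chernoff_union[OF M, where n = d and R = 2 and f = "\<lambda>p y. c * (f (fst p) y)\<^sup>2"])
      (use I(1) fin f mgf small in auto)
  then show ?thesis
  proof (rule holds_whp_mono)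
    fix Z assume Z: "\<forall>p\<in>?I. (\<Sum>i\<in>snd p. c * (f (fst p) (Z i))\<^sup>2) < t"
    show "?Q Z"
    proof (intro ballI allI impI)
      fix x J assume "x \<in> I" "J \<subseteq> {..<N}" "card J = d"
      then have "c * (\<Sum>i\<in>J. (f x (Z i))\<^sup>2) < t"
        using bspec[OF Z, of "(x, J)"] by (simp add: sum_distrib_left)
      then show "(\<Sum>i\<in>J. (f x (Z i))\<^sup>2) \<le> d * ((ln A + ln 2 + 1 + ln (1 / \<epsilon>)) / c) * (1 + ln (N / d))"
        using c by (simp add: t_def \<kappa>_def r_def l_def field_simps)
    qed
  qed simp
qed

text \<open>For all N terms together the entropy d ln A is absorbed because d \<le> N, so no
  logarithm of N / d is lost.\<close>

lemma square_sums_whp: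
  fixes f :: "'i \<Rightarrow> 'a \<Rightarrow> real"
  assumes M: "prob_space M" and I: "finite I" "real (card I) \<le> A ^ d" and A: "1 \<le> A"
    and d: "1 \<le> d" "d \<le> N" and c: "0 < c" and \<epsilon>: "0 < \<epsilon>" "\<epsilon> \<le> 1"
    and f: "\<And>x. x \<in> I \<Longrightarrow> f x \<in> borel_measurable M"
    and mgf: "\<And>x. x \<in> I \<Longrightarrow> (\<integral>\<^sup>+y. ennreal (exp (c * (f x y)\<^sup>2)) \<partial>M) \<le> ennreal 2"
  shows "holds_whp (sample N M) \<epsilon> (\<lambda>Z. \<forall>x\<in>I.
    (\<Sum>i<N. (f x (Z i))\<^sup>2) \<le> N * ((ln A + ln 2 + ln (1 / \<epsilon>)) / c))"
  (is "holds_whp _ _ ?Q")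
proof -
  define r where "r = ln (1 / \<epsilon>)"
  define t where "t = N * (ln A + ln 2 + r)"
  have r: "0 \<le> r" using \<epsilon> by (simp add: r_def)
  have lnA: "0 \<le> ln A" using A by simp
  have "card I * (2 ^ N * exp (- t)) \<le> exp (d * ln A) * (exp (N * ln 2) * exp (- t))"
    using I(2) A by (intro mult_mono) (auto simp: power_eq_exp_ln)
  also have "\<dots> = exp (d * ln A + N * ln 2 - t)"
    by (simp add: exp_add[symmetric] algebra_simps)
  also have "\<dots> \<le> exp (- r)"
  proof -
    have "d * ln A \<le> N * ln A" using d lnA by (intro mult_right_mono) auto
    moreover have "1 * r \<le> N * r" using d r by (intro mult_right_mono) auto
    ultimately show ?thesis by (simp add: t_def algebra_simps)
  qed
  also have "exp (- r) = \<epsilon>" using \<epsilon> by (simp add: r_def ln_div)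
  finally have small: "real (card I) * (2 ^ N * exp (- t)) \<le> \<epsilon>" .
  have "holds_whp (sample N M) \<epsilon> (\<lambda>Z. \<forall>x\<in>I. (\<Sum>i\<in>{..<N}. c * (f x (Z i))\<^sup>2) < t)"
    by (rule chernoff_union[OF M, where n = N and R = 2 and f = "\<lambda>x y. c * (f x y)\<^sup>2"])
      (use I(1) f mgf small in auto)
  then show ?thesis
  proof (rule holds_whp_mono)
    fix Z assume Z: "\<forall>x\<in>I. (\<Sum>i\<in>{..<N}. c * (f x (Z i))\<^sup>2) < t"
    show "?Q Z"
    proof
      fix x assume "x \<in> I"
      then have "c * (\<Sum>i<N. (f x (Z i))\<^sup>2) < t"
        using bspec[OF Z, of x] by (simp add: sum_distrib_left)
      then show "(\<Sum>i<N. (f x (Z i))\<^sup>2) \<le> N * ((ln A + ln 2 + ln (1 / \<epsilon>)) / c)"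
        using c by (simp add: t_def r_def field_simps)
    qed
  qed simp
qed

lemma square_sums_lower_whp:
  fixes f :: "'i \<Rightarrow> 'a \<Rightarrow> real"
  assumes M: "prob_space M" and I: "finite I" "real (card I) \<le> exp a" and K: "0 < K"
    and \<epsilon>: "0 < \<epsilon>" and N: "16 * K * (a + ln (1 / \<epsilon>)) \<le> N"
    and f: "\<And>x. x \<in> I \<Longrightarrow> f x \<in> borel_measurable M"
    and i2: "\<And>x. x \<in> I \<Longrightarrow> integrable M (\<lambda>y. (f x y)\<^sup>2)"
    and i4: "\<And>x. x \<in> I \<Longrightarrow> integrable M (\<lambda>y. (f x y) ^ 4)"
    and e2: "\<And>x. x \<in> I \<Longrightarrow> (\<integral>y. (f x y)\<^sup>2 \<partial>M) = \<beta> x"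
    and e4: "\<And>x. x \<in> I \<Longrightarrow> (\<integral>y. (f x y) ^ 4 \<partial>M) \<le> K * (\<beta> x)\<^sup>2"
  shows "holds_whp (sample N M) \<epsilon> (\<lambda>Z. \<forall>x\<in>I. N * \<beta> x / 2 \<le> (\<Sum>i<N. (f x (Z i))\<^sup>2))"
  (is "holds_whp _ _ ?Q")
proof -
  \<comment> \<open>The tilt \<open>l x\<close> below is the minimiser of the exponent. It gives R ^
    N = exp (- 3 N / (16 K)) against exp (- t) = exp (2 N / (16 K)), which leaves exp (- N / (16 K))
    to pay for the union bound. Indices without positive \<beta> satisfy the claim trivially and
    would spoil the division.\<close>
  define t where "t = - (N / (8 * K))"
  define R where "R = exp (- (3 / (16 * K)))"
  define I' where "I' = {x \<in> I. 0 < \<beta> x}"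
  define l where "l x = 1 / (4 * K * \<beta> x)" for x
  have I': "finite I'" "card I' \<le> card I" "I' \<subseteq> I"
    using I(1) by (auto simp: I'_def intro: card_mono)
  have "R ^ N * exp (- t) = exp (- (N / (16 * K)))"
    using K by (simp add: R_def t_def exp_of_nat_mult[symmetric] exp_add[symmetric] field_simps)
  then have "card I' * (R ^ N * exp (- t)) \<le> exp a * exp (- (N / (16 * K)))"
    using I(2) I'(2) by (simp add: mult_right_mono)
  also have "exp a * exp (- (N / (16 * K))) = exp (a - N / (16 * K))"
    by (simp add: exp_add[symmetric])
  also have "\<dots> \<le> exp (- ln (1 / \<epsilon>))"
    using N K by (simp add: field_simps)
  also have "\<dots> = \<epsilon>" using \<epsilon> by (simp add: ln_div)
  finally have small: "real (card I') * (R ^ N * exp (- t)) \<le> \<epsilon>" .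
  have mgf: "(\<integral>\<^sup>+y. ennreal (exp (- l x * (f x y)\<^sup>2)) \<partial>M) \<le> ennreal R" if x: "x \<in> I'" for x
  proof -
    have xI: "x \<in> I" and b: "0 < \<beta> x" using x by (auto simp: I'_def)
    have "(\<integral>\<^sup>+y. ennreal (exp (- l x * (f x y)\<^sup>2)) \<partial>M)
        \<le> ennreal (exp (- l x * \<beta> x + (l x)\<^sup>2 * (K * (\<beta> x)\<^sup>2)))"
      using K b by (intro lower_tail_mgf[OF M f i2 i4 e2 e4] xI) (auto simp: l_def)
    also have "- l x * \<beta> x + (l x)\<^sup>2 * (K * (\<beta> x)\<^sup>2) = - (3 / (16 * K))"
      using K b by (simp add: l_def power2_eq_square field_simps)
    finally show ?thesis by (simp add: R_def)
  qed
  have "holds_whp (sample N M) \<epsilon> (\<lambda>Z. \<forall>x\<in>I'. (\<Sum>i\<in>{..<N}. - l x * (f x (Z i))\<^sup>2) < t)"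
  proof (rule chernoff_union[OF M I'(1), where n = N and R = R and f = "\<lambda>x y. - l x * (f x y)\<^sup>2"])
    fix x assume x: "x \<in> I'"
    then have "f x \<in> borel_measurable M" using f I'(3) by auto
    then show "(\<lambda>y. - l x * (f x y)\<^sup>2) \<in> borel_measurable M" by measurable
  qed (use mgf small in \<open>auto simp: R_def\<close>)
  then show ?thesis
  proof (rule holds_whp_mono)
    fix Z assume Z: "\<forall>x\<in>I'. (\<Sum>i\<in>{..<N}. - l x * (f x (Z i))\<^sup>2) < t"
    show "?Q Z"
    proof
      fix x assume xI: "x \<in> I"
      show "N * \<beta> x / 2 \<le> (\<Sum>i<N. (f x (Z i))\<^sup>2)"
      proof (cases "0 < \<beta> x")
        case True
        then have "(\<Sum>i<N. - l x * (f x (Z i))\<^sup>2) < t" using Z xI by (auto simp: I'_def)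
        then have "l x * (\<Sum>i<N. (f x (Z i))\<^sup>2) > N / (8 * K)"
          by (simp only: sum_distrib_left[symmetric]) (simp add: t_def)
        then show ?thesis using True K by (simp add: l_def field_simps)
      next
        case False
        then have "N * \<beta> x / 2 \<le> 0" by (simp add: mult_nonneg_nonpos)
        also have "0 \<le> (\<Sum>i<N. (f x (Z i))\<^sup>2)" by (simp add: sum_nonneg)
        finally show ?thesis .
      qed
    qed
  qed simp
qed

text \<open>The three summands are the cost of the union bound under the tilt 1 / (2 b), the
  variance term, and the bias caused by truncation.\<close>

lemma truncated_sums_whp:
  fixes Y :: "'i \<Rightarrow> 'a \<Rightarrow> real"
  assumes M: "prob_space M" and I: "finite I" "real (card I) \<le> A ^ d" and A: "1 \<le> A"
    and d: "1 \<le> d" "d \<le> N" and b: "0 < b" and \<epsilon>: "0 < \<epsilon>" "\<epsilon> \<le> 1"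
    and Y: "\<And>x. x \<in> I \<Longrightarrow> Y x \<in> borel_measurable M"
    and i1: "\<And>x. x \<in> I \<Longrightarrow> integrable M (Y x)" and e1: "\<And>x. x \<in> I \<Longrightarrow> (\<integral>y. Y x y \<partial>M) = 0"
    and i2: "\<And>x. x \<in> I \<Longrightarrow> integrable M (\<lambda>y. (Y x y)\<^sup>2)"
    and e2: "\<And>x. x \<in> I \<Longrightarrow> (\<integral>y. (Y x y)\<^sup>2 \<partial>M) \<le> v"
  shows "holds_whp (sample N M) \<epsilon> (\<lambda>Z. \<forall>x\<in>I.
    \<bar>\<Sum>i<N. if \<bar>Y x (Z i)\<bar> \<le> b then Y x (Z i) else 0\<bar>
      \<le> 2 * b * d * (ln A + ln 2 + ln (1 / \<epsilon>)) + N * v / (2 * b) + N * v / b)"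
  (is "holds_whp _ _ ?Q")
proof -
  interpret prob_space M by fact
  define W where "W x y = (if \<bar>Y x y\<bar> \<le> b then Y x y else 0)" for x y
  define r where "r = ln (1 / \<epsilon>)"
  define l where "l = 1 / (2 * b)"
  define t where "t = d * (ln A + ln 2 + r) + N * (l\<^sup>2 * v)"
  have r: "0 \<le> r" using \<epsilon> by (simp add: r_def)
  have W: "W x \<in> borel_measurable M" if "x \<in> I" for x
    using Y[OF that] unfolding W_def by measurable
  have Wb: "\<bar>W x y\<bar> \<le> b" for x y using b by (simp add: W_def)
  have W2: "(\<integral>y. (W x y)\<^sup>2 \<partial>M) \<le> v" if x: "x \<in> I" for x
  proof -
    have "integrable M (\<lambda>y. (W x y)\<^sup>2)"
    proof (rule Bochner_Integration.integrable_bound[OF i2[OF x]])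
      show "(\<lambda>y. (W x y)\<^sup>2) \<in> borel_measurable M" using W[OF x] by measurable
    qed (auto simp: W_def)
    then have "(\<integral>y. (W x y)\<^sup>2 \<partial>M) \<le> (\<integral>y. (Y x y)\<^sup>2 \<partial>M)"
      using i2[OF x] by (intro integral_mono) (auto simp: W_def)
    then show ?thesis using e2[OF x] by simp
  qed
  have EW: "\<bar>\<integral>y. W x y \<partial>M\<bar> \<le> v / b" if x: "x \<in> I" for x
  proof -
    have iW: "integrable M (W x)"
      using W[OF x] by (intro Bochner_Integration.integrable_bound[OF i1[OF x]]) (auto simp: W_def)
    \<comment> \<open>Since \<open>Y x\<close> has mean zero, the mean of \<open>W x\<close> is, up
      to sign, that of the discarded part, where |Y| exceeds b and is therefore at most Y^2 /
      b.\<close>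
    have "(\<integral>y. W x y \<partial>M) = (\<integral>y. W x y - Y x y \<partial>M)"
      using iW i1[OF x] e1[OF x] by simp
    also have "\<bar>\<dots>\<bar> \<le> (\<integral>y. \<bar>W x y - Y x y\<bar> \<partial>M)" by (rule integral_abs_bound)
    also have "\<dots> \<le> (\<integral>y. (Y x y)\<^sup>2 / b \<partial>M)"
    proof (intro integral_mono)
      fix y
      show "\<bar>W x y - Y x y\<bar> \<le> (Y x y)\<^sup>2 / b"
      proof (cases "\<bar>Y x y\<bar> \<le> b")
        case False
        then have "\<bar>Y x y\<bar> * b \<le> \<bar>Y x y\<bar> * \<bar>Y x y\<bar>" by (intro mult_left_mono) auto
        then show ?thesis using False b by (simp add: W_def field_simps power2_eq_square)
      qed (use b in \<open>simp add: W_def\<close>)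
    qed (use iW i1[OF x] i2[OF x] in auto)
    also have "\<dots> \<le> v / b" using e2[OF x] b by (simp add: divide_right_mono)
    finally show ?thesis .
  qed
  \<comment> \<open>Both signs enter the index to get an absolute value from a one-sided bound; the
    doubling is paid by ln 2.\<close>
  let ?I = "I \<times> {1, -1 :: real}"
  let ?f = "\<lambda>p y. l * (snd p * W (fst p) y - (\<integral>y. snd p * W (fst p) y \<partial>M))"
  have "card ?I * (exp (l\<^sup>2 * v) ^ N * exp (- t))
      \<le> (exp (d * ln A) * exp (d * ln 2)) * (exp (l\<^sup>2 * v) ^ N * exp (- t))"
  proof (intro mult_right_mono)
    have "2 \<le> (2::real) ^ d" using d power_increasing[of 1 d "2::real"] by simp
    then show "real (card ?I) \<le> exp (d * ln A) * exp (d * ln 2)"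
      unfolding card_cartesian_product of_nat_mult
      using I(2) A by (intro mult_mono) (auto simp: power_eq_exp_ln[symmetric])
  qed auto
  also have "\<dots> = exp (d * ln A + d * ln 2 + N * (l\<^sup>2 * v) - t)"
    by (simp add: exp_of_nat_mult[symmetric] exp_add[symmetric])
  also have "\<dots> \<le> exp (- r)"
  proof -
    have "1 * r \<le> d * r" using d r by (intro mult_right_mono) auto
    then show ?thesis by (simp add: t_def algebra_simps)
  qed
  also have "exp (- r) = \<epsilon>" using \<epsilon> by (simp add: r_def ln_div)
  finally have small: "card ?I * (exp (l\<^sup>2 * v) ^ N * exp (- t)) \<le> \<epsilon>" .
  have "holds_whp (sample N M) \<epsilon> (\<lambda>Z. \<forall>p\<in>?I. (\<Sum>i\<in>{..<N}. ?f p (Z i)) < t)"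
  proof (rule chernoff_union[OF M, where n = N and R = "exp (l\<^sup>2 * v)" and f = ?f])
    fix p assume p: "p \<in> ?I"
    have m: "(\<lambda>y. snd p * W (fst p) y) \<in> borel_measurable M" using W p by auto
    then show "?f p \<in> borel_measurable M" by measurable
    have sq: "(snd p * W (fst p) y)\<^sup>2 = (W (fst p) y)\<^sup>2" for y using p by (auto simp: power_mult_distrib)
    show "(\<integral>\<^sup>+y. ennreal (exp (?f p y)) \<partial>M) \<le> ennreal (exp (l\<^sup>2 * v))"
    proof (rule bernstein_mgf[OF M m])
      show "\<bar>snd p * W (fst p) y\<bar> \<le> b" for y using p Wb by (auto simp: abs_mult)
      show "(\<integral>y. (snd p * W (fst p) y)\<^sup>2 \<partial>M) \<le> v" unfolding sq using W2 p by auto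
      show "0 \<le> l" "2 * b * l \<le> 1" using b by (auto simp: l_def)
    qed
  qed (use I(1) small in auto)
  then show ?thesis
  proof (rule holds_whp_mono)
    fix Z assume Z: "\<forall>p\<in>?I. (\<Sum>i\<in>{..<N}. ?f p (Z i)) < t"
    show "?Q Z"
    proof
      fix x assume x: "x \<in> I"
      define w where "w = (\<integral>y. W x y \<partial>M)"
      define S where "S = (\<Sum>i<N. W x (Z i))"
      have 1: "l * (S - N * w) < t"
        using bspec[OF Z, of "(x, 1)"] x
        by (simp add: S_def w_def sum_distrib_left[symmetric] sum_subtractf)
      have 2: "l * (- S + N * w) < t"
        using bspec[OF Z, of "(x, - 1)"] x
        by (simp add: S_def w_def sum_distrib_left[symmetric] sum_subtractf)
      have lpos: "0 < l" using b by (simp add: l_def)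
      have "l * \<bar>S - N * w\<bar> < t" using 1 2 lpos by (auto simp: abs_if)
      then have "\<bar>S - N * w\<bar> \<le> t / l" using lpos by (simp add: field_simps)
      also have "t / l = 2 * b * d * (ln A + ln 2 + r) + N * v / (2 * b)"
        using b by (simp add: t_def l_def field_simps power2_eq_square)
      finally have "\<bar>S - N * w\<bar> \<le> 2 * b * d * (ln A + ln 2 + r) + N * v / (2 * b)" .
      moreover have "\<bar>N * w\<bar> \<le> N * v / b"
        using mult_left_mono[OF EW[OF x], of "real N"] by (simp add: abs_mult w_def)
      ultimately have "\<bar>S\<bar> \<le> 2 * b * d * (ln A + ln 2 + r) + N * v / (2 * b) + N * v / b"
        by linarith
      then show "\<bar>\<Sum>i<N. if \<bar>Y x (Z i)\<bar> \<le> b then Y x (Z i) else 0\<bar>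
          \<le> 2 * b * d * (ln A + ln 2 + ln (1 / \<epsilon>)) + N * v / (2 * b) + N * v / b"
        by (simp add: S_def W_def r_def)
    qed
  qed simp
qed

section \<open>Largest products of noise and design\<close>

lemma one_plus_ln_le_powr:
  assumes "1 \<le> (x::real)" "0 < \<alpha>"
  shows "1 + ln x \<le> (1 + 1 / \<alpha>) * x powr \<alpha>"
proof -
  have "\<alpha> * ln x = ln (x powr \<alpha>)" using assms by (simp add: ln_powr)
  also have "\<dots> \<le> x powr \<alpha>" using assms ln_le_minus_one[of "x powr \<alpha>"] by simp
  finally have "ln x \<le> x powr \<alpha> / \<alpha>" using assms by (simp add: field_simps)
  moreover have "1 \<le> x powr \<alpha>" using assms by (simp add: ge_one_powr_ge_zero)
  ultimately show ?thesis by (simp add: algebra_simps)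
qed

text \<open>Splitting at the level \<tau> = (N / d) powr (1 / q) balances small and large noise: the
  q-th moment bounds the sum of squared noise by d (1 + E) (N / d) powr (2 / q). The logarithm in
  the other factor is at most a constant times the complementary power (N / d) powr (1 - 2 / q), so
  Cauchy-Schwarz ends at sqrt (N d) with no logarithm left.\<close>

lemma top_product_sum_le:
  fixes \<xi> f :: "'k \<Rightarrow> real"
  assumes q: "2 < q" and J: "card J = d" and d: "1 \<le> d" "d \<le> N" and E: "0 \<le> E" and C: "0 \<le> C"
    and \<xi>: "(\<Sum>i\<in>J. \<bar>\<xi> i\<bar> powr q) \<le> N * E"
    and f: "(\<Sum>i\<in>J. (f i)\<^sup>2) \<le> d * C * (1 + ln (N / d))"
  shows "(\<Sum>i\<in>J. \<bar>\<xi> i * f i\<bar>) \<le> sqrt ((1 + E) * C * (1 + 1 / (1 - 2 / q))) * sqrt (real N * d)"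
proof -
  define x where "x = real N / d"
  define \<alpha> where "\<alpha> = 1 - 2 / q"
  define \<tau> where "\<tau> = x powr (1 / q)"
  have x: "1 \<le> x" using d by (simp add: x_def)
  have \<alpha>: "0 < \<alpha>" using q by (simp add: \<alpha>_def)
  have \<tau>: "0 < \<tau>" using x by (simp add: \<tau>_def)
  have "(\<Sum>i\<in>J. (\<xi> i)\<^sup>2) \<le> (\<Sum>i\<in>J. \<tau>\<^sup>2 + \<tau> powr (2 - q) * \<bar>\<xi> i\<bar> powr q)"
  proof (rule sum_mono)
    fix i
    show "(\<xi> i)\<^sup>2 \<le> \<tau>\<^sup>2 + \<tau> powr (2 - q) * \<bar>\<xi> i\<bar> powr q"
    proof (cases "\<bar>\<xi> i\<bar> \<le> \<tau>")
      case True
      then have "\<bar>\<xi> i\<bar>\<^sup>2 \<le> \<tau>\<^sup>2" by (intro power_mono) auto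
      then show ?thesis by (simp add: add_increasing2)
    next
      case False
      then have pos: "0 < \<bar>\<xi> i\<bar>" using \<tau> by linarith
      have "(\<xi> i)\<^sup>2 = \<bar>\<xi> i\<bar> powr 2" using pos by simp
      also have "\<dots> = \<bar>\<xi> i\<bar> powr (2 - q) * \<bar>\<xi> i\<bar> powr q" by (simp add: powr_add[symmetric])
      also have "\<dots> \<le> \<tau> powr (2 - q) * \<bar>\<xi> i\<bar> powr q"
        using False q \<tau> by (intro mult_right_mono powr_mono2') auto
      finally show ?thesis by (simp add: add_increasing)
    qed
  qed
  also have "\<dots> = d * \<tau>\<^sup>2 + \<tau> powr (2 - q) * (\<Sum>i\<in>J. \<bar>\<xi> i\<bar> powr q)"
    by (simp add: sum.distrib sum_distrib_left J)
  also have "\<dots> \<le> d * \<tau>\<^sup>2 + \<tau> powr (2 - q) * (N * E)"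
    using \<xi> by (intro add_left_mono mult_left_mono) auto
  also have "\<tau> powr (2 - q) = \<tau>\<^sup>2 / x"
    using \<tau> x q by (simp add: powr_diff) (simp add: \<tau>_def powr_powr)
  also have "d * \<tau>\<^sup>2 + \<tau>\<^sup>2 / x * (N * E) = d * (1 + E) * \<tau>\<^sup>2"
    using d by (simp add: x_def field_simps)
  also have "\<tau>\<^sup>2 = x powr (2 / q)"
    using x by (simp add: \<tau>_def powr_power)
  finally have s1: "(\<Sum>i\<in>J. (\<xi> i)\<^sup>2) \<le> d * (1 + E) * x powr (2 / q)" .
  have "(\<Sum>i\<in>J. (f i)\<^sup>2) \<le> d * C * ((1 + 1 / \<alpha>) * x powr \<alpha>)"
    using f one_plus_ln_le_powr[OF x \<alpha>] C unfolding x_def[symmetric]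
    by (meson mult_left_mono mult_nonneg_nonneg of_nat_0_le_iff order_trans)
  then have "(\<Sum>i\<in>J. (\<xi> i)\<^sup>2) * (\<Sum>i\<in>J. (f i)\<^sup>2)
      \<le> (d * (1 + E) * x powr (2 / q)) * (d * C * ((1 + 1 / \<alpha>) * x powr \<alpha>))"
    using s1 E by (intro mult_mono) (auto intro: sum_nonneg)
  also have "\<dots> = ((1 + E) * C * (1 + 1 / \<alpha>)) * (d * d * (x powr (2 / q) * x powr \<alpha>))"
    by (simp add: mult_ac)
  also have "x powr (2 / q) * x powr \<alpha> = x" using x by (simp add: powr_add[symmetric] \<alpha>_def)
  also have "d * d * x = real N * d" using d by (simp add: x_def)
  finally have "sqrt ((\<Sum>i\<in>J. (\<xi> i)\<^sup>2) * (\<Sum>i\<in>J. (f i)\<^sup>2)) \<le> sqrt ((1 + E) * C * (1 + 1 / \<alpha>) * (real N * d))"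
    by (rule real_sqrt_le_mono)
  moreover have "(\<Sum>i\<in>J. \<bar>\<xi> i\<bar> * \<bar>f i\<bar>) \<le> sqrt (\<Sum>i\<in>J. \<bar>\<xi> i\<bar>\<^sup>2) * sqrt (\<Sum>i\<in>J. \<bar>f i\<bar>\<^sup>2)"
    by (rule sum_product_le_sqrt)
  ultimately show ?thesis by (simp add: abs_mult real_sqrt_mult \<alpha>_def)
qed

text \<open>If d terms exceeded b, their sum would be at least d b > S. So there are fewer than d of
  them, and they fit into a set of exactly d indices, to which \<open>top\<close> applies.\<close>

lemma sum_large_terms_le:
  fixes z :: "nat \<Rightarrow> real"
  assumes top: "\<And>J. J \<subseteq> {..<N} \<Longrightarrow> card J = d \<Longrightarrow> (\<Sum>i\<in>J. \<bar>z i\<bar>) \<le> S"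
    and S: "S < d * b" and d: "d \<le> N"
  shows "(\<Sum>i\<in>{i. i < N \<and> b < \<bar>z i\<bar>}. \<bar>z i\<bar>) \<le> S"
proof -
  let ?B = "{i. i < N \<and> b < \<bar>z i\<bar>}"
  have "card ?B < d"
  proof (rule ccontr)
    assume "\<not> card ?B < d"
    then obtain J where J: "J \<subseteq> ?B" "card J = d" "finite J"
      using obtain_subset_with_card_n[of d ?B] by auto
    have "d * b = (\<Sum>i\<in>J. b)" using J by simp
    also have "\<dots> \<le> (\<Sum>i\<in>J. \<bar>z i\<bar>)" using J(1) by (intro sum_mono) auto
    also have "\<dots> \<le> S" using J by (intro top) auto
    finally show False using S by simp
  qed
  then obtain J where J: "?B \<subseteq> J" "J \<subseteq> {..<N}" "card J = d"
    using exists_subset_between[of ?B d "{..<N}"] d by auto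
  have "(\<Sum>i\<in>?B. \<bar>z i\<bar>) \<le> (\<Sum>i\<in>J. \<bar>z i\<bar>)"
    using J finite_subset[OF J(2)] by (intro sum_mono2) auto
  also have "\<dots> \<le> S" by (intro top J)
  finally show ?thesis .
qed

section \<open>Multiplier process and design moments\<close>

definition tail_const :: "real \<Rightarrow> real \<Rightarrow> real \<Rightarrow> real" where
  "tail_const A c \<epsilon> = (ln A + ln 2 + 1 + ln (1 / \<epsilon>)) / c"

definition top_const :: "real \<Rightarrow> real \<Rightarrow> real \<Rightarrow> real \<Rightarrow> real" where
  "top_const q A c \<epsilon> = sqrt ((1 + 1 / \<epsilon>) * tail_const A c \<epsilon> * (1 + 1 / (1 - 2 / q)))"

text \<open>In this order: the large terms, the union bound, the variance and the truncation bias,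
  at truncation level 2 \<open>top_const q A c \<epsilon>\<close> sqrt (N / d) and in units of sqrt
  (N d).\<close>

definition multiplier_const :: "real \<Rightarrow> real \<Rightarrow> real \<Rightarrow> real \<Rightarrow> real \<Rightarrow> real" where
  "multiplier_const q A c \<epsilon> v = top_const q A c \<epsilon>
    + 4 * top_const q A c \<epsilon> * (ln A + ln 2 + ln (1 / \<epsilon>))
    + v / (4 * top_const q A c \<epsilon>) + v / (2 * top_const q A c \<epsilon>)"

lemma tail_const_pos: "1 \<le> A \<Longrightarrow> 0 < c \<Longrightarrow> 0 < \<epsilon> \<Longrightarrow> \<epsilon> \<le> 1 \<Longrightarrow> 0 < tail_const A c \<epsilon>"
  unfolding tail_const_def by (intro divide_pos_pos add_nonneg_pos add_pos_nonneg) (auto simp: add_nonneg_pos)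

lemma top_const_pos:
  assumes "2 < q" "1 \<le> A" "0 < c" "0 < \<epsilon>" "\<epsilon> \<le> 1"
  shows "0 < top_const q A c \<epsilon>"
proof -
  have "0 < 1 + 1 / \<epsilon>" "0 < 1 + 1 / (1 - 2 / q)" using assms by (auto simp: add_pos_pos)
  then show ?thesis unfolding top_const_def using tail_const_pos[OF assms(2-5)] by simp
qed

lemma multiplier_const_pos:
  assumes "2 < q" "1 \<le> A" "0 < c" "0 < \<epsilon>" "\<epsilon> \<le> 1" "0 \<le> v"
  shows "0 < multiplier_const q A c \<epsilon> v"
proof -
  have "0 \<le> ln A + ln 2 + ln (1 / \<epsilon>)" using assms by (simp add: add_nonneg_nonneg)
  then show ?thesis
    unfolding multiplier_const_def using top_const_pos[OF assms(1-5)] assms(6)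
    by (intro add_pos_nonneg mult_nonneg_nonneg divide_nonneg_nonneg) simp_all
qed

text \<open>The products \<open>\<xi> (f x)\<close> are truncated at level \<open>2 B \<surd>(N / d)\<close>. The truncated sums obey
  Bernstein's inequality, and fewer than \<open>d\<close> terms exceed the level.\<close>

lemma multiplier_whp:
  fixes f :: "'i \<Rightarrow> 'a \<Rightarrow> real" and \<xi> :: "'a \<Rightarrow> real"
  assumes M: "prob_space M" and I: "finite I" "real (card I) \<le> A ^ d" and A: "1 \<le> A"
    and d: "1 \<le> d" "d \<le> N" and c: "0 < c" and \<epsilon>: "0 < \<epsilon>" "\<epsilon> \<le> 1" and q: "2 < q"
    and f: "\<And>x. x \<in> I \<Longrightarrow> f x \<in> borel_measurable M"
    and mgf: "\<And>x. x \<in> I \<Longrightarrow> (\<integral>\<^sup>+y. ennreal (exp (c * (f x y)\<^sup>2)) \<partial>M) \<le> ennreal 2"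
    and \<xi>: "\<xi> \<in> borel_measurable M" "integrable M (\<lambda>y. \<bar>\<xi> y\<bar> powr q)" "(\<integral>y. \<bar>\<xi> y\<bar> powr q \<partial>M) \<le> 1"
    and i1: "\<And>x. x \<in> I \<Longrightarrow> integrable M (\<lambda>y. \<xi> y * f x y)"
    and e1: "\<And>x. x \<in> I \<Longrightarrow> (\<integral>y. \<xi> y * f x y \<partial>M) = 0"
    and i2: "\<And>x. x \<in> I \<Longrightarrow> integrable M (\<lambda>y. (\<xi> y * f x y)\<^sup>2)"
    and e2: "\<And>x. x \<in> I \<Longrightarrow> (\<integral>y. (\<xi> y * f x y)\<^sup>2 \<partial>M) \<le> v"
  shows "holds_whp (sample N M) (3 * \<epsilon>) (\<lambda>Z. \<forall>x\<in>I.
    \<bar>\<Sum>i<N. \<xi> (Z i) * f x (Z i)\<bar> \<le> multiplier_const q A c \<epsilon> v * sqrt (real N * d))"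
  (is "holds_whp _ _ ?Q")
proof -
  let ?B = "top_const q A c \<epsilon>"
  define R where "R = sqrt (real N * d)"
  \<comment> \<open>Here R / d = sqrt (N / d). The factor 2 gives d b = 2 B R, the strict inequality
    that \<open>sum_large_terms_le\<close> asks for.\<close>
  define b where "b = 2 * ?B * (R / d)"
  have B: "0 < ?B" by (rule top_const_pos[OF q A c \<epsilon>])
  have R: "0 < R" "R * R = real N * d" using d by (auto simp: R_def)
  have b: "0 < b" using B R d by (simp add: b_def)
  have N: "0 < N" using d by simp
  have S: "prob_space (sample N M)" by (rule prob_space_sample[OF M])
  have markov: "holds_whp (sample N M) \<epsilon> (\<lambda>Z. (\<Sum>i<N. \<bar>\<xi> (Z i)\<bar> powr q) < real N * 1 / \<epsilon>)"
    by (rule markov_sample_sum[OF M \<xi>(2) _ \<xi>(3) \<epsilon>(1) _ N]) auto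
  have Y: "(\<lambda>y. \<xi> y * f x y) \<in> borel_measurable M" if "x \<in> I" for x
    using \<xi>(1) f[OF that] by measurable
  have "holds_whp (sample N M) (\<epsilon> + \<epsilon> + \<epsilon>) (\<lambda>Z.
      ((\<forall>x\<in>I. \<forall>J. J \<subseteq> {..<N} \<longrightarrow> card J = d \<longrightarrow>
        (\<Sum>i\<in>J. (f x (Z i))\<^sup>2) \<le> d * ((ln A + ln 2 + 1 + ln (1 / \<epsilon>)) / c) * (1 + ln (N / d)))
      \<and> (\<Sum>i<N. \<bar>\<xi> (Z i)\<bar> powr q) < real N * 1 / \<epsilon>)
      \<and> (\<forall>x\<in>I. \<bar>\<Sum>i<N. if \<bar>\<xi> (Z i) * f x (Z i)\<bar> \<le> b then \<xi> (Z i) * f x (Z i) else 0\<bar>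
        \<le> 2 * b * d * (ln A + ln 2 + ln (1 / \<epsilon>)) + N * v / (2 * b) + N * v / b))"
    (is "holds_whp _ _ ?E")
    by (rule holds_whp_conj[OF S holds_whp_conj[OF S top_sums_whp[OF M I A d c \<epsilon> f mgf] markov]
      truncated_sums_whp[OF M I A d b \<epsilon> Y i1 e1 i2 e2]])
  then show ?thesis
  proof (rule holds_whp_mono)
    fix Z
    assume Z: "?E Z"
    show "?Q Z"
    proof
      fix x assume x: "x \<in> I"
      let ?z = "\<lambda>i. \<xi> (Z i) * f x (Z i)"
      have top: "(\<Sum>i\<in>J. \<bar>?z i\<bar>) \<le> ?B * R" if J: "J \<subseteq> {..<N}" "card J = d" for J
        unfolding R_def top_const_def
      proof (rule top_product_sum_le[OF q J(2) d])
        have "(\<Sum>i\<in>J. \<bar>\<xi> (Z i)\<bar> powr q) \<le> (\<Sum>i<N. \<bar>\<xi> (Z i)\<bar> powr q)"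
          using J by (intro sum_mono2) auto
        then show "(\<Sum>i\<in>J. \<bar>\<xi> (Z i)\<bar> powr q) \<le> N * (1 / \<epsilon>)" using Z by simp
        show "(\<Sum>i\<in>J. (f x (Z i))\<^sup>2) \<le> d * tail_const A c \<epsilon> * (1 + ln (N / d))"
          using Z x J by (simp add: tail_const_def)
      qed (use \<epsilon> tail_const_pos[OF A c \<epsilon>] in auto)
      have lt: "?B * R < d * b" using B R(1) d by (simp add: b_def)
      have large: "(\<Sum>i\<in>{i. i < N \<and> b < \<bar>?z i\<bar>}. \<bar>?z i\<bar>) \<le> ?B * R"
      proof (rule sum_large_terms_le[of N d ?z "?B * R" b])
        show "(\<Sum>i\<in>J. \<bar>?z i\<bar>) \<le> ?B * R" if "J \<subseteq> {..<N}" "card J = d" for J by (rule top[OF that])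
      qed (rule lt, rule d(2))
      have "(\<Sum>i<N. ?z i) = (\<Sum>i<N. (if \<bar>?z i\<bar> \<le> b then ?z i else 0) + (if b < \<bar>?z i\<bar> then ?z i else 0))"
        by (intro sum.cong) auto
      also have "\<dots> = (\<Sum>i<N. if \<bar>?z i\<bar> \<le> b then ?z i else 0) + (\<Sum>i\<in>{i. i < N \<and> b < \<bar>?z i\<bar>}. ?z i)"
        by (simp add: sum.distrib sum.If_cases Int_def)
      finally have "\<bar>\<Sum>i<N. ?z i\<bar> \<le> \<bar>\<Sum>i<N. if \<bar>?z i\<bar> \<le> b then ?z i else 0\<bar>
          + \<bar>\<Sum>i\<in>{i. i < N \<and> b < \<bar>?z i\<bar>}. ?z i\<bar>"
        by (simp only: abs_triangle_ineq)
      also have "\<bar>\<Sum>i\<in>{i. i < N \<and> b < \<bar>?z i\<bar>}. ?z i\<bar> \<le> ?B * R"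
        using large sum_abs[of ?z "{i. i < N \<and> b < \<bar>?z i\<bar>}"] by linarith
      also have "\<bar>\<Sum>i<N. if \<bar>?z i\<bar> \<le> b then ?z i else 0\<bar>
          \<le> 2 * b * d * (ln A + ln 2 + ln (1 / \<epsilon>)) + N * v / (2 * b) + N * v / b"
        using Z x by blast
      also have "2 * b * d = 4 * ?B * R" using d by (simp add: b_def)
      also have "N * v / b = v / (2 * ?B) * R"
        using R B d by (simp add: b_def field_simps)
      also have "N * v / (2 * b) = v / (4 * ?B) * R"
        using R B d by (simp add: b_def field_simps)
      finally show "\<bar>\<Sum>i<N. ?z i\<bar> \<le> multiplier_const q A c \<epsilon> v * sqrt (real N * d)"
        unfolding R_def[symmetric] multiplier_const_def by (simp add: algebra_simps)
    qed
  qed simp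
qed

section \<open>Moments of linear functionals of the design\<close>

lemma space_joint_law:
  assumes "joint_law m T P"
  shows "space P = carrier_mat m T \<times> UNIV"
proof -
  have "space P = space (mat_borel m T \<Otimes>\<^sub>M (borel :: real measure))"
    using assms by (intro sets_eq_imp_space_eq) (simp add: joint_law_def)
  then show ?thesis by (simp add: space_pair_measure mat_borel_def)
qed

lemma trace_inner_fun_mat:
  assumes "x \<in> carrier_mat m T"
  shows "trace_inner (fun_mat m T a) x = frob m T a (entries x)"
  by (subst trace_inner_eq_frob[OF _ assms]) (auto intro: frob_cong)

text \<open>The functional lives on the joint law and not on the law of the design, because it has
  to be multiplied by noise that may depend on it.\<close>

definition design_score ::
  "nat \<Rightarrow> nat \<Rightarrow> (nat \<Rightarrow> nat \<Rightarrow> real) \<Rightarrow> real mat \<times> real \<Rightarrow> real" where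
  "design_score m T a z = frob m T a (entries (fst z))"

context
  fixes m T :: nat and P :: "(real mat \<times> real) measure" and L :: real
  assumes joint: "joint_law m T P" and iso: "isotropic m T (law_X m T P)"
    and sub: "subgaussian L m T (law_X m T P)" and L: "0 \<le> L"
begin

lemma prob_space_law: "prob_space P"
  using joint by (simp add: joint_law_def)

lemma measurable_fst_law: "fst \<in> measurable P (mat_borel m T)"
proof -
  have "measurable P (mat_borel m T) = measurable (mat_borel m T \<Otimes>\<^sub>M (borel :: real measure)) (mat_borel m T)"
    using joint by (intro measurable_cong_sets) (auto simp: joint_law_def)
  then show ?thesis by simp
qed

lemma fst_carrier: "z \<in> space P \<Longrightarrow> fst z \<in> carrier_mat m T"
  unfolding space_joint_law[OF joint] mem_Times_iff by (rule conjunct1)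

lemma design_score_eq:
  "z \<in> space P \<Longrightarrow> design_score m T a z = trace_inner (fun_mat m T a) (fst z)"
  by (simp add: design_score_def trace_inner_fun_mat fst_carrier)

lemma measurable_trace_inner: "trace_inner (fun_mat m T a) \<in> borel_measurable (mat_borel m T)"
proof -
  have "trace_inner (fun_mat m T a) \<in> borel_measurable (law_X m T P)"
    using sub by (auto simp: subgaussian_def in_Lp_def)
  then show ?thesis by (simp add: law_X_def)
qed

lemma measurable_design_score [measurable]: "design_score m T a \<in> borel_measurable P"
proof -
  have "(\<lambda>z. trace_inner (fun_mat m T a) (fst z)) \<in> borel_measurable P"
    by (rule measurable_compose[OF measurable_fst_law measurable_trace_inner])
  then show ?thesis by (subst measurable_cong[OF design_score_eq])
qed

lemma transfer_integral:
  fixes g :: "real \<Rightarrow> real"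
  assumes "g \<in> borel_measurable borel"
  shows "integrable P (\<lambda>z. g (design_score m T a z)) \<longleftrightarrow>
      integrable (law_X m T P) (\<lambda>x. g (trace_inner (fun_mat m T a) x))"
    and "(\<integral>z. g (design_score m T a z) \<partial>P) = (\<integral>x. g (trace_inner (fun_mat m T a) x) \<partial>law_X m T P)"
proof -
  have meas: "(\<lambda>x. g (trace_inner (fun_mat m T a) x)) \<in> borel_measurable (mat_borel m T)"
    by (rule measurable_compose[OF measurable_trace_inner assms])
  have "integrable (law_X m T P) (\<lambda>x. g (trace_inner (fun_mat m T a) x)) \<longleftrightarrow>
      integrable P (\<lambda>z. g (trace_inner (fun_mat m T a) (fst z)))"
    unfolding law_X_def by (rule integrable_distr_eq[OF measurable_fst_law meas])
  also have "\<dots> \<longleftrightarrow> integrable P (\<lambda>z. g (design_score m T a z))"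
    by (intro Bochner_Integration.integrable_cong refl) (simp add: design_score_eq)
  finally show "integrable P (\<lambda>z. g (design_score m T a z)) \<longleftrightarrow>
      integrable (law_X m T P) (\<lambda>x. g (trace_inner (fun_mat m T a) x))" by simp
  have "(\<integral>x. g (trace_inner (fun_mat m T a) x) \<partial>law_X m T P) = (\<integral>z. g (trace_inner (fun_mat m T a) (fst z)) \<partial>P)"
    unfolding law_X_def by (rule integral_distr[OF measurable_fst_law meas])
  also have "\<dots> = (\<integral>z. g (design_score m T a z) \<partial>P)"
    by (intro Bochner_Integration.integral_cong refl) (simp add: design_score_eq)
  finally show "(\<integral>z. g (design_score m T a z) \<partial>P) = (\<integral>x. g (trace_inner (fun_mat m T a) x) \<partial>law_X m T P)"
    by simp
qed

lemma design_score_second_moment: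
  "integrable P (\<lambda>z. (design_score m T a z)\<^sup>2)" "(\<integral>z. (design_score m T a z)\<^sup>2 \<partial>P) = frob m T a a"
proof -
  have "integrable (law_X m T P) (\<lambda>x. (trace_inner (fun_mat m T a) x)\<^sup>2)"
    "(\<integral>x. (trace_inner (fun_mat m T a) x)\<^sup>2 \<partial>law_X m T P) = frob m T a a"
    using iso by (auto simp: isotropic_def schatten_norm_2 frob_norm_sq)
  then show "integrable P (\<lambda>z. (design_score m T a z)\<^sup>2)" "(\<integral>z. (design_score m T a z)\<^sup>2 \<partial>P) = frob m T a a"
    using transfer_integral[of "\<lambda>x. x\<^sup>2" a] by auto
qed

lemma design_score_moment:
  assumes p: "2 \<le> p"
  shows "integrable P (\<lambda>z. \<bar>design_score m T a z\<bar> powr p)"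
    and "(\<integral>z. \<bar>design_score m T a z\<bar> powr p \<partial>P) \<le> (L * sqrt p * frob_norm m T a) powr p"
proof -
  let ?B = "fun_mat m T a"
  have "in_Lp (law_X m T P) p (trace_inner ?B)"
    and le: "Lp_norm (law_X m T P) p (trace_inner ?B) \<le> L * sqrt p * Lp_norm (law_X m T P) 2 (trace_inner ?B)"
    using sub p by (auto simp: subgaussian_def)
  then have "integrable (law_X m T P) (\<lambda>x. \<bar>trace_inner ?B x\<bar> powr p)" by (simp add: in_Lp_def)
  then show "integrable P (\<lambda>z. \<bar>design_score m T a z\<bar> powr p)"
    using transfer_integral(1)[of "\<lambda>x. \<bar>x\<bar> powr p" a] by simp
  have "(\<integral>x. \<bar>trace_inner ?B x\<bar> powr 2 \<partial>law_X m T P) = (\<integral>x. (trace_inner ?B x)\<^sup>2 \<partial>law_X m T P)"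
    by simp
  also have "\<dots> = frob m T a a" using iso by (auto simp: isotropic_def schatten_norm_2 frob_norm_sq)
  finally have "Lp_norm (law_X m T P) 2 (trace_inner ?B) = frob_norm m T a"
    by (simp add: Lp_norm_def frob_norm_def powr_half_sqrt)
  then have le: "(\<integral>z. \<bar>design_score m T a z\<bar> powr p \<partial>P) powr (1 / p) \<le> L * sqrt p * frob_norm m T a"
    using le transfer_integral(2)[of "\<lambda>x. \<bar>x\<bar> powr p" a] by (simp add: Lp_norm_def)
  have "(\<integral>z. \<bar>design_score m T a z\<bar> powr p \<partial>P) = ((\<integral>z. \<bar>design_score m T a z\<bar> powr p \<partial>P) powr (1 / p)) powr p"
    using p by (simp add: powr_powr integral_nonneg_AE)
  also have "\<dots> \<le> (L * sqrt p * frob_norm m T a) powr p"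
    using le p by (intro powr_mono2) auto
  finally show "(\<integral>z. \<bar>design_score m T a z\<bar> powr p \<partial>P) \<le> (L * sqrt p * frob_norm m T a) powr p" .
qed

lemma design_score_even_moment:
  assumes k: "1 \<le> k"
  shows "integrable P (\<lambda>z. design_score m T a z ^ (2 * k))"
    and "(\<integral>z. design_score m T a z ^ (2 * k) \<partial>P) \<le> (2 * L\<^sup>2 * frob m T a a * k) ^ k"
proof -
  have pw: "\<bar>x\<bar> powr real (2 * k) = x ^ (2 * k)" for x :: real
  proof (cases "x = 0")
    case False
    then have "\<bar>x\<bar> powr real (2 * k) = \<bar>x\<bar> ^ (2 * k)" by (intro powr_realpow) simp
    then show ?thesis by (simp add: power_mult)
  qed (use k in simp)
  have p: "2 \<le> real (2 * k)" using k by simp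
  show "integrable P (\<lambda>z. design_score m T a z ^ (2 * k))"
    using design_score_moment(1)[OF p, of a] unfolding pw .
  have "(\<integral>z. design_score m T a z ^ (2 * k) \<partial>P) \<le> (L * sqrt (real (2 * k)) * frob_norm m T a) powr real (2 * k)"
    using design_score_moment(2)[OF p, of a] unfolding pw .
  also have "\<dots> = (L * sqrt (real (2 * k)) * frob_norm m T a) ^ (2 * k)"
    using L by (simp add: pw[symmetric])
  also have "\<dots> = ((L * sqrt (real (2 * k)) * frob_norm m T a)\<^sup>2) ^ k" by (rule power_mult)
  also have "(L * sqrt (real (2 * k)) * frob_norm m T a)\<^sup>2 = 2 * L\<^sup>2 * frob m T a a * k"
    by (simp add: power_mult_distrib frob_norm_sq)
  finally show "(\<integral>z. design_score m T a z ^ (2 * k) \<partial>P) \<le> (2 * L\<^sup>2 * frob m T a a * k) ^ k" .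
qed

text \<open>The bound 16 is that of \<open>frob_lattice_outer_le\<close>; it turns the moments of
  order 2 k into at most (32 L^2 k)^k.\<close>

lemma design_score_mgf:
  assumes a: "frob m T a a \<le> 16" and c: "0 \<le> c" "c * (32 * L\<^sup>2) * exp 1 \<le> 1 / 2"
  shows "(\<integral>\<^sup>+z. ennreal (exp (c * (design_score m T a z)\<^sup>2)) \<partial>P) \<le> ennreal 2"
proof (rule exp_square_moment[OF prob_space_law measurable_design_score design_score_even_moment(1) _ c(1) _ c(2)])
  fix k :: nat assume k: "1 \<le> k"
  have "2 * L\<^sup>2 * frob m T a a * k \<le> 2 * L\<^sup>2 * 16 * k"
    using a by (intro mult_right_mono mult_left_mono) auto
  then have "(2 * L\<^sup>2 * frob m T a a * k) ^ k \<le> (32 * L\<^sup>2 * k) ^ k"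
    by (intro power_mono) auto
  then show "(\<integral>z. design_score m T a z ^ (2 * k) \<partial>P) \<le> (32 * L\<^sup>2 * k) ^ k"
    using design_score_even_moment(2)[OF k, of a] by linarith
qed auto

lemma noise_eq:
  assumes "B \<in> carrier_mat m T" "z \<in> space P"
  shows "noise B z = design_score m T (entries B) z - snd z"
  using assms fst_carrier
  by (simp add: noise_def design_score_def case_prod_unfold trace_inner_eq_frob)

text \<open>First-order condition for the risk: along the direction \<open>a\<close> the risk is a
  quadratic polynomial in t with its minimum at t = 0, so the linear coefficient vanishes. This
  centres the multiplier sums without independence.\<close>

lemma noise_orthogonal:
  assumes min: "is_risk_minimizer m T P B"
    and \<xi>: "noise B \<in> borel_measurable P" "integrable P (\<lambda>z. (noise B z)\<^sup>2)"
    and prod: "integrable P (\<lambda>z. noise B z * design_score m T a z)"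
  shows "(\<integral>z. noise B z * design_score m T a z \<partial>P) = 0"
proof -
  have B: "B \<in> carrier_mat m T" using min by (simp add: is_risk_minimizer_def is_arg_min_def)
  define e where "e = (\<integral>z. noise B z * design_score m T a z \<partial>P)"
  define \<beta> where "\<beta> = frob m T a a"
  have ge: "0 \<le> 2 * t * e + t\<^sup>2 * \<beta>" for t
  proof -
    let ?C = "fun_mat m T (\<lambda>i j. B $$ (i, j) + t * a i j)"
    have C: "?C \<in> carrier_mat m T" by simp
    have risk_B: "(\<integral>(x, y). (trace_inner B x - y)\<^sup>2 \<partial>P) = (\<integral>z. (noise B z)\<^sup>2 \<partial>P)"
      by (simp add: noise_def case_prod_unfold)
    have expand: "(case z of (x, y) \<Rightarrow> (trace_inner ?C x - y)\<^sup>2)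
        = (noise B z)\<^sup>2 + 2 * t * (noise B z * design_score m T a z) + t\<^sup>2 * (design_score m T a z)\<^sup>2"
      if z: "z \<in> space P" for z
    proof -
      have "frob m T (\<lambda>i j. B $$ (i, j) + t * a i j) (entries (fst z))
          = frob m T (entries B) (entries (fst z)) + t * frob m T a (entries (fst z))"
        by (simp only: frob_add_left frob_scale_left)
      then have shift: "trace_inner ?C (fst z) - snd z = noise B z + t * design_score m T a z"
        unfolding noise_eq[OF B z] trace_inner_fun_mat[OF fst_carrier[OF z]] design_score_def
        by linarith
      have "(case z of (x, y) \<Rightarrow> (trace_inner ?C x - y)\<^sup>2) = (trace_inner ?C (fst z) - snd z)\<^sup>2"
        by (simp only: case_prod_unfold)
      also have "\<dots> = (noise B z)\<^sup>2 + 2 * t * (noise B z * design_score m T a z) + t\<^sup>2 * (design_score m T a z)\<^sup>2"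
        unfolding shift by (simp add: power2_eq_square algebra_simps)
      finally show ?thesis .
    qed
    have "(\<integral>(x, y). (trace_inner ?C x - y)\<^sup>2 \<partial>P)
        = (\<integral>z. (noise B z)\<^sup>2 + 2 * t * (noise B z * design_score m T a z) + t\<^sup>2 * (design_score m T a z)\<^sup>2 \<partial>P)"
      by (rule Bochner_Integration.integral_cong[OF refl expand])
    also have "\<dots> = (\<integral>z. (noise B z)\<^sup>2 \<partial>P) + 2 * t * e + t\<^sup>2 * \<beta>"
      using \<xi>(2) prod design_score_second_moment by (simp add: e_def \<beta>_def)
    finally have "(\<integral>(x, y). (trace_inner ?C x - y)\<^sup>2 \<partial>P) = (\<integral>z. (noise B z)\<^sup>2 \<partial>P) + 2 * t * e + t\<^sup>2 * \<beta>" .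
    moreover have "\<not> (\<integral>(x, y). (trace_inner ?C x - y)\<^sup>2 \<partial>P) < (\<integral>(x, y). (trace_inner B x - y)\<^sup>2 \<partial>P)"
      using min C unfolding is_risk_minimizer_def is_arg_min_def by blast
    ultimately show ?thesis unfolding risk_B by linarith
  qed
  have \<beta>: "0 \<le> \<beta>" by (simp add: \<beta>_def)
  have "e = 0"
  proof (rule ccontr)
    assume "e \<noteq> 0"
    \<comment> \<open>Close to the minimiser of the quadratic; the added 1 covers \<beta> =
      0.\<close>
    define t where "t = - e / (\<beta> + 1)"
    have e: "e = - ((\<beta> + 1) * t)" using \<beta> by (simp add: t_def)
    then have "t \<noteq> 0" using \<open>e \<noteq> 0\<close> by auto
    have "2 * t * e + t\<^sup>2 * \<beta> = t\<^sup>2 * (- \<beta> - 2)"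
      unfolding e by (simp add: power2_eq_square algebra_simps)
    also have "\<dots> < 0"
      using \<open>t \<noteq> 0\<close> \<beta> by (intro mult_pos_neg) auto
    finally show False using ge[of t] by simp
  qed
  then show ?thesis by (simp add: e_def)
qed

end

text \<open>Young's inequality for the conjugate exponents q / 2 and q / (q - 2), proved by asking
  which factor dominates. It makes products with dependent noise square integrable, since the design
  has moments of every order.\<close>

lemma square_product_le:
  fixes a b q :: real
  assumes q: "2 < q"
  shows "(a * b)\<^sup>2 \<le> \<bar>a\<bar> powr q + \<bar>b\<bar> powr (2 * q / (q - 2))"
proof (cases "a = 0 \<or> b = 0")
  case False
  then have pos: "0 < \<bar>a\<bar>" "0 < \<bar>b\<bar>" by auto
  have sq: "(a * b)\<^sup>2 = \<bar>a\<bar> powr 2 * \<bar>b\<bar> powr 2" using pos by (simp add: power_mult_distrib)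
  show ?thesis
  proof (cases "\<bar>b\<bar> \<le> \<bar>a\<bar> powr ((q - 2) / 2)")
    case True
    then have "\<bar>b\<bar> powr 2 \<le> (\<bar>a\<bar> powr ((q - 2) / 2)) powr 2" by (intro powr_mono2) auto
    also have "\<dots> = \<bar>a\<bar> powr (q - 2)"
    proof -
      have "(q - 2) / 2 * 2 = q - 2" by (metis nonzero_eq_divide_eq zero_neq_numeral)
      then show ?thesis by (simp only: powr_powr)
    qed
    finally have "(a * b)\<^sup>2 \<le> \<bar>a\<bar> powr 2 * \<bar>a\<bar> powr (q - 2)" unfolding sq by (intro mult_left_mono) auto
    also have "\<dots> = \<bar>a\<bar> powr q" by (simp only: powr_add[symmetric]) simp
    finally show ?thesis by (simp add: add_increasing2)
  next
    case False
    have "(q - 2) / 2 * (2 / (q - 2)) = 1" using q by simp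
    then have "\<bar>a\<bar> = (\<bar>a\<bar> powr ((q - 2) / 2)) powr (2 / (q - 2))"
      using pos by (simp only: powr_powr) simp
    also have "(\<bar>a\<bar> powr ((q - 2) / 2)) powr (2 / (q - 2)) \<le> \<bar>b\<bar> powr (2 / (q - 2))" using False q by (intro powr_mono2) auto
    finally have "\<bar>a\<bar> powr 2 \<le> (\<bar>b\<bar> powr (2 / (q - 2))) powr 2" by (intro powr_mono2) auto
    also have "\<dots> = \<bar>b\<bar> powr (4 / (q - 2))" by (simp add: powr_powr)
    finally have "(a * b)\<^sup>2 \<le> \<bar>b\<bar> powr (4 / (q - 2)) * \<bar>b\<bar> powr 2" unfolding sq by (intro mult_right_mono) auto
    also have "\<dots> = \<bar>b\<bar> powr (4 / (q - 2) + 2)" by (simp add: powr_add)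
    also have "4 / (q - 2) + 2 = 2 * q / (q - 2)" using q by (simp add: field_simps)
    finally show ?thesis by (simp add: add_increasing)
  qed
qed auto

text \<open>Deterministic part. The multiplier term is at most a quarter of the penalty, so it
  cannot offset what decomposability gains outside the s directions of V; this confines D, up to w,
  to a cone where trace and Hilbert-Schmidt norm differ by a multiple of sqrt s.\<close>

lemma estimator_error_bound:
  fixes X :: "nat \<Rightarrow> nat \<Rightarrow> nat \<Rightarrow> real" and A B V :: "nat \<Rightarrow> nat \<Rightarrow> real" and \<xi> :: "nat \<Rightarrow> real"
  defines "D \<equiv> \<lambda>i j. A i j - B i j"
  assumes N: "0 < N" and s: "0 < s" and lam: "0 < lam" and w: "0 \<le> w"
    and opt: "(\<Sum>i<N. (\<xi> i + frob m T (X i) D)\<^sup>2) / N + lam * trace_norm m T A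
      \<le> (\<Sum>i<N. (\<xi> i)\<^sup>2) / N + lam * trace_norm m T B"
    and rank: "vec_space.rank m (fun_mat m T V) \<le> s"
    and approx: "trace_norm m T (\<lambda>i j. B i j - V i j) \<le> w"
    and mult: "\<bar>(\<Sum>i<N. \<xi> i * frob m T (X i) D) / N\<bar> \<le> lam / 4 * trace_norm m T D"
    and quad: "frob m T D D / 2 - (trace_norm m T D)\<^sup>2 * C / h \<le> (\<Sum>i<N. (frob m T (X i) D)\<^sup>2) / N"
    and h: "400 * C * s \<le> h" "0 < h" and C: "0 \<le> C"
  shows "trace_norm m T D \<le> 160 * lam * s + 10 * w"
    and "frob_norm m T D \<le> 16 * lam * sqrt s + w / sqrt s"
proof -
  define f where "f = frob_norm m T D"
  define n where "n = trace_norm m T D"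
  define r where "r = sqrt (real s)"
  define Q where "Q = (\<Sum>i<N. (frob m T (X i) D)\<^sup>2) / N"
  define U where "U = (\<Sum>i<N. \<xi> i * frob m T (X i) D) / N"
  have r: "0 < r" "r * r = s" using s by (auto simp: r_def)
  have f: "0 \<le> f" by (simp add: f_def)
  have "(\<Sum>i<N. (\<xi> i + frob m T (X i) D)\<^sup>2) / N = (\<Sum>i<N. (\<xi> i)\<^sup>2) / N + 2 * U + Q"
    by (simp add: U_def Q_def power2_sum sum.distrib add_divide_distrib sum_distrib_left mult.assoc algebra_simps)
  then have basic: "Q \<le> - 2 * U + lam * (trace_norm m T B - trace_norm m T A)"
    using opt by (simp add: algebra_simps)
  obtain t where t: "0 \<le> t" "trace_norm m T V - r * f + t \<le> trace_norm m T (\<lambda>i j. V i j + D i j)"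
    "n \<le> 2 * r * f + t"
    using trace_norm_decomposition[OF rank, of D] unfolding r_def f_def n_def by blast
  have "trace_norm m T (\<lambda>i j. V i j + D i j) - w \<le> trace_norm m T A"
  proof -
    have "trace_norm m T (\<lambda>i j. V i j + D i j) - trace_norm m T (\<lambda>i j. B i j - V i j)
        \<le> trace_norm m T (\<lambda>i j. (V i j + D i j) + (B i j - V i j))"
      by (rule trace_norm_diff_ge)
    then show ?thesis using approx by (simp add: D_def)
  qed
  moreover have "trace_norm m T B \<le> trace_norm m T V + w"
    using trace_norm_triangle[of m T V "\<lambda>i j. B i j - V i j"] approx by simp
  ultimately have "trace_norm m T B - trace_norm m T A \<le> r * f - t + 2 * w" using t(2) by linarith
  then have "lam * (trace_norm m T B - trace_norm m T A) \<le> lam * (r * f - t + 2 * w)"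
    using lam by (intro mult_left_mono) auto
  moreover have "- 2 * U \<le> lam / 2 * n"
    using abs_le_D2[OF mult[folded U_def n_def]] by simp
  moreover have "lam / 2 * n \<le> lam / 2 * (2 * r * f + t)" using t(3) lam by (intro mult_left_mono) auto
  ultimately have Q: "Q \<le> lam * (2 * (r * f) - t / 2 + 2 * w)"
    using basic by (simp add: algebra_simps)
  have "0 \<le> Q" by (simp add: Q_def sum_nonneg)
  then have "0 \<le> lam * (2 * (r * f) - t / 2 + 2 * w)" using Q by linarith
  then have "0 \<le> 2 * (r * f) - t / 2 + 2 * w" using lam by (simp add: zero_le_mult_iff)
  then have n: "n \<le> 6 * (r * f) + 4 * w" using t(3) by linarith
  have "lam * (2 * (r * f) - t / 2 + 2 * w) \<le> lam * (2 * (r * f) + 2 * w)"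
    using lam t(1) by (intro mult_left_mono) auto
  then have Q: "Q \<le> lam * (2 * (r * f) + 2 * w)" using Q by linarith
  have "n \<le> 160 * lam * s + 10 * w \<and> f \<le> 16 * lam * r + w / r"
  \<comment> \<open>Either the approximation error dominates and the claim is immediate, or it is
    absorbed and n \<le> 10 r f. In the latter case 400 = 4 * 10^2 makes the sampling error at most
    f^2 / 4, and f^2 / 4 \<le> 4 lam r f gives the constants 16 and 160.\<close>
  proof (cases "r * f \<le> w")
    case True
    then have "f \<le> w / r" using r by (simp add: field_simps)
    moreover have "n \<le> 10 * w" using n True by linarith
    moreover have "0 \<le> 160 * lam * s" "0 \<le> 16 * lam * r" using lam r by auto
    ultimately show ?thesis by linarith
  next
    case False
    then have fpos: "0 < f" using w r f by (cases "f = 0") auto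
    have n10: "n \<le> 10 * (r * f)" using n False by linarith
    have n0: "0 \<le> n" by (simp add: n_def)
    have "n\<^sup>2 \<le> (10 * (r * f))\<^sup>2" using n10 n0 by (intro power_mono) auto
    also have "\<dots> = 100 * s * f\<^sup>2" by (simp add: power2_eq_square r(2)[symmetric])
    finally have "n\<^sup>2 * C / h \<le> 100 * s * f\<^sup>2 * C / h"
      using C h by (intro divide_right_mono mult_right_mono) auto
    also have "\<dots> \<le> f\<^sup>2 / 4"
    proof -
      have "f\<^sup>2 * (400 * C * s) \<le> f\<^sup>2 * h" using h by (intro mult_left_mono) auto
      then show ?thesis using h by (simp add: field_simps)
    qed
    finally have "f\<^sup>2 / 4 \<le> Q"
      using quad unfolding Q_def[symmetric] n_def[symmetric] frob_norm_sq[symmetric] f_def[symmetric] by linarith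
    moreover have "lam * (2 * (r * f) + 2 * w) \<le> lam * (4 * (r * f))"
      using False lam by (intro mult_left_mono) linarith+
    ultimately have "f * f \<le> f * (16 * lam * r)" using Q by (simp add: power2_eq_square algebra_simps)
    then have f16: "f \<le> 16 * lam * r" using fpos by simp
    then have "r * f \<le> r * (16 * lam * r)" using r by (intro mult_left_mono) auto
    also have "r * (16 * lam * r) = 16 * lam * s" by (simp add: r(2)[symmetric] mult_ac)
    finally have "n \<le> 160 * lam * s" using n10 by linarith
    moreover have "0 \<le> w / r" using w r by simp
    ultimately show ?thesis using f16 w by linarith
  qed
  then show "trace_norm m T D \<le> 160 * lam * s + 10 * w"
    and "frob_norm m T D \<le> 16 * lam * sqrt s + w / sqrt s"
    by (auto simp: n_def f_def r_def)
qed

section \<open>The estimator\<close>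

text \<open>Allows L to be replaced by \<open>max L 1\<close>, so that the constants are positive
  whatever L is.\<close>

lemma subgaussian_mono:
  assumes "subgaussian L m T \<mu>" "L \<le> L'"
  shows "subgaussian L' m T \<mu>"
  unfolding subgaussian_def
proof (intro allI impI ballI)
  fix p :: real and B :: "real mat" assume pB: "2 \<le> p" "B \<in> carrier_mat m T"
  have "L * sqrt p * Lp_norm \<mu> 2 (trace_inner B) \<le> L' * sqrt p * Lp_norm \<mu> 2 (trace_inner B)"
    using assms(2) pB by (intro mult_right_mono) (auto simp: Lp_norm_def)
  then show "in_Lp \<mu> p (trace_inner B) \<and> Lp_norm \<mu> p (trace_inner B) \<le> L' * sqrt p * Lp_norm \<mu> 2 (trace_inner B)"
    using assms(1) pB unfolding subgaussian_def by (meson order_trans)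
qed

lemma fun_mat_entries: "A \<in> carrier_mat m T \<Longrightarrow> fun_mat m T (entries A) = A"
  by (intro eq_matI) auto

lemma fun_mat_diff:
  "A \<in> carrier_mat m T \<Longrightarrow> B \<in> carrier_mat m T \<Longrightarrow> A - B = fun_mat m T (\<lambda>i j. A $$ (i, j) - B $$ (i, j))"
  by (intro eq_matI) auto

definition mgf_scale :: "real \<Rightarrow> real" where
  "mgf_scale L = 1 / (64 * exp 1 * L\<^sup>2)"

definition score_bound :: "real \<Rightarrow> real \<Rightarrow> real" where
  "score_bound L \<epsilon> = (ln 2304 + ln 2 + ln (1 / \<epsilon>)) / mgf_scale L"

text \<open>16 L^4 is the fourth-moment ratio of a score, and (400 C + 2) s bounds the number of
  points in a Maurey sum. The leading 1 ensures that N is at least \<open>max m T\<close>.\<close>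

definition sample_const :: "real \<Rightarrow> real \<Rightarrow> real" where
  "sample_const L \<epsilon> = 1 + 16 * (16 * L ^ 4) * ((400 * score_bound L \<epsilon> + 2) * ln 2304 + ln (1 / \<epsilon>))"

text \<open>The last argument bounds the second moment of normalised noise times score: 1 for the
  q-th moment of the noise, plus the moment of order 2 q / (q - 2) of a score of Hilbert-Schmidt
  norm at most 4.\<close>

definition noise_const :: "real \<Rightarrow> real \<Rightarrow> real \<Rightarrow> real" where
  "noise_const L \<epsilon> q = multiplier_const q 2304 (mgf_scale L) \<epsilon>
    (1 + (4 * L * sqrt (2 * q / (q - 2))) powr (2 * q / (q - 2)))"

lemma mgf_scale_pos: "1 \<le> L \<Longrightarrow> 0 < mgf_scale L"
  by (simp add: mgf_scale_def)

lemma score_bound_pos: "1 \<le> L \<Longrightarrow> 0 < \<epsilon> \<Longrightarrow> \<epsilon> \<le> 1 \<Longrightarrow> 0 < score_bound L \<epsilon>"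
  unfolding score_bound_def
  by (intro divide_pos_pos mgf_scale_pos add_pos_nonneg add_pos_pos) auto

lemma sample_const_ge_1:
  assumes "1 \<le> L" "0 < \<epsilon>" "\<epsilon> \<le> 1"
  shows "1 \<le> sample_const L \<epsilon>"
proof -
  have "0 \<le> (400 * score_bound L \<epsilon> + 2) * ln 2304 + ln (1 / \<epsilon>)"
    using score_bound_pos[OF assms] assms by (intro add_nonneg_nonneg mult_nonneg_nonneg) auto
  then show ?thesis unfolding sample_const_def by simp
qed

lemma noise_const_pos: "1 \<le> L \<Longrightarrow> 0 < \<epsilon> \<Longrightarrow> \<epsilon> \<le> 1 \<Longrightarrow> 2 < q \<Longrightarrow> 0 < noise_const L \<epsilon> q"
  unfolding noise_const_def by (intro multiplier_const_pos mgf_scale_pos) auto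

section \<open>High-probability events on the lattice\<close>

context
  fixes m T N :: nat and P :: "(real mat \<times> real) measure" and L \<epsilon> :: real
  assumes m: "0 < m" and T: "0 < T" and joint: "joint_law m T P"
    and iso: "isotropic m T (law_X m T P)" and sub: "subgaussian L m T (law_X m T P)"
    and L: "1 \<le> L" and \<epsilon>: "0 < \<epsilon>" "\<epsilon> \<le> 1" and N: "max m T \<le> N"
begin

lemma L_nonneg: "0 \<le> L" using L by simp

text \<open>2304 = 48^2, one factor 48 for each of the two lattice vectors.\<close>

lemma card_lattice_pairs_le_power: "real (card (lattice_pairs m T)) \<le> 2304 ^ max m T"
proof -
  have "real (card (lattice_pairs m T)) \<le> 48 ^ (m + T)" by (rule card_lattice_pairs_le)
  also have "\<dots> \<le> 48 ^ (2 * max m T)" by (intro power_increasing) auto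
  finally show ?thesis by (simp add: power_mult)
qed

lemma lattice_score_mgf:
  assumes "x \<in> lattice_pairs m T"
  shows "(\<integral>\<^sup>+z. ennreal (exp (mgf_scale L * (design_score m T (lattice_outer m T x) z)\<^sup>2)) \<partial>P) \<le> ennreal 2"
  using mgf_scale_pos[OF L] L
  by (intro design_score_mgf[OF joint iso sub L_nonneg] frob_lattice_outer_le assms m T)
    (auto simp: mgf_scale_def)

lemma lattice_upper_whp:
  "holds_whp (sample N P) \<epsilon> (\<lambda>Z. \<forall>x\<in>lattice_pairs m T.
    (\<Sum>i<N. (design_score m T (lattice_outer m T x) (Z i))\<^sup>2) \<le> N * score_bound L \<epsilon>)"
  unfolding score_bound_def using m N mgf_scale_pos[OF L]
  by (intro square_sums_whp[OF prob_space_law[OF joint iso sub L_nonneg] _ card_lattice_pairs_le_power] \<epsilon>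
      lattice_score_mgf measurable_design_score[OF joint iso sub L_nonneg]) auto

text \<open>Lists and not sets, because sampling may repeat points. The logarithm of their number is
  at most k \<open>max m T\<close> ln 2304, and since k is of order s this fixes the sample
  size.\<close>

lemma lattice_lower_whp:
  assumes n: "16 * (16 * L ^ 4) * (k * max m T * ln 2304 + ln (1 / \<epsilon>)) \<le> N"
  defines "G \<equiv> \<lambda>xs i j. \<Sum>x\<leftarrow>xs. lattice_outer m T x i j"
  shows "holds_whp (sample N P) \<epsilon> (\<lambda>Z. \<forall>xs\<in>{xs. set xs \<subseteq> lattice_pairs m T \<and> length xs = k}.
    N * frob m T (G xs) (G xs) / 2 \<le> (\<Sum>i<N. (design_score m T (G xs) (Z i))\<^sup>2))"
proof (rule square_sums_lower_whp[OF prob_space_law[OF joint iso sub L_nonneg] _ _ _ \<epsilon>(1) n])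
  let ?I = "{xs. set xs \<subseteq> lattice_pairs m T \<and> length xs = k}"
  have fin: "finite (lattice_pairs m T)" by simp
  show "finite ?I" by (rule finite_lists_length_eq[OF fin])
  have "real (card ?I) = real (card (lattice_pairs m T)) ^ k"
    by (simp only: card_lists_length_eq[OF fin] of_nat_power)
  also have "\<dots> \<le> (2304 ^ max m T) ^ k" by (intro power_mono card_lattice_pairs_le_power) auto
  also have "\<dots> = exp (k * max m T * ln 2304)"
    by (simp add: power_eq_exp_ln power_mult[symmetric] mult_ac)
  finally show "real (card ?I) \<le> exp (k * max m T * ln 2304)" .
  show "0 < 16 * L ^ 4" using L by simp
next
  fix xs
  show "design_score m T (G xs) \<in> borel_measurable P" by (rule measurable_design_score[OF joint iso sub L_nonneg])
  show "integrable P (\<lambda>z. (design_score m T (G xs) z)\<^sup>2)" "(\<integral>z. (design_score m T (G xs) z)\<^sup>2 \<partial>P) = frob m T (G xs) (G xs)"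
    by (rule design_score_second_moment[OF joint iso sub L_nonneg])+
  show "integrable P (\<lambda>z. design_score m T (G xs) z ^ 4)"
    using design_score_even_moment(1)[OF joint iso sub L_nonneg, of 2 "G xs"] by simp
  have "(\<integral>z. design_score m T (G xs) z ^ 4 \<partial>P) \<le> (2 * L\<^sup>2 * frob m T (G xs) (G xs) * 2)\<^sup>2"
    using design_score_even_moment(2)[OF joint iso sub L_nonneg, of 2 "G xs"] by simp
  also have "\<dots> = 16 * L ^ 4 * (frob m T (G xs) (G xs))\<^sup>2"
    by (simp add: power_mult_distrib power_mult[symmetric])
  finally show "(\<integral>z. design_score m T (G xs) z ^ 4 \<partial>P) \<le> 16 * L ^ 4 * (frob m T (G xs) (G xs))\<^sup>2" .
qed

text \<open>Division by \<kappa> normalises the q-th moment of the noise to 1, which makes the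
  constant free of scale. The three failure probabilities belong to the sums over d indices, the
  noise and the truncated sums.\<close>

lemma lattice_multiplier_whp:
  assumes q: "2 < q" and min: "is_risk_minimizer m T P B" and \<xi>: "in_Lp P q (noise B)"
  defines "\<kappa> \<equiv> Lp_norm P q (noise B)"
  assumes \<kappa>: "0 < \<kappa>"
  shows "holds_whp (sample N P) (3 * \<epsilon>) (\<lambda>Z. \<forall>x\<in>lattice_pairs m T.
    \<bar>\<Sum>i<N. noise B (Z i) / \<kappa> * design_score m T (lattice_outer m T x) (Z i)\<bar>
      \<le> noise_const L \<epsilon> q * sqrt (real N * max m T))"
proof -
  interpret prob_space P by (rule prob_space_law[OF joint iso sub L_nonneg])
  let ?\<xi> = "\<lambda>z. noise B z / \<kappa>" and ?f = "\<lambda>x. design_score m T (lattice_outer m T x)"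
  define r where "r = 2 * q / (q - 2)"
  have r: "2 \<le> r" using q by (simp add: r_def field_simps)
  have nm: "noise B \<in> borel_measurable P" and ni: "integrable P (\<lambda>z. \<bar>noise B z\<bar> powr q)"
    using \<xi> by (auto simp: in_Lp_def)
  have fm: "?f x \<in> borel_measurable P" for x by (rule measurable_design_score[OF joint iso sub L_nonneg])
  have \<xi>m: "?\<xi> \<in> borel_measurable P" using nm by measurable
  have scale: "\<bar>?\<xi> z\<bar> powr q = \<bar>noise B z\<bar> powr q / \<kappa> powr q" for z
    using \<kappa> by (simp add: powr_divide)
  have \<xi>i: "integrable P (\<lambda>z. \<bar>?\<xi> z\<bar> powr q)" unfolding scale using ni by simp
  have "\<kappa> powr q = (\<integral>z. \<bar>noise B z\<bar> powr q \<partial>P)"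
    using q unfolding \<kappa>_def Lp_norm_def by (simp add: powr_powr integral_nonneg_AE)
  then have \<xi>1: "(\<integral>z. \<bar>?\<xi> z\<bar> powr q \<partial>P) \<le> 1" unfolding scale using \<kappa> by simp
  have mom: "integrable P (\<lambda>z. \<bar>?f x z\<bar> powr r)" "(\<integral>z. \<bar>?f x z\<bar> powr r \<partial>P) \<le> (4 * L * sqrt r) powr r"
    if x: "x \<in> lattice_pairs m T" for x
  proof -
    show "integrable P (\<lambda>z. \<bar>?f x z\<bar> powr r)"
      by (rule design_score_moment(1)[OF joint iso sub L_nonneg r])
    have "frob_norm m T (lattice_outer m T x) \<le> sqrt 16"
      unfolding frob_norm_def by (intro real_sqrt_le_mono frob_lattice_outer_le x m T)
    then have "L * sqrt r * frob_norm m T (lattice_outer m T x) \<le> L * sqrt r * 4"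
      using L r by (intro mult_left_mono) auto
    then have "(L * sqrt r * frob_norm m T (lattice_outer m T x)) powr r \<le> (4 * L * sqrt r) powr r"
      using L r by (intro powr_mono2) (auto simp: mult_ac)
    then show "(\<integral>z. \<bar>?f x z\<bar> powr r \<partial>P) \<le> (4 * L * sqrt r) powr r"
      using design_score_moment(2)[OF joint iso sub L_nonneg r, of "lattice_outer m T x"] by linarith
  qed
  have i2: "integrable P (\<lambda>z. (?\<xi> z * ?f x z)\<^sup>2)" if x: "x \<in> lattice_pairs m T" for x
  proof (rule Bochner_Integration.integrable_bound[OF Bochner_Integration.integrable_add[OF \<xi>i mom(1)[OF x]]])
    show "(\<lambda>z. (?\<xi> z * ?f x z)\<^sup>2) \<in> borel_measurable P" using \<xi>m fm[of x] by measurable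
    show "AE z in P. norm ((?\<xi> z * ?f x z)\<^sup>2) \<le> norm (\<bar>?\<xi> z\<bar> powr q + \<bar>?f x z\<bar> powr r)"
      using square_product_le[OF q, folded r_def] by (intro AE_I2) (simp only: real_norm_def abs_of_nonneg zero_le_power2 add_nonneg_nonneg powr_ge_zero)
  qed
  have e2: "(\<integral>z. (?\<xi> z * ?f x z)\<^sup>2 \<partial>P) \<le> 1 + (4 * L * sqrt r) powr r" if x: "x \<in> lattice_pairs m T" for x
  proof -
    have "(\<integral>z. (?\<xi> z * ?f x z)\<^sup>2 \<partial>P) \<le> (\<integral>z. \<bar>?\<xi> z\<bar> powr q + \<bar>?f x z\<bar> powr r \<partial>P)"
      by (intro integral_mono i2[OF x] Bochner_Integration.integrable_add \<xi>i mom(1)[OF x]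
          square_product_le[OF q, folded r_def])
    also have "\<dots> = (\<integral>z. \<bar>?\<xi> z\<bar> powr q \<partial>P) + (\<integral>z. \<bar>?f x z\<bar> powr r \<partial>P)"
      by (rule Bochner_Integration.integral_add[OF \<xi>i mom(1)[OF x]])
    also have "\<dots> \<le> 1 + (4 * L * sqrt r) powr r" by (intro add_mono \<xi>1 mom(2)[OF x])
    finally show ?thesis .
  qed
  have i1: "integrable P (\<lambda>z. ?\<xi> z * ?f x z)" if x: "x \<in> lattice_pairs m T" for x
  proof (rule square_integrable_imp_integrable[OF _ i2[OF x]])
    show "(\<lambda>z. ?\<xi> z * ?f x z) \<in> borel_measurable P" using \<xi>m fm[of x] by measurable
  qed
  \<comment> \<open>Square integrability of the noise, needed to expand the risk in
    \<open>noise_orthogonal\<close>, follows from its q-th moment on a probability space.\<close>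
  have n2: "integrable P (\<lambda>z. (noise B z)\<^sup>2)"
  proof (rule Bochner_Integration.integrable_bound[OF Bochner_Integration.integrable_add[OF integrable_const[of 1] ni]])
    show "(\<lambda>z. (noise B z)\<^sup>2) \<in> borel_measurable P" using nm by measurable
    show "AE z in P. norm ((noise B z)\<^sup>2) \<le> norm (1 + \<bar>noise B z\<bar> powr q)"
    proof (intro AE_I2)
      fix z
      have "(noise B z)\<^sup>2 \<le> 1 + \<bar>noise B z\<bar> powr q"
        using square_product_le[OF q, of "noise B z" 1] by simp
      then show "norm ((noise B z)\<^sup>2) \<le> norm (1 + \<bar>noise B z\<bar> powr q)" by simp
    qed
  qed
  have e1: "(\<integral>z. ?\<xi> z * ?f x z \<partial>P) = 0" if x: "x \<in> lattice_pairs m T" for x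
  proof -
    have "(\<lambda>z. noise B z * ?f x z) = (\<lambda>z. \<kappa> * (?\<xi> z * ?f x z))" using \<kappa> by (simp add: fun_eq_iff)
    then have "integrable P (\<lambda>z. noise B z * ?f x z)"
      using Bochner_Integration.integrable_mult_right[OF i1[OF x], of \<kappa>] by (simp only:)
    then have "(\<integral>z. noise B z * ?f x z \<partial>P) = 0"
      by (rule noise_orthogonal[OF joint iso sub L_nonneg min nm n2])
    then show ?thesis by simp
  qed
  show ?thesis
    unfolding noise_const_def r_def[symmetric]
    by (rule multiplier_whp[OF prob_space_axioms _ card_lattice_pairs_le_power _ _ N mgf_scale_pos[OF L] \<epsilon> q
          fm lattice_score_mgf \<xi>m \<xi>i \<xi>1 i1 e1 i2 e2]) (use m in auto)
qed

end

text \<open>The exceptional set is fixed before the estimator, so every minimiser is covered and no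
  measurable selection is involved. The multiplier costs 3 \<epsilon>, each of the two quadratic
  events one \<epsilon>.\<close>

lemma trace_norm_estimator_whp:
  fixes L \<epsilon> q lam :: real and m T N s :: nat and P :: "(real mat \<times> real) measure" and B V :: "real mat"
  defines "\<rho> \<equiv> sqrt (real (max m T) / real N)" and "\<kappa> \<equiv> Lp_norm P q (noise B)"
  assumes L: "1 \<le> L" and \<epsilon>: "0 < \<epsilon>" "\<epsilon> \<le> 1" and q: "2 < q"
    and pos: "0 < m" "0 < T" "0 < N" "0 < s"
    and joint: "joint_law m T P" and iso: "isotropic m T (law_X m T P)"
    and sub: "subgaussian L m T (law_X m T P)"
    and min: "is_risk_minimizer m T P B" and \<xi>: "in_Lp P q (noise B)"
    and V: "V \<in> carrier_mat m T" "vec_space.rank m V \<le> s"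
    and approx: "schatten_norm 1 (B - V) \<le> \<kappa> * real s * \<rho>"
    and N: "real N \<ge> sample_const L \<epsilon> * real s * real (max m T)"
    and lam: "lam = 4 * noise_const L \<epsilon> q * \<kappa> * \<rho>" "0 < lam"
  shows "holds_whp (sample N P) (5 * \<epsilon>) (\<lambda>Z. \<forall>A. trace_norm_estimator m T N lam Z A \<longrightarrow>
    (\<forall>p. 1 \<le> p \<and> p \<le> 2 \<longrightarrow> schatten_norm p (A - B)
      \<le> 2 * (640 * noise_const L \<epsilon> q + 10) * \<kappa> * real s powr (1 / p) * \<rho>))"
  (is "holds_whp _ _ ?Q")
proof -
  define d where "d = max m T"
  define C where "C = score_bound L \<epsilon>"
  \<comment> \<open>The transfer of the quadratic bound divides by k - 1, which therefore has to
    reach 400 C s.\<close>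
  define k where "k = nat \<lceil>400 * C * s\<rceil> + 1"
  let ?I = "lattice_pairs m T" and ?g = "lattice_outer m T"
  let ?G = "\<lambda>xs i j. \<Sum>x\<leftarrow>xs. ?g x i j"
  have L_nonneg: "0 \<le> L" using L by simp
  have nc: "0 < noise_const L \<epsilon> q" by (rule noise_const_pos[OF L \<epsilon> q])
  have \<rho>: "0 < \<rho>" using pos by (simp add: \<rho>_def)
  \<comment> \<open>Zero noise norm would force lam = 0, so positivity of lam permits division by
    \<kappa>.\<close>
  have \<kappa>: "0 < \<kappa>"
    using lam nc \<rho> by (simp add: zero_less_mult_iff)
  have B: "B \<in> carrier_mat m T" using min by (simp add: is_risk_minimizer_def is_arg_min_def)
  have C: "0 < C" unfolding C_def by (rule score_bound_pos[OF L \<epsilon>])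
  have d: "1 \<le> d" using pos by (simp add: d_def)
  have sd: "1 \<le> real s * d" using pos d mult_mono[of 1 "real s" 1 "real d"] by simp
  have dN: "max m T \<le> N"
  proof -
    have "1 * real d \<le> (sample_const L \<epsilon> * real s) * real d"
      using sample_const_ge_1[OF L \<epsilon>] pos mult_mono[of 1 "sample_const L \<epsilon>" 1 "real s"]
      by (intro mult_right_mono) auto
    then have "real d \<le> real N" using N unfolding d_def by linarith
    then show ?thesis unfolding d_def by (simp only: of_nat_le_iff)
  qed
  have k: "2 \<le> k" "400 * C * s \<le> real (k - 1)" "real k \<le> (400 * C + 2) * s"
  proof -
    have "0 < 400 * C * s" using C pos by simp
    then have "0 < \<lceil>400 * C * s\<rceil>" by linarith
    then show "2 \<le> k" unfolding k_def by linarith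
    show "400 * C * s \<le> real (k - 1)" unfolding k_def by (simp add: real_nat_ceiling_ge)
    have "real k \<le> 400 * C * s + 2" using \<open>0 < \<lceil>400 * C * s\<rceil>\<close> unfolding k_def by linarith
    then show "real k \<le> (400 * C + 2) * s" using pos by (simp add: algebra_simps)
  qed
  have n: "16 * (16 * L ^ 4) * (k * max m T * ln 2304 + ln (1 / \<epsilon>)) \<le> N"
  proof -
    have ln0: "0 \<le> ln (1 / \<epsilon>)" using \<epsilon> by simp
    have "real k * d * ln 2304 \<le> (400 * C + 2) * s * d * ln 2304"
      using k(3) by (intro mult_right_mono) auto
    moreover have "ln (1 / \<epsilon>) * 1 \<le> ln (1 / \<epsilon>) * (real s * d)" using sd ln0 by (intro mult_left_mono)
    ultimately have "k * d * ln 2304 + ln (1 / \<epsilon>) \<le> ((400 * C + 2) * ln 2304 + ln (1 / \<epsilon>)) * (real s * d)"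
      by (simp add: algebra_simps)
    then have "16 * (16 * L ^ 4) * (k * d * ln 2304 + ln (1 / \<epsilon>))
        \<le> 16 * (16 * L ^ 4) * (((400 * C + 2) * ln 2304 + ln (1 / \<epsilon>)) * (real s * d))"
      by (intro mult_left_mono) auto
    also have "\<dots> \<le> sample_const L \<epsilon> * (real s * d)"
      using sd by (simp add: sample_const_def C_def algebra_simps)
    also have "\<dots> \<le> N" using N by (simp add: d_def mult.assoc)
    finally show ?thesis by (simp add: d_def)
  qed
  note whp = holds_whp_conj[OF prob_space_sample[OF prob_space_law[OF joint iso sub L_nonneg]]]
  have "holds_whp (sample N P) (3 * \<epsilon> + (\<epsilon> + \<epsilon>)) (\<lambda>Z.
      (\<forall>x\<in>?I. \<bar>\<Sum>i<N. noise B (Z i) / \<kappa> * design_score m T (?g x) (Z i)\<bar>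
        \<le> noise_const L \<epsilon> q * sqrt (real N * max m T))
      \<and> ((\<forall>x\<in>?I. (\<Sum>i<N. (design_score m T (?g x) (Z i))\<^sup>2) \<le> N * score_bound L \<epsilon>)
        \<and> (\<forall>xs\<in>{xs. set xs \<subseteq> ?I \<and> length xs = k}.
          N * frob m T (?G xs) (?G xs) / 2 \<le> (\<Sum>i<N. (design_score m T (?G xs) (Z i))\<^sup>2))))"
    (is "holds_whp _ _ ?E")
    using \<kappa> unfolding \<kappa>_def
    by (intro whp lattice_multiplier_whp[OF pos(1,2) joint iso sub L \<epsilon> dN q min \<xi>]
      lattice_upper_whp[OF pos(1,2) joint iso sub L \<epsilon> dN]
      lattice_lower_whp[OF pos(1,2) joint iso sub L \<epsilon> dN n])
  then show ?thesis
  proof (rule holds_whp_mono)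
    fix Z assume Zs: "Z \<in> space (sample N P)"
    assume Z: "?E Z"
    note Z1 = Z[THEN conjunct1] and Z2 = Z[THEN conjunct2, THEN conjunct1] and Z3 = Z[THEN conjunct2, THEN conjunct2]
    define X where "X i = entries (fst (Z i))" for i
    define \<eta> where "\<eta> i = noise B (Z i)" for i
    have ZP: "Z i \<in> space P" if "i < N" for i using Zs that by (auto simp: space_PiM)
    have score: "design_score m T a (Z i) = frob m T (X i) a" for a i
      by (simp add: design_score_def X_def frob_commute)
    have upper: "(\<Sum>i<N. (frob m T (X i) (?g x))\<^sup>2) / N \<le> C" if "x \<in> ?I" for x
    proof -
      have "(\<Sum>i<N. (frob m T (X i) (?g x))\<^sup>2) \<le> N * C" using bspec[OF Z2 that] by (simp only: score C_def)
      then show ?thesis using pos by (simp add: pos_divide_le_eq mult.commute)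
    qed
    have lower: "frob m T (?G xs) (?G xs) / 2 \<le> (\<Sum>i<N. (frob m T (X i) (?G xs))\<^sup>2) / N"
      if "set xs \<subseteq> ?I" "length xs = k" for xs
    proof -
      have "N * frob m T (?G xs) (?G xs) / 2 \<le> (\<Sum>i<N. (frob m T (X i) (?G xs))\<^sup>2)"
        using bspec[OF Z3, of xs] that by (simp only: score mem_Collect_eq simp_thms)
      then show ?thesis using pos by (simp add: pos_le_divide_eq mult.commute)
    qed
    have quad: "frob m T D D / 2 - (trace_norm m T D)\<^sup>2 * C / real (k - 1) \<le> (\<Sum>i<N. (frob m T (X i) D)\<^sup>2) / N" for D
      by (rule quadratic_lower_bound_transfer[OF pos(1,2) k(1) upper lower])
    have mult: "\<bar>(\<Sum>i<N. \<eta> i * frob m T (X i) D) / N\<bar> \<le> lam / 4 * trace_norm m T D" for D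
    proof -
      \<comment> \<open>The multiplier process is linear in D, hence the pairing with this single
        random matrix; its values on the lattice control all D at once.\<close>
      let ?a = "\<lambda>i j. \<Sum>l<N. \<eta> l / N * X l i j"
      have a: "frob m T ?a D' = (\<Sum>i<N. \<eta> i * frob m T (X i) D') / N" for D'
      proof -
        have "frob m T ?a D' = (\<Sum>l<N. \<eta> l / N * frob m T (X l) D')"
          unfolding frob_sum_left frob_scale_left by (rule refl)
        then show ?thesis by (simp add: sum_divide_distrib)
      qed
      have "\<bar>frob m T ?a (?g x)\<bar> \<le> lam / 4" if x: "x \<in> ?I" for x
      proof -
        have "\<bar>\<Sum>i<N. \<eta> i / \<kappa> * frob m T (X i) (?g x)\<bar> \<le> noise_const L \<epsilon> q * sqrt (real N * d)"
          using bspec[OF Z1 x] by (simp only: score \<eta>_def d_def)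
        moreover have "(\<Sum>i<N. \<eta> i / \<kappa> * frob m T (X i) (?g x)) = (\<Sum>i<N. \<eta> i * frob m T (X i) (?g x)) / \<kappa>"
          by (simp add: sum_divide_distrib)
        ultimately have "\<bar>\<Sum>i<N. \<eta> i * frob m T (X i) (?g x)\<bar> / \<kappa> \<le> noise_const L \<epsilon> q * sqrt (real N * d)"
          using \<kappa> by (simp only: abs_divide abs_of_pos)
        then have "\<bar>\<Sum>i<N. \<eta> i * frob m T (X i) (?g x)\<bar> \<le> noise_const L \<epsilon> q * \<kappa> * sqrt (real N * d)"
          using \<kappa> by (simp add: pos_divide_le_eq mult_ac)
        then have "\<bar>frob m T ?a (?g x)\<bar> \<le> noise_const L \<epsilon> q * \<kappa> * sqrt (real N * d) / N"
          unfolding a by (simp add: divide_right_mono)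
        also have "sqrt (real N * d) = N * \<rho>"
          using pos by (simp add: \<rho>_def d_def real_sqrt_mult real_sqrt_divide field_simps)
        finally show ?thesis using pos by (simp add: lam)
      qed
      then show ?thesis
        using frob_le_trace_norm_if_lattice[OF pos(1,2), of ?a "lam / 4" D] unfolding a by simp
    qed
    show "?Q Z"
    proof (intro allI impI)
      fix A and p :: real assume est: "trace_norm_estimator m T N lam Z A" and p: "1 \<le> p \<and> p \<le> 2"
      have A: "A \<in> carrier_mat m T" using est by (simp add: trace_norm_estimator_def is_arg_min_def)
      let ?D = "\<lambda>i j. A $$ (i, j) - B $$ (i, j)"
      have tn: "schatten_norm 1 E = trace_norm m T (entries E)" if "E \<in> carrier_mat m T" for E
        unfolding trace_norm_def by (simp only: fun_mat_entries[OF that])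
      \<comment> \<open>The noise is prediction minus response while the loss uses response minus
        prediction, hence the sign of \<open>\<eta> i\<close>.\<close>
      have res: "snd (Z i) - trace_inner (fst (Z i)) E = frob m T (X i) (\<lambda>a b. B $$ (a, b) - E $$ (a, b)) - \<eta> i"
        if "i < N" "E \<in> carrier_mat m T" for i E
        using trace_inner_eq_frob[OF fst_carrier[OF joint iso sub L_nonneg ZP[OF that(1)]] that(2)]
          noise_eq[OF joint iso sub L_nonneg B ZP[OF that(1)]] L
        by (simp add: X_def \<eta>_def score frob_diff_right)
      have resA: "(snd (Z i) - trace_inner (fst (Z i)) A)\<^sup>2 = (\<eta> i + frob m T (X i) ?D)\<^sup>2" if "i < N" for i
        unfolding res[OF that A] by (simp add: frob_diff_right power2_commute algebra_simps)
      have resB: "(snd (Z i) - trace_inner (fst (Z i)) B)\<^sup>2 = (\<eta> i)\<^sup>2" if "i < N" for i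
        unfolding res[OF that B] by (simp add: frob_def dot_def)
      have "\<not> 1 / real N * (\<Sum>i<N. (snd (Z i) - trace_inner (fst (Z i)) B)\<^sup>2) + lam * schatten_norm 1 B
          < 1 / real N * (\<Sum>i<N. (snd (Z i) - trace_inner (fst (Z i)) A)\<^sup>2) + lam * schatten_norm 1 A"
        using est B unfolding trace_norm_estimator_def is_arg_min_def by blast
      then have opt: "(\<Sum>i<N. (\<eta> i + frob m T (X i) ?D)\<^sup>2) / N + lam * trace_norm m T (entries A)
          \<le> (\<Sum>i<N. (\<eta> i)\<^sup>2) / N + lam * trace_norm m T (entries B)"
        by (simp add: resA resB tn A B not_less cong: sum.cong_simp)
      have rank: "vec_space.rank m (fun_mat m T (entries V)) \<le> s"
        unfolding fun_mat_entries[OF V(1)] by (rule V(2))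
      have appr: "trace_norm m T (\<lambda>i j. B $$ (i, j) - V $$ (i, j)) \<le> \<kappa> * s * \<rho>"
        using approx by (simp add: trace_norm_def fun_mat_diff[OF B V(1)])
      have w0: "0 \<le> \<kappa> * s * \<rho>" using \<kappa> \<rho> by simp
      have h: "0 < real (k - 1)" using k(1) by simp
      note bounds = estimator_error_bound[OF pos(3,4) lam(2) w0 opt rank appr mult quad k(2) h less_imp_le[OF C]]
      define \<alpha> where "\<alpha> = (640 * noise_const L \<epsilon> q + 10) * \<kappa> * \<rho>"
      have \<alpha>: "0 < \<alpha>" using nc \<kappa> \<rho> by (simp add: \<alpha>_def add_pos_pos)
      have 1: "trace_norm m T ?D \<le> \<alpha> * s"
        using bounds(1) by (simp add: \<alpha>_def lam algebra_simps)
      have "\<kappa> * s * \<rho> / sqrt s = \<kappa> * \<rho> * (real s / sqrt s)" by simp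
      also have "real s / sqrt s = sqrt s" by (rule real_div_sqrt) simp
      finally have "16 * lam * sqrt s + \<kappa> * s * \<rho> / sqrt s = (64 * noise_const L \<epsilon> q + 1) * (\<kappa> * \<rho> * sqrt s)"
        by (simp add: lam algebra_simps)
      also have "\<dots> \<le> (640 * noise_const L \<epsilon> q + 10) * (\<kappa> * \<rho> * sqrt s)"
        using nc \<kappa> \<rho> by (intro mult_right_mono) auto
      finally have 2: "frob_norm m T ?D \<le> \<alpha> * sqrt s"
        using bounds(2) by (simp add: \<alpha>_def mult_ac)
      have "schatten_norm p (fun_mat m T ?D) \<le> 2 * \<alpha> * real s powr (1 / p)"
        using p pos by (intro schatten_norm_interpolate \<alpha> 1 2) auto
      then show "schatten_norm p (A - B) \<le> 2 * (640 * noise_const L \<epsilon> q + 10) * \<kappa> * real s powr (1 / p) * \<rho>"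
        unfolding fun_mat_diff[OF A B] by (simp add: \<alpha>_def mult_ac)
    qed
  qed simp
qed

theorem theorem1p7:
  fixes L \<delta> :: real
  assumes "0 < \<delta>" and "\<delta> < 1"
  shows "\<exists>c1 c2 :: real. 0 < c1 \<and> 0 < c2 \<and>
    (\<forall>q :: real. 2 < q \<longrightarrow>
      (\<exists>c3 c4 :: real. 0 < c3 \<and> 0 < c4 \<and>
        (\<forall>(m::nat) (T::nat) (N::nat) (s::nat) (P :: (real mat \<times> real) measure)
           (Astar :: real mat) (V :: real mat) (lam :: real).
           0 < m \<longrightarrow> 0 < T \<longrightarrow> 0 < N \<longrightarrow> 0 < s \<longrightarrow>
           joint_law m T P \<longrightarrow>
           isotropic m T (law_X m T P) \<longrightarrow>
           subgaussian L m T (law_X m T P) \<longrightarrow>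
           in_Lp P 2 snd \<longrightarrow>
           is_risk_minimizer m T P Astar \<longrightarrow>
           in_Lp P q (noise Astar) \<longrightarrow>
           V \<in> carrier_mat m T \<longrightarrow>
           vec_space.rank m V \<le> s \<longrightarrow>
           schatten_norm 1 (Astar - V)
             \<le> c1 * Lp_norm P q (noise Astar) * real s * sqrt (real (max m T) / real N) \<longrightarrow>
           real N \<ge> c2 * real s * real (max m T) \<longrightarrow>
           lam = c3 * Lp_norm P q (noise Astar) * sqrt (real (max m T) / real N) \<longrightarrow>
           0 < lam \<longrightarrow>
           (\<exists>E \<in> sets (sample_law N P).
              measure (sample_law N P) E \<ge> 1 - \<delta> \<and>
              (\<forall>Z\<in>E. \<forall>Ahat. trace_norm_estimator m T N lam Z Ahat \<longrightarrow>
                 (\<forall>p::real. 1 \<le> p \<and> p \<le> 2 \<longrightarrow>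
                    schatten_norm p (Ahat - Astar)
                      \<le> c4 * Lp_norm P q (noise Astar) * real s powr (1 / p)
                          * sqrt (real (max m T) / real N)))))))"
proof -
  define L' where "L' = max L 1"
  define \<epsilon> where "\<epsilon> = \<delta> / 5"
  have L': "1 \<le> L'" "L \<le> L'" "0 \<le> L'" by (auto simp: L'_def)
  have \<epsilon>: "0 < \<epsilon>" "\<epsilon> \<le> 1" and \<epsilon>5: "5 * \<epsilon> = \<delta>" using assms by (auto simp: \<epsilon>_def)
  \<comment> \<open>c1 = 1 suffices, since the approximation error enters the bounds linearly and is
    of the order of lam s. c2 must be given before q, and \<open>sample_const\<close> involves only
    L' and \<epsilon>; q enters through \<open>noise_const\<close>, that is, through c3 and
    c4.\<close>
  show ?thesis
  proof (rule exI[of _ 1], rule exI[of _ "sample_const L' \<epsilon>"], intro conjI allI impI, goal_cases)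
    case 2
    show ?case using sample_const_ge_1[OF L'(1) \<epsilon>] by linarith
  next
    case (3 q)
    note q = this
    have nc: "0 < noise_const L' \<epsilon> q" by (rule noise_const_pos[OF L'(1) \<epsilon> q])
    show ?case
    proof (rule exI[of _ "4 * noise_const L' \<epsilon> q"], rule exI[of _ "2 * (640 * noise_const L' \<epsilon> q + 10)"],
        intro conjI allI impI, goal_cases)
      case (3 m T N s P Astar V lam)
      note joint = 3(5) and iso = 3(6) and sub = subgaussian_mono[OF 3(7) L'(2)]
      have "prob_space (sample N P)" by (rule prob_space_sample[OF prob_space_law[OF joint iso sub L'(3)]])
      from holds_whp_event[OF this trace_norm_estimator_whp[OF L'(1) \<epsilon> q 3(1-4) joint iso sub
          3(9-12) 3(13)[unfolded mult_1_left] 3(14-16)]]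
      show ?case by (simp only: sample_law_def \<epsilon>5)
    qed (use nc in auto)
  qed simp
qed

end
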